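(* Let $\mathsf{T}$ be a monad on an abelian category $\mathcal{B}$, let $\mathcal{B}^{\mathsf{T}}$ be the Eilenberg-Moore category of $\mathsf{T}$, and let $U^{\mathsf{T}}\colon \mathcal{B}^{\mathsf{T}}\to \mathcal{B}$ be the forgetful functor with left adjoint $F^{\mathsf{T}}\colon \mathcal{B}\to \mathcal{B}^{\mathsf{T}}$. Then the adjoint pair $F^{\mathsf{T}}\dashv U^{\mathsf{T}}$ has a Nakayama functor if and only if there exists a comonad $\mathsf{S}$ on $\mathcal{B}$ and an ambidextrous adjunction $\mathsf{S}\dashv \mathsf{T}\dashv \mathsf{S}$ of monads and comonads.
   Context: All categories are preadditive and all functors are additive. A monad on $\mathcal{B}$ is a triple $\mathsf{T}=(T,\eta,\mu)$ with $T\colon\mathcal{B}\to\mathcal{B}$, unit $\eta\colon 1\to T$, multiplication $\mu\colon TT\to T$ (associative and unital); a comonad is a triple $\mathsf{S}=(S,\epsilon,\Delta)$ with $\epsilon\colon S\to 1$ and $\Delta\colon S\to SS$ (coassociative and counital). Objects of $\mathcal{B}^{\mathsf{T}}$ are the $\mathsf{T}$-modules, i.e. morphisms $s\colon T(B)\to B$ with $s\circ\eta_B=1_B$ and $s\circ\mu_B=s\circ T(s)$; a morphism from $s_1\colon T(B_1)\to B_1$ to $s_2\colon T(B_2)\to B_2$ is $f\colon B_1\to B_2$ in $\mathcal{B}$ with $f\circ s_1=s_2\circ T(f)$. Given adjunctions $L_1\dashv R_1$ and $L_2\dashv R_2$ from $\mathcal{D}$ to $\mathcal{E}$ with adjunction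 isomorphisms $\phi_i\colon \mathcal{E}(L_i(D),E)\to\mathcal{D}(D,R_i(E))$, natural transformations $\sigma\colon L_1\to L_2$ and $\tau\colon R_2\to R_1$ are conjugate if $\phi_1(h\circ\sigma_D)=\tau_E\circ\phi_2(h)$ for all $h\colon L_2(D)\to E$. For composites $SS$ and $TT$ one uses the composite adjunctions. Adjunctions of monads and comonads: $\mathsf{S}\dashv\mathsf{T}$ means that $S$ is left adjoint to $T$ in such a way that $\Delta$ and $\mu$ are conjugate and $\epsilon$ and $\eta$ are conjugate. $\mathsf{T}\dashv\mathsf{S}$ means that $S$ is right adjoint to $T$ in such a way that $\Delta$ and $\mu$ are conjugate and $\epsilon$ and $\eta$ are conjugate. An ambidextrous adjunction $\mathsf{S}\dashv\mathsf{T}\dashv\mathsf{S}$ means that both hold for the same comonad $\mathsf{S}$. Nakayama functor: let $\mathcal{D}$ be an additive category, $\mathcal{A}$ an abelian category, and $f^*\colon\mathcal{A}\to\mathcal{D}$ a faithful functor with left adjoint $f_!\colon\mathcal{D}\to\mathcal{A}$. A Nakayama functor relative to $f_!\dashv f^*$ is a functor $\nu\colon\mathcal{A}\to\mathcal{A}$ with a right adjoint $\nu^-$ such that (1) $\nu\circ f_!$ is right adjoint to $f^*$; (2) the unit of $\nu\dashv\nu^-$ precomposed with $f_!$ is an isomorphism $f_!\to\nu^-\circ\nu\circ f_!$. One says $f_!\dashv f^*$ has a Nakayama functor if such a $\nu$ exists. Here this is applied with $\mathcal{A}=\mathcal{B}^{\mathsf{T}}$, $f^*=U^{\mathsf{T}}$,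 $f_!=F^{\mathsf{T}}$; the assertion that $F^{\mathsf{T}}\dashv U^{\mathsf{T}}$ has a Nakayama functor includes that $\mathcal{B}^{\mathsf{T}}$ is abelian. *)

theory Defs
  imports "HOL-Algebra.Group"
begin

section \<open>Preadditive, additive and abelian categories\<close>

text \<open>Composition is written in the usual order, so \<open>g \<cdot> f\<close> is meaningful when
  \<open>Cod f = Dom g\<close>. All fields are unspecified outside the sets of objects and arrows.\<close>

record ('o, 'a) cat =
  Obj :: "'o set"
  Arr :: "'a set"
  Dom :: "'a \<Rightarrow> 'o"
  Cod :: "'a \<Rightarrow> 'o"
  Ident :: "'o \<Rightarrow> 'a"
  Comp :: "'a \<Rightarrow> 'a \<Rightarrow> 'a" (infixl "\<cdot>\<index>" 70)
  Add :: "'a \<Rightarrow> 'a \<Rightarrow> 'a"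
  Zero :: "'o \<Rightarrow> 'o \<Rightarrow> 'a"

definition Hom :: "('o, 'a) cat \<Rightarrow> 'o \<Rightarrow> 'o \<Rightarrow> 'a set" where
  "Hom C x y = {f \<in> Arr C. Dom C f = x \<and> Cod C f = y}"

abbreviation Hom_group :: "('o, 'a) cat \<Rightarrow> 'o \<Rightarrow> 'o \<Rightarrow> 'a monoid" where
  "Hom_group C x y \<equiv> \<lparr>carrier = Hom C x y, mult = Add C, one = Zero C x y\<rparr>"

locale preadditive_category =
  fixes C :: "('o, 'a) cat" (structure)
  assumes dom_obj: "f \<in> Arr C \<Longrightarrow> Dom C f \<in> Obj C"
    and cod_obj: "f \<in> Arr C \<Longrightarrow> Cod C f \<in> Obj C"
    and ident_hom: "x \<in> Obj C \<Longrightarrow> Ident C x \<in> Hom C x x"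
    and comp_hom: "\<lbrakk>f \<in> Hom C x y; g \<in> Hom C y z\<rbrakk> \<Longrightarrow> g \<cdot> f \<in> Hom C x z"
    and comp_ident_right: "f \<in> Hom C x y \<Longrightarrow> f \<cdot> Ident C x = f"
    and comp_ident_left: "f \<in> Hom C x y \<Longrightarrow> Ident C y \<cdot> f = f"
    and comp_assoc: "\<lbrakk>f \<in> Hom C w x; g \<in> Hom C x y; h \<in> Hom C y z\<rbrakk>
      \<Longrightarrow> h \<cdot> (g \<cdot> f) = (h \<cdot> g) \<cdot> f"
    and hom_group: "\<lbrakk>x \<in> Obj C; y \<in> Obj C\<rbrakk> \<Longrightarrow> comm_group (Hom_group C x y)"
    and comp_add_right: "\<lbrakk>f \<in> Hom C x y; f' \<in> Hom C x y; g \<in> Hom C y z\<rbrakk>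
      \<Longrightarrow> g \<cdot> Add C f f' = Add C (g \<cdot> f) (g \<cdot> f')"
    and comp_add_left: "\<lbrakk>f \<in> Hom C x y; g \<in> Hom C y z; g' \<in> Hom C y z\<rbrakk>
      \<Longrightarrow> Add C g g' \<cdot> f = Add C (g \<cdot> f) (g' \<cdot> f)"

definition zero_object :: "('o, 'a) cat \<Rightarrow> 'o \<Rightarrow> bool" where
  "zero_object C z \<longleftrightarrow> z \<in> Obj C \<and>
     (\<forall>x \<in> Obj C. (\<exists>!f. f \<in> Hom C z x) \<and> (\<exists>!f. f \<in> Hom C x z))"

definition biproduct ::
  "('o, 'a) cat \<Rightarrow> 'o \<Rightarrow> 'o \<Rightarrow> 'o \<Rightarrow> 'a \<Rightarrow> 'a \<Rightarrow> 'a \<Rightarrow> 'a \<Rightarrow> bool" where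
  "biproduct C x y p i1 i2 p1 p2 \<longleftrightarrow> p \<in> Obj C \<and>
     i1 \<in> Hom C x p \<and> i2 \<in> Hom C y p \<and> p1 \<in> Hom C p x \<and> p2 \<in> Hom C p y \<and>
     p1 \<cdot>\<^bsub>C\<^esub> i1 = Ident C x \<and> p2 \<cdot>\<^bsub>C\<^esub> i2 = Ident C y \<and>
     p2 \<cdot>\<^bsub>C\<^esub> i1 = Zero C x y \<and> p1 \<cdot>\<^bsub>C\<^esub> i2 = Zero C y x \<and>
     Add C (i1 \<cdot>\<^bsub>C\<^esub> p1) (i2 \<cdot>\<^bsub>C\<^esub> p2) = Ident C p"

locale additive_category = preadditive_category +
  assumes ex_zero_object: "\<exists>z. zero_object C z"
    and ex_biproduct: "\<lbrakk>x \<in> Obj C; y \<in> Obj C\<rbrakk>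
      \<Longrightarrow> \<exists>p i1 i2 p1 p2. biproduct C x y p i1 i2 p1 p2"

definition is_mono :: "('o, 'a) cat \<Rightarrow> 'a \<Rightarrow> bool" where
  "is_mono C m \<longleftrightarrow> m \<in> Arr C \<and>
     (\<forall>x f g. f \<in> Hom C x (Dom C m) \<and> g \<in> Hom C x (Dom C m) \<and> m \<cdot>\<^bsub>C\<^esub> f = m \<cdot>\<^bsub>C\<^esub> g \<longrightarrow> f = g)"

definition is_epi :: "('o, 'a) cat \<Rightarrow> 'a \<Rightarrow> bool" where
  "is_epi C e \<longleftrightarrow> e \<in> Arr C \<and>
     (\<forall>x f g. f \<in> Hom C (Cod C e) x \<and> g \<in> Hom C (Cod C e) x \<and> f \<cdot>\<^bsub>C\<^esub> e = g \<cdot>\<^bsub>C\<^esub> e \<longrightarrow> f = g)"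

definition is_iso :: "('o, 'a) cat \<Rightarrow> 'a \<Rightarrow> bool" where
  "is_iso C f \<longleftrightarrow> f \<in> Arr C \<and>
     (\<exists>g \<in> Hom C (Cod C f) (Dom C f).
        g \<cdot>\<^bsub>C\<^esub> f = Ident C (Dom C f) \<and> f \<cdot>\<^bsub>C\<^esub> g = Ident C (Cod C f))"

definition is_kernel :: "('o, 'a) cat \<Rightarrow> 'a \<Rightarrow> 'a \<Rightarrow> bool" where
  "is_kernel C f k \<longleftrightarrow> f \<in> Arr C \<and> k \<in> Arr C \<and> Cod C k = Dom C f \<and>
     f \<cdot>\<^bsub>C\<^esub> k = Zero C (Dom C k) (Cod C f) \<and>
     (\<forall>x. \<forall>g \<in> Hom C x (Dom C f). f \<cdot>\<^bsub>C\<^esub> g = Zero C x (Cod C f) \<longrightarrow>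
        (\<exists>!u. u \<in> Hom C x (Dom C k) \<and> k \<cdot>\<^bsub>C\<^esub> u = g))"

definition is_cokernel :: "('o, 'a) cat \<Rightarrow> 'a \<Rightarrow> 'a \<Rightarrow> bool" where
  "is_cokernel C f c \<longleftrightarrow> f \<in> Arr C \<and> c \<in> Arr C \<and> Dom C c = Cod C f \<and>
     c \<cdot>\<^bsub>C\<^esub> f = Zero C (Dom C f) (Cod C c) \<and>
     (\<forall>y. \<forall>g \<in> Hom C (Cod C f) y. g \<cdot>\<^bsub>C\<^esub> f = Zero C (Dom C f) y \<longrightarrow>
        (\<exists>!u. u \<in> Hom C (Cod C c) y \<and> u \<cdot>\<^bsub>C\<^esub> c = g))"

locale abelian_category = additive_category +
  assumes ex_kernel: "f \<in> Arr C \<Longrightarrow> \<exists>k. is_kernel C f k"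
    and ex_cokernel: "f \<in> Arr C \<Longrightarrow> \<exists>c. is_cokernel C f c"
    and mono_is_kernel: "is_mono C m \<Longrightarrow> \<exists>f. is_kernel C f m"
    and epi_is_cokernel: "is_epi C e \<Longrightarrow> \<exists>f. is_cokernel C f e"


section \<open>Additive functors and natural transformations\<close>

record ('o1, 'a1, 'o2, 'a2) func =
  fobj :: "'o1 \<Rightarrow> 'o2"
  farr :: "'a1 \<Rightarrow> 'a2"

definition id_func :: "('o, 'a, 'o, 'a) func" where
  "id_func = \<lparr>fobj = (\<lambda>x. x), farr = (\<lambda>f. f)\<rparr>"

definition comp_func ::
  "('o2, 'a2, 'o3, 'a3) func \<Rightarrow> ('o1, 'a1, 'o2, 'a2) func \<Rightarrow> ('o1, 'a1, 'o3, 'a3) func"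
  (infixl "\<circ>\<^sub>F" 55) where
  "G \<circ>\<^sub>F F = \<lparr>fobj = fobj G \<circ> fobj F, farr = farr G \<circ> farr F\<rparr>"

locale additive_functor = C: preadditive_category C + D: preadditive_category D
  for C :: "('o1, 'a1) cat" and D :: "('o2, 'a2) cat" +
  fixes F :: "('o1, 'a1, 'o2, 'a2) func"
  assumes fobj_obj: "x \<in> Obj C \<Longrightarrow> fobj F x \<in> Obj D"
    and farr_hom: "f \<in> Hom C x y \<Longrightarrow> farr F f \<in> Hom D (fobj F x) (fobj F y)"
    and farr_ident: "x \<in> Obj C \<Longrightarrow> farr F (Ident C x) = Ident D (fobj F x)"
    and farr_comp: "\<lbrakk>f \<in> Hom C x y; g \<in> Hom C y z\<rbrakk>
      \<Longrightarrow> farr F (g \<cdot>\<^bsub>C\<^esub> f) = farr F g \<cdot>\<^bsub>D\<^esub> farr F f"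
    and farr_add: "\<lbrakk>f \<in> Hom C x y; g \<in> Hom C x y\<rbrakk>
      \<Longrightarrow> farr F (Add C f g) = Add D (farr F f) (farr F g)"

definition faithful_functor ::
  "('o1, 'a1) cat \<Rightarrow> ('o2, 'a2) cat \<Rightarrow> ('o1, 'a1, 'o2, 'a2) func \<Rightarrow> bool" where
  "faithful_functor C D F \<longleftrightarrow> additive_functor C D F \<and>
     (\<forall>x \<in> Obj C. \<forall>y \<in> Obj C. inj_on (farr F) (Hom C x y))"

locale nat_trans = F: additive_functor C D F + G: additive_functor C D G
  for C :: "('o1, 'a1) cat" and D :: "('o2, 'a2) cat"
    and F G :: "('o1, 'a1, 'o2, 'a2) func" +
  fixes \<alpha> :: "'o1 \<Rightarrow> 'a2"
  assumes component_hom: "x \<in> Obj C \<Longrightarrow> \<alpha> x \<in> Hom D (fobj F x) (fobj G x)"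
    and natural: "f \<in> Hom C x y \<Longrightarrow> \<alpha> y \<cdot>\<^bsub>D\<^esub> farr F f = farr G f \<cdot>\<^bsub>D\<^esub> \<alpha> x"


section \<open>Adjunctions and conjugate transformations\<close>

locale adjunction = L: additive_functor D E L + R: additive_functor E D R
  for D :: "('o1, 'a1) cat" and E :: "('o2, 'a2) cat"
    and L :: "('o1, 'a1, 'o2, 'a2) func" and R :: "('o2, 'a2, 'o1, 'a1) func" +
  fixes \<phi> :: "'o1 \<Rightarrow> 'o2 \<Rightarrow> 'a2 \<Rightarrow> 'a1"
  assumes adj_bij: "\<lbrakk>d \<in> Obj D; e \<in> Obj E\<rbrakk>
      \<Longrightarrow> bij_betw (\<phi> d e) (Hom E (fobj L d) e) (Hom D d (fobj R e))"
    and adj_natural_left: "\<lbrakk>u \<in> Hom D d' d; e \<in> Obj E; h \<in> Hom E (fobj L d) e\<rbrakk>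
      \<Longrightarrow> \<phi> d' e (h \<cdot>\<^bsub>E\<^esub> farr L u) = \<phi> d e h \<cdot>\<^bsub>D\<^esub> u"
    and adj_natural_right: "\<lbrakk>d \<in> Obj D; v \<in> Hom E e e'; h \<in> Hom E (fobj L d) e\<rbrakk>
      \<Longrightarrow> \<phi> d e' (v \<cdot>\<^bsub>E\<^esub> h) = farr R v \<cdot>\<^bsub>D\<^esub> \<phi> d e h"

definition adj_unit ::
  "('o2, 'a2) cat \<Rightarrow> ('o1, 'a1, 'o2, 'a2) func \<Rightarrow> ('o1 \<Rightarrow> 'o2 \<Rightarrow> 'a2 \<Rightarrow> 'a1) \<Rightarrow> 'o1 \<Rightarrow> 'a1" where
  "adj_unit E L \<phi> d = \<phi> d (fobj L d) (Ident E (fobj L d))"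

definition id_adj :: "'o \<Rightarrow> 'o \<Rightarrow> 'a \<Rightarrow> 'a" where
  "id_adj d e h = h"

text \<open>If \<open>L\<close> is left adjoint to \<open>R\<close> from \<open>D\<close> to \<open>E\<close>, and \<open>L'\<close> is left adjoint to \<open>R'\<close> from \<open>E\<close>
  to \<open>K\<close>, then \<open>L' \<circ>\<^sub>F L\<close> is left adjoint to \<open>R \<circ>\<^sub>F R'\<close> via
  \<open>K(L'(L d), k) \<rightarrow> E(L d, R' k) \<rightarrow> D(d, R(R' k))\<close>.\<close>

definition comp_adj ::
  "('o1, 'a1, 'o2, 'a2) func \<Rightarrow> ('o3, 'a3, 'o2, 'a2) func \<Rightarrow>
   ('o1 \<Rightarrow> 'o2 \<Rightarrow> 'a2 \<Rightarrow> 'a1) \<Rightarrow> ('o2 \<Rightarrow> 'o3 \<Rightarrow> 'a3 \<Rightarrow> 'a2) \<Rightarrow> 'o1 \<Rightarrow> 'o3 \<Rightarrow> 'a3 \<Rightarrow> 'a1" where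
  "comp_adj L R' \<phi> \<phi>' d k h = \<phi> d (fobj R' k) (\<phi>' (fobj L d) k h)"

definition conjugate ::
  "('o1, 'a1) cat \<Rightarrow> ('o2, 'a2) cat \<Rightarrow>
   ('o1, 'a1, 'o2, 'a2) func \<Rightarrow> ('o2, 'a2, 'o1, 'a1) func \<Rightarrow> ('o1 \<Rightarrow> 'o2 \<Rightarrow> 'a2 \<Rightarrow> 'a1) \<Rightarrow>
   ('o1, 'a1, 'o2, 'a2) func \<Rightarrow> ('o2, 'a2, 'o1, 'a1) func \<Rightarrow> ('o1 \<Rightarrow> 'o2 \<Rightarrow> 'a2 \<Rightarrow> 'a1) \<Rightarrow>
   ('o1 \<Rightarrow> 'a2) \<Rightarrow> ('o2 \<Rightarrow> 'a1) \<Rightarrow> bool" where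
  "conjugate D E L1 R1 \<phi>1 L2 R2 \<phi>2 \<sigma> \<tau> \<longleftrightarrow>
     adjunction D E L1 R1 \<phi>1 \<and> adjunction D E L2 R2 \<phi>2 \<and>
     nat_trans D E L1 L2 \<sigma> \<and> nat_trans E D R2 R1 \<tau> \<and>
     (\<forall>d \<in> Obj D. \<forall>e \<in> Obj E. \<forall>h \<in> Hom E (fobj L2 d) e.
        \<phi>1 d e (h \<cdot>\<^bsub>E\<^esub> \<sigma> d) = \<tau> e \<cdot>\<^bsub>D\<^esub> \<phi>2 d e h)"


section \<open>Monads, comonads and adjunctions between them\<close>

locale monad = T: additive_functor B B T
    + \<eta>: nat_trans B B id_func T \<eta> + \<mu>: nat_trans B B "T \<circ>\<^sub>F T" T \<mu>
  for B :: "('o, 'a) cat" and T :: "('o, 'a, 'o, 'a) func" and \<eta> \<mu> :: "'o \<Rightarrow> 'a" +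
  assumes mult_assoc: "x \<in> Obj B \<Longrightarrow> \<mu> x \<cdot>\<^bsub>B\<^esub> farr T (\<mu> x) = \<mu> x \<cdot>\<^bsub>B\<^esub> \<mu> (fobj T x)"
    and mult_unit_left: "x \<in> Obj B \<Longrightarrow> \<mu> x \<cdot>\<^bsub>B\<^esub> \<eta> (fobj T x) = Ident B (fobj T x)"
    and mult_unit_right: "x \<in> Obj B \<Longrightarrow> \<mu> x \<cdot>\<^bsub>B\<^esub> farr T (\<eta> x) = Ident B (fobj T x)"

locale comonad = S: additive_functor B B S
    + \<epsilon>: nat_trans B B S id_func \<epsilon> + \<Delta>: nat_trans B B S "S \<circ>\<^sub>F S" \<Delta>
  for B :: "('o, 'a) cat" and S :: "('o, 'a, 'o, 'a) func" and \<epsilon> \<Delta> :: "'o \<Rightarrow> 'a" +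
  assumes comult_coassoc: "x \<in> Obj B \<Longrightarrow> farr S (\<Delta> x) \<cdot>\<^bsub>B\<^esub> \<Delta> x = \<Delta> (fobj S x) \<cdot>\<^bsub>B\<^esub> \<Delta> x"
    and comult_counit_left: "x \<in> Obj B \<Longrightarrow> \<epsilon> (fobj S x) \<cdot>\<^bsub>B\<^esub> \<Delta> x = Ident B (fobj S x)"
    and comult_counit_right: "x \<in> Obj B \<Longrightarrow> farr S (\<epsilon> x) \<cdot>\<^bsub>B\<^esub> \<Delta> x = Ident B (fobj S x)"

definition comonad_left_adjoint_monad ::
  "('o, 'a) cat \<Rightarrow> ('o, 'a, 'o, 'a) func \<Rightarrow> ('o \<Rightarrow> 'a) \<Rightarrow> ('o \<Rightarrow> 'a) \<Rightarrow>
   ('o, 'a, 'o, 'a) func \<Rightarrow> ('o \<Rightarrow> 'a) \<Rightarrow> ('o \<Rightarrow> 'a) \<Rightarrow> bool" where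
  "comonad_left_adjoint_monad B S \<epsilon> \<Delta> T \<eta> \<mu> \<longleftrightarrow> comonad B S \<epsilon> \<Delta> \<and> monad B T \<eta> \<mu> \<and>
     (\<exists>\<phi>. adjunction B B S T \<phi> \<and>
        conjugate B B S T \<phi> (S \<circ>\<^sub>F S) (T \<circ>\<^sub>F T) (comp_adj S T \<phi> \<phi>) \<Delta> \<mu> \<and>
        conjugate B B S T \<phi> id_func id_func id_adj \<epsilon> \<eta>)"

definition monad_left_adjoint_comonad ::
  "('o, 'a) cat \<Rightarrow> ('o, 'a, 'o, 'a) func \<Rightarrow> ('o \<Rightarrow> 'a) \<Rightarrow> ('o \<Rightarrow> 'a) \<Rightarrow>
   ('o, 'a, 'o, 'a) func \<Rightarrow> ('o \<Rightarrow> 'a) \<Rightarrow> ('o \<Rightarrow> 'a) \<Rightarrow> bool" where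
  "monad_left_adjoint_comonad B T \<eta> \<mu> S \<epsilon> \<Delta> \<longleftrightarrow> monad B T \<eta> \<mu> \<and> comonad B S \<epsilon> \<Delta> \<and>
     (\<exists>\<psi>. adjunction B B T S \<psi> \<and>
        conjugate B B (T \<circ>\<^sub>F T) (S \<circ>\<^sub>F S) (comp_adj T S \<psi> \<psi>) T S \<psi> \<mu> \<Delta> \<and>
        conjugate B B id_func id_func id_adj T S \<psi> \<eta> \<epsilon>)"

definition ambidextrous_adjunction ::
  "('o, 'a) cat \<Rightarrow> ('o, 'a, 'o, 'a) func \<Rightarrow> ('o \<Rightarrow> 'a) \<Rightarrow> ('o \<Rightarrow> 'a) \<Rightarrow>
   ('o, 'a, 'o, 'a) func \<Rightarrow> ('o \<Rightarrow> 'a) \<Rightarrow> ('o \<Rightarrow> 'a) \<Rightarrow> bool" where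
  "ambidextrous_adjunction B S \<epsilon> \<Delta> T \<eta> \<mu> \<longleftrightarrow>
     comonad_left_adjoint_monad B S \<epsilon> \<Delta> T \<eta> \<mu> \<and> monad_left_adjoint_comonad B T \<eta> \<mu> S \<epsilon> \<Delta>"


section \<open>The Eilenberg-Moore category\<close>

text \<open>A module is a pair of its underlying object and its structure morphism. A module morphism is
  stored together with its source and target, so that hom-sets between different modules are
  disjoint.\<close>

type_synonym ('o, 'a) em_arr = "('o \<times> 'a) \<times> 'a \<times> ('o \<times> 'a)"

definition em_module ::
  "('o, 'a) cat \<Rightarrow> ('o, 'a, 'o, 'a) func \<Rightarrow> ('o \<Rightarrow> 'a) \<Rightarrow> ('o \<Rightarrow> 'a) \<Rightarrow> 'o \<Rightarrow> 'a \<Rightarrow> bool" where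
  "em_module B T \<eta> \<mu> x s \<longleftrightarrow> x \<in> Obj B \<and> s \<in> Hom B (fobj T x) x \<and>
     s \<cdot>\<^bsub>B\<^esub> \<eta> x = Ident B x \<and> s \<cdot>\<^bsub>B\<^esub> \<mu> x = s \<cdot>\<^bsub>B\<^esub> farr T s"

definition em_category ::
  "('o, 'a) cat \<Rightarrow> ('o, 'a, 'o, 'a) func \<Rightarrow> ('o \<Rightarrow> 'a) \<Rightarrow> ('o \<Rightarrow> 'a) \<Rightarrow>
   ('o \<times> 'a, ('o, 'a) em_arr) cat" where
  "em_category B T \<eta> \<mu> =
    \<lparr>Obj = {(x, s). em_module B T \<eta> \<mu> x s},
     Arr = {((x, s), f, (y, t)). em_module B T \<eta> \<mu> x s \<and> em_module B T \<eta> \<mu> y t \<and>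
              f \<in> Hom B x y \<and> f \<cdot>\<^bsub>B\<^esub> s = t \<cdot>\<^bsub>B\<^esub> farr T f},
     Dom = (\<lambda>(m, f, n). m),
     Cod = (\<lambda>(m, f, n). n),
     Ident = (\<lambda>m. (m, Ident B (fst m), m)),
     Comp = (\<lambda>(m', g, n') (m, f, n). (m, g \<cdot>\<^bsub>B\<^esub> f, n')),
     Add = (\<lambda>(m, f, n) (m', g, n'). (m, Add B f g, n)),
     Zero = (\<lambda>m n. (m, Zero B (fst m) (fst n), n))\<rparr>"

definition em_forgetful :: "('o \<times> 'a, ('o, 'a) em_arr, 'o, 'a) func" where
  "em_forgetful = \<lparr>fobj = fst, farr = (\<lambda>(m, f, n). f)\<rparr>"

definition em_free ::
  "('o, 'a) cat \<Rightarrow> ('o, 'a, 'o, 'a) func \<Rightarrow> ('o \<Rightarrow> 'a) \<Rightarrow> ('o, 'a, 'o \<times> 'a, ('o, 'a) em_arr) func" where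
  "em_free B T \<mu> =
    \<lparr>fobj = (\<lambda>x. (fobj T x, \<mu> x)),
     farr = (\<lambda>f. ((fobj T (Dom B f), \<mu> (Dom B f)), farr T f, (fobj T (Cod B f), \<mu> (Cod B f))))\<rparr>"

definition em_adj ::
  "('o, 'a) cat \<Rightarrow> ('o \<Rightarrow> 'a) \<Rightarrow> 'o \<Rightarrow> 'o \<times> 'a \<Rightarrow> ('o, 'a) em_arr \<Rightarrow> 'a" where
  "em_adj B \<eta> x m h = farr em_forgetful h \<cdot>\<^bsub>B\<^esub> \<eta> x"


section \<open>Nakayama functors\<close>

locale nakayama_setting =
  D: additive_category D + A: abelian_category A + adj: adjunction D A fl fs \<phi>
  for D :: "('o1, 'a1) cat" and A :: "('o2, 'a2) cat"
    and fl :: "('o1, 'a1, 'o2, 'a2) func" and fs :: "('o2, 'a2, 'o1, 'a1) func"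
    and \<phi> :: "'o1 \<Rightarrow> 'o2 \<Rightarrow> 'a2 \<Rightarrow> 'a1" +
  assumes faithful: "faithful_functor A D fs"

definition nakayama_functor ::
  "('o1, 'a1) cat \<Rightarrow> ('o2, 'a2) cat \<Rightarrow>
   ('o1, 'a1, 'o2, 'a2) func \<Rightarrow> ('o2, 'a2, 'o1, 'a1) func \<Rightarrow> ('o1 \<Rightarrow> 'o2 \<Rightarrow> 'a2 \<Rightarrow> 'a1) \<Rightarrow>
   ('o2, 'a2, 'o2, 'a2) func \<Rightarrow> bool" where
  "nakayama_functor D A fl fs \<phi> \<nu> \<longleftrightarrow> nakayama_setting D A fl fs \<phi> \<and>
     additive_functor A A \<nu> \<and>
     (\<exists>\<psi>. adjunction A D fs (\<nu> \<circ>\<^sub>F fl) \<psi>) \<and>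
     (\<exists>\<nu>' \<theta>. adjunction A A \<nu> \<nu>' \<theta> \<and>
        (\<forall>d \<in> Obj D. is_iso A (adj_unit A \<nu> \<theta> (fobj fl d))))"

definition has_nakayama_functor ::
  "('o1, 'a1) cat \<Rightarrow> ('o2, 'a2) cat \<Rightarrow>
   ('o1, 'a1, 'o2, 'a2) func \<Rightarrow> ('o2, 'a2, 'o1, 'a1) func \<Rightarrow> ('o1 \<Rightarrow> 'o2 \<Rightarrow> 'a2 \<Rightarrow> 'a1) \<Rightarrow> bool" where
  "has_nakayama_functor D A fl fs \<phi> \<longleftrightarrow> (\<exists>\<nu>. nakayama_functor D A fl fs \<phi> \<nu>)"

end

theory Submission
  imports Defs
begin

text \<open>
  Write \<open>M\<close> for the Eilenberg-Moore category and \<open>F\<close>, \<open>U\<close> for the free and the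
  forgetful functor, so that \<open>T = U \<circ>\<^sub>F F\<close>.

  Suppose that \<open>\<nu>\<close> is a Nakayama functor, with right adjoint \<open>\<nu>'\<close>. The adjunction of \<open>U\<close> and
  \<open>\<nu> \<circ>\<^sub>F F\<close> makes \<open>S = U \<circ>\<^sub>F \<nu> \<circ>\<^sub>F F\<close> a comonad, and composing it with the
  adjunction of \<open>F\<close> and \<open>U\<close> shows that \<open>S\<close> is right adjoint to \<open>T\<close>. That the unit of \<open>\<nu>\<close> and
  \<open>\<nu>'\<close> is invertible on free modules means that \<open>\<nu>\<close> is fully faithful on them, so
  \<open>B(S x, y) \<cong> M(\<nu> (F x), \<nu> (F y)) \<cong> M(F x, F y) \<cong> B(x, T y)\<close>, and \<open>S\<close> is left adjoint to
  \<open>T\<close> as well. The conjugacy conditions hold because \<open>\<nu>\<close> respects composition and identities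
  (\<open>ambidextrous_if_fully_faithful_on_free\<close>).

  Conversely let \<open>S\<close> be a comonad that is adjoint to \<open>T\<close> on both sides. The functor \<open>T\<close> preserves
  cokernels because it is a left adjoint; hence kernels and cokernels of module morphisms can be
  formed in \<open>B\<close>, and \<open>M\<close> is abelian (\<open>em_abelian\<close>). Transposing structure morphisms
  along the adjunction that has \<open>S\<close> on the right turns modules into comodules for \<open>S\<close>. Therefore each
  \<open>S x\<close> is a module, the cofree one, and \<open>cofree\<close> is right adjoint to \<open>U\<close>. The other adjunction
  provides a second, right action \<open>S (T x) \<rightarrow> S x\<close>. The Nakayama functor is the tensor product
  \<open>\<nu> (x, s) = S \<otimes>\<^sub>T x\<close>, the coequalizer in \<open>M\<close> of \<open>S s\<close> and of the right action. Morphisms from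
  it to \<open>n = (y, t)\<close> are the arrows \<open>S x \<rightarrow> y\<close> that are linear on the left and balanced on the right.
  Balancedness of such an arrow says that its transpose \<open>x \<rightarrow> T y\<close> is linear, and linearity
  says that this transpose is equalized by two module morphisms \<open>F y \<rightarrow> F (S y)\<close>. So the
  bimodule of these arrows is represented on both sides, by cokernels and by kernels, which yields
  \<open>\<nu>\<close> and a right adjoint \<open>\<nu>'\<close> at once (\<open>representable_adjunction\<close>). On a free module the right
  action itself is universal in both variables (\<open>act_universal_from\<close> and \<open>act_universal_to\<close>):
  the first says that \<open>\<nu> (F x)\<close> is isomorphic to the cofree module on \<open>x\<close>, so that
  \<open>\<nu> \<circ>\<^sub>F F\<close> is right adjoint to \<open>U\<close>, and both together say that the unit at \<open>F x\<close> is
  invertible.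
\<close>


section \<open>Preadditive categories and additive functors\<close>

lemma Hom_iff: "f \<in> Hom C x y \<longleftrightarrow> f \<in> Arr C \<and> Dom C f = x \<and> Cod C f = y"
  by (auto simp: Hom_def)

context preadditive_category
begin

lemma hom_objs: "f \<in> Hom C x y \<Longrightarrow> x \<in> Obj C \<and> y \<in> Obj C"
  using dom_obj cod_obj by (auto simp: Hom_iff)

lemma arr_hom: "f \<in> Arr C \<Longrightarrow> f \<in> Hom C (Dom C f) (Cod C f)"
  by (simp add: Hom_iff)

lemma arr_objs [simp]: "f \<in> Arr C \<Longrightarrow> Dom C f \<in> Obj C" "f \<in> Arr C \<Longrightarrow> Cod C f \<in> Obj C"
  by (auto intro: dom_obj cod_obj)

lemma ident_arr [simp]:
  assumes "x \<in> Obj C"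
  shows "Ident C x \<in> Arr C" "Dom C (Ident C x) = x" "Cod C (Ident C x) = x"
  using ident_hom[OF assms] by (auto simp: Hom_iff)

lemma comp_arr [simp]:
  assumes "f \<in> Arr C" "g \<in> Arr C" "Dom C g = Cod C f"
  shows "g \<cdot> f \<in> Arr C" "Dom C (g \<cdot> f) = Dom C f" "Cod C (g \<cdot> f) = Cod C g"
  using comp_hom[of f "Dom C f" "Cod C f" g "Cod C g"] assms by (auto simp: Hom_iff)

lemma comp_ident [simp]:
  "f \<in> Arr C \<Longrightarrow> Dom C f = x \<Longrightarrow> f \<cdot> Ident C x = f"
  "f \<in> Arr C \<Longrightarrow> Cod C f = x \<Longrightarrow> Ident C x \<cdot> f = f"
  using comp_ident_right comp_ident_left by (auto simp: Hom_iff)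

lemma comp_assoc_right [simp]:
  assumes "f \<in> Arr C" "g \<in> Arr C" "h \<in> Arr C" "Dom C g = Cod C f" "Dom C h = Cod C g"
  shows "h \<cdot> g \<cdot> f = h \<cdot> (g \<cdot> f)"
  using comp_assoc[of f "Dom C f" "Cod C f" g "Cod C g" h "Cod C h"] assms by (simp add: Hom_iff)

text \<open>The simplifier associates composites to the right, which hides the left-hand side of an
  equation \<open>g \<cdot> f = k\<close> inside \<open>g \<cdot> (f \<cdot> z)\<close>; this is the form of the equation that can then be
  applied.\<close>

lemma comp_extend:
  assumes "g \<cdot> f = k" "z \<in> Arr C" "f \<in> Arr C" "g \<in> Arr C" "Dom C f = Cod C z" "Dom C g = Cod C f"
  shows "g \<cdot> (f \<cdot> z) = k \<cdot> z"
  using comp_assoc_right[of z f g] assms by simp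

lemma zero_arr [simp]:
  assumes "x \<in> Obj C" "y \<in> Obj C"
  shows "Zero C x y \<in> Arr C" "Dom C (Zero C x y) = x" "Cod C (Zero C x y) = y"
proof -
  interpret comm_group "Hom_group C x y" using hom_group[OF assms] .
  show "Zero C x y \<in> Arr C" "Dom C (Zero C x y) = x" "Cod C (Zero C x y) = y"
    using one_closed by (auto simp: Hom_iff)
qed

lemma add_arr [simp]:
  assumes "f \<in> Arr C" "g \<in> Arr C" "Dom C f = Dom C g" "Cod C f = Cod C g"
  shows "Add C f g \<in> Arr C" "Dom C (Add C f g) = Dom C g" "Cod C (Add C f g) = Cod C g"
proof -
  interpret comm_group "Hom_group C (Dom C g) (Cod C g)" using hom_group assms by simp
  show "Add C f g \<in> Arr C" "Dom C (Add C f g) = Dom C g" "Cod C (Add C f g) = Cod C g"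
    using m_closed[of f g] assms by (auto simp: Hom_iff)
qed

lemma add_comp [simp]:
  assumes "f \<in> Arr C" "g \<in> Arr C" "Dom C f = Dom C g" "Cod C f = Cod C g"
  shows "h \<in> Arr C \<Longrightarrow> Dom C h = Cod C g \<Longrightarrow> h \<cdot> Add C f g = Add C (h \<cdot> f) (h \<cdot> g)"
    and "h \<in> Arr C \<Longrightarrow> Cod C h = Dom C g \<Longrightarrow> Add C f g \<cdot> h = Add C (f \<cdot> h) (g \<cdot> h)"
  using comp_add_right[of f "Dom C g" "Cod C g" g h "Cod C h"]
    comp_add_left[of h "Dom C h" "Dom C g" f "Cod C g" g] assms by (simp_all add: Hom_iff)

lemma add_idem_zero:
  assumes "f \<in> Arr C" "Add C f f = f"
  shows "f = Zero C (Dom C f) (Cod C f)"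
proof -
  interpret comm_group "Hom_group C (Dom C f) (Cod C f)" using hom_group assms by simp
  show ?thesis using l_cancel_one'[of f f] assms by (simp add: Hom_iff)
qed

lemma add_zero [simp]:
  assumes "f \<in> Arr C" "Dom C f = x" "Cod C f = y"
  shows "Add C f (Zero C x y) = f" "Add C (Zero C x y) f = f"
proof -
  interpret comm_group "Hom_group C x y" using hom_group assms by auto
  show "Add C f (Zero C x y) = f" "Add C (Zero C x y) f = f"
    using r_one[of f] l_one[of f] assms by (auto simp: Hom_iff)
qed

lemma comp_zero [simp]:
  assumes "x \<in> Obj C" "y \<in> Obj C" "f \<in> Arr C"
  shows "Dom C f = y \<Longrightarrow> f \<cdot> Zero C x y = Zero C x (Cod C f)"
    and "Cod C f = x \<Longrightarrow> Zero C x y \<cdot> f = Zero C (Dom C f) y"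
  using add_idem_zero[of "f \<cdot> Zero C x y"] add_idem_zero[of "Zero C x y \<cdot> f"]
    add_comp[of "Zero C x y" "Zero C x y" f] assms by auto

text \<open>This turns equalizers into kernels and coequalizers into cokernels. All that matters about the
  difference is when its composites vanish.\<close>

lemma ex_difference:
  assumes f: "f \<in> Hom C x y" and g: "g \<in> Hom C x y"
  obtains d where "d \<in> Hom C x y"
    and "\<And>z h. h \<in> Hom C y z \<Longrightarrow> h \<cdot> d = Zero C x z \<longleftrightarrow> h \<cdot> f = h \<cdot> g"
    and "\<And>z h. h \<in> Hom C z x \<Longrightarrow> d \<cdot> h = Zero C z y \<longleftrightarrow> f \<cdot> h = g \<cdot> h"
proof -
  have obj: "x \<in> Obj C" "y \<in> Obj C" using f by (auto simp: Hom_iff)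
  interpret comm_group "Hom_group C x y" using hom_group obj .
  define n where "n = inv\<^bsub>Hom_group C x y\<^esub> g"
  have n: "n \<in> Hom C x y" "Add C g n = Zero C x y"
    using inv_closed[of g] r_inv[of g] g by (auto simp: n_def)
  have cancel: "Add C a c = Add C b c \<longleftrightarrow> a = b"
    if "a \<in> Hom C u v" "b \<in> Hom C u v" "c \<in> Hom C u v" for a b c u v
  proof -
    interpret G: comm_group "Hom_group C u v" using that hom_group hom_objs by blast
    show ?thesis using G.right_cancel[of c a b] that by simp
  qed
  show ?thesis
  proof (rule that[of "Add C f n"])
    show "Add C f n \<in> Hom C x y" using f n by (simp add: Hom_iff)
    fix z h
    show "h \<cdot> Add C f n = Zero C x z \<longleftrightarrow> h \<cdot> f = h \<cdot> g" if h: "h \<in> Hom C y z"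
    proof -
      have "Zero C x z = Add C (h \<cdot> g) (h \<cdot> n)"
        using f g n(1) h add_comp(1)[of g n h] obj by (simp add: Hom_iff n(2))
      then show ?thesis
        using cancel[of "h \<cdot> f" x z "h \<cdot> g" "h \<cdot> n"] f g n(1) h by (simp add: Hom_iff)
    qed
    show "Add C f n \<cdot> h = Zero C z y \<longleftrightarrow> f \<cdot> h = g \<cdot> h" if h: "h \<in> Hom C z x"
    proof -
      have "Zero C z y = Add C (g \<cdot> h) (n \<cdot> h)"
        using f g n(1) h add_comp(2)[of g n h] obj by (simp add: Hom_iff n(2))
      then show ?thesis
        using cancel[of "f \<cdot> h" z y "g \<cdot> h" "n \<cdot> h"] f g n(1) h by (simp add: Hom_iff)
    qed
  qed
qed

lemma id_functor: "additive_functor C C id_func"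
  by unfold_locales (auto simp: id_func_def)

end

lemma comp_func_simps [simp]:
  "fobj (G \<circ>\<^sub>F F) x = fobj G (fobj F x)" "farr (G \<circ>\<^sub>F F) f = farr G (farr F f)"
  by (simp_all add: comp_func_def)

lemma id_func_simps [simp]: "fobj id_func x = x" "farr id_func f = f"
  by (simp_all add: id_func_def)

context additive_functor
begin

lemma fobj_in_Obj [simp]: "x \<in> Obj C \<Longrightarrow> fobj F x \<in> Obj D"
  by (rule fobj_obj)

lemma farr_arr [simp]:
  assumes "f \<in> Arr C"
  shows "farr F f \<in> Arr D" "Dom D (farr F f) = fobj F (Dom C f)" "Cod D (farr F f) = fobj F (Cod C f)"
  using farr_hom[OF C.arr_hom[OF assms]] by (auto simp: Hom_iff)

lemma farr_ident_simp [simp]: "x \<in> Obj C \<Longrightarrow> farr F (Ident C x) = Ident D (fobj F x)"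
  by (rule farr_ident)

lemma farr_comp_simp [simp]:
  "\<lbrakk>f \<in> Arr C; g \<in> Arr C; Dom C g = Cod C f\<rbrakk> \<Longrightarrow> farr F (g \<cdot>\<^bsub>C\<^esub> f) = farr F g \<cdot>\<^bsub>D\<^esub> farr F f"
  using farr_comp[of f "Dom C f" "Cod C f" g "Cod C g"] by (simp add: Hom_iff)

lemma farr_add_simp [simp]:
  "\<lbrakk>f \<in> Arr C; g \<in> Arr C; Dom C f = Dom C g; Cod C f = Cod C g\<rbrakk>
    \<Longrightarrow> farr F (Add C f g) = Add D (farr F f) (farr F g)"
  using farr_add[of f "Dom C g" "Cod C g" g] by (simp add: Hom_iff)

lemma farr_zero [simp]:
  assumes "x \<in> Obj C" "y \<in> Obj C"
  shows "farr F (Zero C x y) = Zero D (fobj F x) (fobj F y)"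
proof -
  have "Add D (farr F (Zero C x y)) (farr F (Zero C x y)) = farr F (Zero C x y)"
    using farr_add_simp[of "Zero C x y" "Zero C x y"] assms by simp
  from D.add_idem_zero[OF _ this] show ?thesis using assms by simp
qed

end

lemma additive_functor_comp:
  assumes "additive_functor C D F" "additive_functor D E G"
  shows "additive_functor C E (G \<circ>\<^sub>F F)"
proof -
  interpret F: additive_functor C D F by fact
  interpret G: additive_functor D E G by fact
  show ?thesis by unfold_locales (auto simp: Hom_iff)
qed

context nat_trans
begin

lemma component_arr [simp]:
  assumes "x \<in> Obj C"
  shows "\<alpha> x \<in> Arr D" "Dom D (\<alpha> x) = fobj F x" "Cod D (\<alpha> x) = fobj G x"
  using component_hom[OF assms] by (auto simp: Hom_iff)

lemma naturality:
  "\<lbrakk>f \<in> Arr C; Dom C f = x; Cod C f = y\<rbrakk> \<Longrightarrow> \<alpha> y \<cdot>\<^bsub>D\<^esub> farr F f = farr G f \<cdot>\<^bsub>D\<^esub> \<alpha> x"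
  by (rule natural) (simp add: Hom_iff)

end


section \<open>Kernels and cokernels\<close>

lemma is_kernelD:
  assumes "is_kernel C f k"
  shows "f \<in> Arr C" "k \<in> Arr C" "Cod C k = Dom C f" "f \<cdot>\<^bsub>C\<^esub> k = Zero C (Dom C k) (Cod C f)"
    and "\<lbrakk>g \<in> Arr C; Cod C g = Dom C f; f \<cdot>\<^bsub>C\<^esub> g = Zero C (Dom C g) (Cod C f)\<rbrakk>
      \<Longrightarrow> \<exists>!u. u \<in> Hom C (Dom C g) (Dom C k) \<and> k \<cdot>\<^bsub>C\<^esub> u = g"
  using assms unfolding is_kernel_def by (auto simp: Hom_iff)

lemma is_cokernelD:
  assumes "is_cokernel C f c"
  shows "f \<in> Arr C" "c \<in> Arr C" "Dom C c = Cod C f" "c \<cdot>\<^bsub>C\<^esub> f = Zero C (Dom C f) (Cod C c)"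
    and "\<lbrakk>g \<in> Arr C; Dom C g = Cod C f; g \<cdot>\<^bsub>C\<^esub> f = Zero C (Dom C f) (Cod C g)\<rbrakk>
      \<Longrightarrow> \<exists>!u. u \<in> Hom C (Cod C c) (Cod C g) \<and> u \<cdot>\<^bsub>C\<^esub> c = g"
  using assms unfolding is_cokernel_def by (auto simp: Hom_iff)

context preadditive_category
begin

lemma kernel_cancel:
  assumes k: "is_kernel C f k" and uv: "u \<in> Arr C" "v \<in> Arr C" "Dom C u = Dom C v"
    "Cod C u = Dom C k" "Cod C v = Dom C k" "k \<cdot> u = k \<cdot> v"
  shows "u = v"
proof -
  note k' = is_kernelD[OF k]
  have "f \<cdot> (k \<cdot> v) = Zero C (Dom C v) (Cod C f)"
    using k'(1-4) uv comp_extend[OF k'(4), of v] by simp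
  then have "\<exists>!w. w \<in> Hom C (Dom C v) (Dom C k) \<and> k \<cdot> w = k \<cdot> v"
    using k'(5)[of "k \<cdot> v"] k'(1-3) uv by simp
  moreover have "u \<in> Hom C (Dom C v) (Dom C k)" "v \<in> Hom C (Dom C v) (Dom C k)"
    using uv by (simp_all add: Hom_iff)
  ultimately show ?thesis using uv(6) by blast
qed

lemma cokernel_cancel:
  assumes c: "is_cokernel C f c" and uv: "u \<in> Arr C" "v \<in> Arr C" "Cod C u = Cod C v"
    "Dom C u = Cod C c" "Dom C v = Cod C c" "u \<cdot> c = v \<cdot> c"
  shows "u = v"
proof -
  note c' = is_cokernelD[OF c]
  have "(v \<cdot> c) \<cdot> f = Zero C (Dom C f) (Cod C v)"
    using c'(1-4) uv by simp
  then have "\<exists>!w. w \<in> Hom C (Cod C c) (Cod C v) \<and> w \<cdot> c = v \<cdot> c"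
    using c'(5)[of "v \<cdot> c"] c'(1-3) uv by simp
  moreover have "u \<in> Hom C (Cod C c) (Cod C v)" "v \<in> Hom C (Cod C c) (Cod C v)"
    using uv by (simp_all add: Hom_iff)
  ultimately show ?thesis using uv(6) by blast
qed

text \<open>If \<open>m\<close> is the kernel of \<open>f\<close>, then \<open>f\<close> factors through the cokernel \<open>c\<close> of \<open>m\<close>, so
  everything annihilated by \<open>c\<close> is annihilated by \<open>f\<close>.\<close>

lemma mono_is_kernel_of_cokernel:
  assumes m: "is_kernel C f m" and c: "is_cokernel C m c"
  shows "is_kernel C c m"
proof -
  note m' = is_kernelD[OF m] and c' = is_cokernelD[OF c]
  have "\<exists>!v. v \<in> Hom C (Cod C c) (Cod C f) \<and> v \<cdot> c = f"
    using c'(5)[of f] m'(1-4) by simp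
  then obtain v where v: "v \<in> Hom C (Cod C c) (Cod C f)" "v \<cdot> c = f" by blast
  show ?thesis
    unfolding is_kernel_def
  proof (intro conjI allI ballI impI)
    fix x g assume g: "g \<in> Hom C x (Dom C c)" and z: "c \<cdot> g = Zero C x (Cod C c)"
    have "f \<cdot> g = v \<cdot> (c \<cdot> g)"
      using v g c'(1-3) by (auto simp: Hom_iff)
    also have "\<dots> = Zero C x (Cod C f)" using v g c'(1-3) z by (auto simp: Hom_iff)
    finally show "\<exists>!u. u \<in> Hom C x (Dom C m) \<and> m \<cdot> u = g"
      using m'(5)[of g] g m'(1-3) c'(3) by (simp add: Hom_iff)
  qed (use m'(1-4) c'(1-4) in auto)
qed

lemma epi_is_cokernel_of_kernel:
  assumes e: "is_cokernel C f e" and k: "is_kernel C e k"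
  shows "is_cokernel C k e"
proof -
  note e' = is_cokernelD[OF e] and k' = is_kernelD[OF k]
  have "\<exists>!v. v \<in> Hom C (Dom C f) (Dom C k) \<and> k \<cdot> v = f"
    using k'(5)[of f] e'(1-4) by simp
  then obtain v where v: "v \<in> Hom C (Dom C f) (Dom C k)" "k \<cdot> v = f" by blast
  show ?thesis
    unfolding is_cokernel_def
  proof (intro conjI allI ballI impI)
    fix y g assume g: "g \<in> Hom C (Cod C k) y" and z: "g \<cdot> k = Zero C (Dom C k) y"
    have "g \<cdot> f = (g \<cdot> k) \<cdot> v"
      using v g k'(1-3) e'(1-3) by (auto simp: Hom_iff)
    also have "\<dots> = Zero C (Dom C f) y" using v g k'(1-3) e'(1-3) z by (auto simp: Hom_iff)
    finally show "\<exists>!u. u \<in> Hom C (Cod C e) y \<and> u \<cdot> e = g"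
      using e'(5)[of g] g e'(1-3) k'(3) by (simp add: Hom_iff)
  qed (use e'(1-4) k'(1-4) in auto)
qed

end

context abelian_category
begin

lemma ex_equalizer:
  assumes "f \<in> Hom C x y" "g \<in> Hom C x y"
  obtains e k where "k \<in> Hom C e x" "f \<cdot> k = g \<cdot> k"
    "\<And>z h. \<lbrakk>h \<in> Hom C z x; f \<cdot> h = g \<cdot> h\<rbrakk> \<Longrightarrow> \<exists>!u. u \<in> Hom C z e \<and> k \<cdot> u = h"
proof -
  from ex_difference[OF assms] obtain d where d: "d \<in> Hom C x y"
    "\<And>z h. h \<in> Hom C z x \<Longrightarrow> d \<cdot> h = Zero C z y \<longleftrightarrow> f \<cdot> h = g \<cdot> h" by metis
  then obtain k where k: "is_kernel C d k" using ex_kernel by (auto simp: Hom_iff)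
  note k' = is_kernelD[OF k]
  show ?thesis
  proof (rule that[of k "Dom C k"])
    show k_hom: "k \<in> Hom C (Dom C k) x" using k'(1-3) d(1) by (simp add: Hom_iff)
    show "f \<cdot> k = g \<cdot> k" using d(2)[OF k_hom] k'(4) d(1) by (simp add: Hom_iff)
    show "\<exists>!u. u \<in> Hom C z (Dom C k) \<and> k \<cdot> u = h" if "h \<in> Hom C z x" "f \<cdot> h = g \<cdot> h" for z h
      using k'(5)[of h] d(2)[OF that(1)] that d(1) by (simp add: Hom_iff)
  qed
qed

lemma ex_coequalizer:
  assumes "f \<in> Hom C x y" "g \<in> Hom C x y"
  obtains q c where "c \<in> Hom C y q" "c \<cdot> f = c \<cdot> g"
    "\<And>z h. \<lbrakk>h \<in> Hom C y z; h \<cdot> f = h \<cdot> g\<rbrakk> \<Longrightarrow> \<exists>!u. u \<in> Hom C q z \<and> u \<cdot> c = h"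
proof -
  from ex_difference[OF assms] obtain d where d: "d \<in> Hom C x y"
    "\<And>z h. h \<in> Hom C y z \<Longrightarrow> h \<cdot> d = Zero C x z \<longleftrightarrow> h \<cdot> f = h \<cdot> g" by metis
  then obtain c where c: "is_cokernel C d c" using ex_cokernel by (auto simp: Hom_iff)
  note c' = is_cokernelD[OF c]
  show ?thesis
  proof (rule that[of c "Cod C c"])
    show c_hom: "c \<in> Hom C y (Cod C c)" using c'(1-3) d(1) by (simp add: Hom_iff)
    show "c \<cdot> f = c \<cdot> g" using d(2)[OF c_hom] c'(4) d(1) by (simp add: Hom_iff)
    show "\<exists>!u. u \<in> Hom C (Cod C c) z \<and> u \<cdot> c = h" if "h \<in> Hom C y z" "h \<cdot> f = h \<cdot> g" for z h
      using c'(5)[of h] d(2)[OF that(1)] that d(1) by (simp add: Hom_iff)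
  qed
qed

end


section \<open>Adjunctions\<close>

context adjunction
begin

lemma tr_arr [simp]:
  assumes "d \<in> Obj D" "h \<in> Arr E" "Dom E h = fobj L d" "Cod E h = e"
  shows "\<phi> d e h \<in> Arr D" "Dom D (\<phi> d e h) = d" "Cod D (\<phi> d e h) = fobj R e"
proof -
  have "e \<in> Obj E" "h \<in> Hom E (fobj L d) e" using assms by (auto simp: Hom_iff)
  then have "\<phi> d e h \<in> Hom D d (fobj R e)" using adj_bij[of d e] assms(1) by (auto simp: bij_betw_def)
  then show "\<phi> d e h \<in> Arr D" "Dom D (\<phi> d e h) = d" "Cod D (\<phi> d e h) = fobj R e"
    by (auto simp: Hom_iff)
qed

lemma tr_precomp:
  assumes "u \<in> Arr D" "h \<in> Arr E" "Dom E h = fobj L (Cod D u)" "Cod E h = e" "Dom D u = d'"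
  shows "\<phi> d' e (h \<cdot>\<^bsub>E\<^esub> farr L u) = \<phi> (Cod D u) e h \<cdot>\<^bsub>D\<^esub> u"
  using adj_natural_left[of u "Dom D u" "Cod D u" e h] assms by (auto simp: Hom_iff)

lemma tr_postcomp:
  assumes "v \<in> Arr E" "h \<in> Arr E" "Dom E h = fobj L d" "d \<in> Obj D" "Dom E v = Cod E h" "Cod E v = e'"
  shows "\<phi> d e' (v \<cdot>\<^bsub>E\<^esub> h) = farr R v \<cdot>\<^bsub>D\<^esub> \<phi> d (Cod E h) h"
  using adj_natural_right[of d v "Dom E v" e' h] assms by (auto simp: Hom_iff)

lemma tr_inj:
  assumes "\<phi> d e h = \<phi> d e h'" "d \<in> Obj D" "h \<in> Arr E" "h' \<in> Arr E" "Dom E h = fobj L d"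
    "Dom E h' = fobj L d" "Cod E h = e" "Cod E h' = e"
  shows "h = h'"
proof -
  have "e \<in> Obj E" using assms by auto
  then have "inj_on (\<phi> d e) (Hom E (fobj L d) e)" using adj_bij assms(2) by (auto simp: bij_betw_def)
  then show ?thesis using assms by (auto simp: Hom_iff inj_on_def)
qed

definition untr :: "'o1 \<Rightarrow> 'o2 \<Rightarrow> 'a1 \<Rightarrow> 'a2" where
  "untr d e g = inv_into (Hom E (fobj L d) e) (\<phi> d e) g"

lemma untr:
  assumes "g \<in> Arr D" "Dom D g = d" "e \<in> Obj E" "Cod D g = fobj R e"
  shows "untr d e g \<in> Arr E" "Dom E (untr d e g) = fobj L d" "Cod E (untr d e g) = e"
    and "\<phi> d e (untr d e g) = g"
proof -
  have "g \<in> \<phi> d e ` Hom E (fobj L d) e"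
    using adj_bij[of d e] assms by (auto simp: bij_betw_def Hom_iff)
  then have "untr d e g \<in> Hom E (fobj L d) e" "\<phi> d e (untr d e g) = g"
    unfolding untr_def by (auto intro: inv_into_into f_inv_into_f)
  then show "untr d e g \<in> Arr E" "Dom E (untr d e g) = fobj L d" "Cod E (untr d e g) = e"
    "\<phi> d e (untr d e g) = g" by (auto simp: Hom_iff)
qed

definition counit :: "'o2 \<Rightarrow> 'a2" where
  "counit e = untr (fobj R e) e (Ident D (fobj R e))"

lemma counit [simp]:
  assumes "e \<in> Obj E"
  shows "counit e \<in> Arr E" "Dom E (counit e) = fobj L (fobj R e)" "Cod E (counit e) = e"
    and "\<phi> (fobj R e) e (counit e) = Ident D (fobj R e)"
  using untr[of "Ident D (fobj R e)" "fobj R e" e] assms by (simp_all add: counit_def)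

lemma tr_counit:
  assumes "g \<in> Arr D" "Dom D g = d" "Cod D g = fobj R e" "e \<in> Obj E"
  shows "\<phi> d e (counit e \<cdot>\<^bsub>E\<^esub> farr L g) = g"
  using tr_precomp[of g "counit e" e d] assms by simp

lemma counit_tr:
  assumes "d \<in> Obj D" "h \<in> Arr E" "Dom E h = fobj L d" "Cod E h = e"
  shows "counit e \<cdot>\<^bsub>E\<^esub> farr L (\<phi> d e h) = h"
proof -
  have "e \<in> Obj E" using assms by auto
  then show ?thesis
    by (intro tr_inj[of d e "counit e \<cdot>\<^bsub>E\<^esub> farr L (\<phi> d e h)" h])
      (use assms tr_counit[of "\<phi> d e h" d e] in simp_all)
qed

abbreviation unit :: "'o1 \<Rightarrow> 'a1" where
  "unit d \<equiv> adj_unit E L \<phi> d"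

lemma unit [simp]:
  assumes "d \<in> Obj D"
  shows "unit d \<in> Arr D" "Dom D (unit d) = d" "Cod D (unit d) = fobj R (fobj L d)"
  using assms by (simp_all add: adj_unit_def)

lemma tr_eq_unit:
  assumes "d \<in> Obj D" "h \<in> Arr E" "Dom E h = fobj L d" "Cod E h = e"
  shows "\<phi> d e h = farr R h \<cdot>\<^bsub>D\<^esub> unit d"
  using tr_postcomp[of h "Ident E (fobj L d)" d e] assms by (simp add: adj_unit_def)

lemma tr_farr:
  assumes "u \<in> Arr D" "Dom D u = d" "Cod D u = d'"
  shows "\<phi> d (fobj L d') (farr L u) = unit d' \<cdot>\<^bsub>D\<^esub> u"
  using tr_precomp[of u "Ident E (fobj L d')" "fobj L d'" d] assms
    by (auto simp: adj_unit_def)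

lemma unit_natural:
  assumes "u \<in> Arr D" "Dom D u = d" "Cod D u = d'"
  shows "unit d' \<cdot>\<^bsub>D\<^esub> u = farr R (farr L u) \<cdot>\<^bsub>D\<^esub> unit d"
  using tr_eq_unit[of d "farr L u" "fobj L d'"] tr_farr[OF assms] assms by auto

lemma counit_natural:
  assumes "v \<in> Arr E" "Dom E v = e" "Cod E v = e'"
  shows "counit e' \<cdot>\<^bsub>E\<^esub> farr L (farr R v) = v \<cdot>\<^bsub>E\<^esub> counit e"
proof (rule tr_inj[of "fobj R e" e'])
  show "\<phi> (fobj R e) e' (counit e' \<cdot>\<^bsub>E\<^esub> farr L (farr R v)) = \<phi> (fobj R e) e' (v \<cdot>\<^bsub>E\<^esub> counit e)"
    using assms tr_counit[of "farr R v" "fobj R e" e'] tr_postcomp[of v "counit e" "fobj R e" e'] by auto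
qed (use assms in auto)

lemma tr_zero:
  assumes "d \<in> Obj D" "e \<in> Obj E"
  shows "\<phi> d e (Zero E (fobj L d) e) = Zero D d (fobj R e)"
  using tr_eq_unit[of d "Zero E (fobj L d) e" e] assms by simp

text \<open>Transposition turns the arrows out of \<open>L (Cod f)\<close> that annihilate \<open>L f\<close> into the arrows out
  of \<open>Cod f\<close> that annihilate \<open>f\<close>.\<close>

lemma left_adjoint_cokernel:
  assumes "is_cokernel D f c"
  shows "is_cokernel E (farr L f) (farr L c)"
proof -
  note c = is_cokernelD[OF assms]
  show ?thesis
    unfolding is_cokernel_def
  proof (intro conjI allI ballI impI)
    show "farr L f \<in> Arr E" "farr L c \<in> Arr E" "Dom E (farr L c) = Cod E (farr L f)"
      using c by simp_all
    show "farr L c \<cdot>\<^bsub>E\<^esub> farr L f = Zero E (Dom E (farr L f)) (Cod E (farr L c))"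
      using c L.farr_comp_simp[of f c] by simp
    fix y g assume g: "g \<in> Hom E (Cod E (farr L f)) y"
      and z: "g \<cdot>\<^bsub>E\<^esub> farr L f = Zero E (Dom E (farr L f)) y"
    have y: "y \<in> Obj E" using g by (auto simp: Hom_iff)
    let ?g = "\<phi> (Cod D f) y g"
    have "?g \<cdot>\<^bsub>D\<^esub> f = Zero D (Dom D f) (fobj R y)"
      using tr_precomp[of f g y "Dom D f"] z g c y by (simp add: Hom_iff tr_zero)
    then have ex1: "\<exists>!v. v \<in> Hom D (Cod D c) (fobj R y) \<and> v \<cdot>\<^bsub>D\<^esub> c = ?g"
      using c(5)[of ?g] c(1) g by (simp add: Hom_iff)
    then obtain v where v: "v \<in> Hom D (Cod D c) (fobj R y)" "v \<cdot>\<^bsub>D\<^esub> c = ?g" by blast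
    have tr: "\<phi> (Cod D f) y (u \<cdot>\<^bsub>E\<^esub> farr L c) = \<phi> (Cod D c) y u \<cdot>\<^bsub>D\<^esub> c"
      if "u \<in> Hom E (Cod E (farr L c)) y" for u
      using tr_precomp[of c u y "Cod D f"] that c(1-3) by (simp add: Hom_iff)
    show "\<exists>!u. u \<in> Hom E (Cod E (farr L c)) y \<and> u \<cdot>\<^bsub>E\<^esub> farr L c = g"
    proof (rule ex_ex1I)
      let ?u = "untr (Cod D c) y v"
      have u: "?u \<in> Hom E (Cod E (farr L c)) y" "\<phi> (Cod D c) y ?u = v"
        using untr[of v "Cod D c" y] v y c(2) by (auto simp: Hom_iff)
      have "?u \<cdot>\<^bsub>E\<^esub> farr L c = g"
        by (rule tr_inj[of "Cod D f" y]) (use tr[OF u(1)] u v g c(1-3) in \<open>auto simp: Hom_iff\<close>)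
      with u show "\<exists>u. u \<in> Hom E (Cod E (farr L c)) y \<and> u \<cdot>\<^bsub>E\<^esub> farr L c = g" by blast
    next
      fix u u' assume u: "u \<in> Hom E (Cod E (farr L c)) y \<and> u \<cdot>\<^bsub>E\<^esub> farr L c = g"
        and u': "u' \<in> Hom E (Cod E (farr L c)) y \<and> u' \<cdot>\<^bsub>E\<^esub> farr L c = g"
      have "\<phi> (Cod D c) y u \<in> Hom D (Cod D c) (fobj R y) \<and> \<phi> (Cod D c) y u \<cdot>\<^bsub>D\<^esub> c = ?g"
        "\<phi> (Cod D c) y u' \<in> Hom D (Cod D c) (fobj R y) \<and> \<phi> (Cod D c) y u' \<cdot>\<^bsub>D\<^esub> c = ?g"
        using tr[of u] tr[of u'] u u' c(2) by (auto simp: Hom_iff)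
      with ex1 have "\<phi> (Cod D c) y u = \<phi> (Cod D c) y u'" by blast
      then show "u = u'"
        by (rule tr_inj) (use u u' c(2) in \<open>auto simp: Hom_iff\<close>)
    qed
  qed
qed

lemma comonad: "comonad E (L \<circ>\<^sub>F R) counit (\<lambda>e. farr L (unit (fobj R e)))"
proof -
  have LR: "additive_functor E E (L \<circ>\<^sub>F R)"
    by (rule additive_functor_comp) unfold_locales
  interpret LR: additive_functor E E "L \<circ>\<^sub>F R" by (rule LR)
  interpret I: additive_functor E E id_func by (rule L.D.id_functor)
  interpret LRLR: additive_functor E E "(L \<circ>\<^sub>F R) \<circ>\<^sub>F (L \<circ>\<^sub>F R)"
    by (rule additive_functor_comp[OF LR LR])
  show ?thesis
  proof unfold_locales
    show "counit x \<in> Hom E (fobj (L \<circ>\<^sub>F R) x) (fobj id_func x)" if "x \<in> Obj E" for x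
      using that by (simp add: Hom_iff)
    show "counit y \<cdot>\<^bsub>E\<^esub> farr (L \<circ>\<^sub>F R) f = farr id_func f \<cdot>\<^bsub>E\<^esub> counit x"
      if "f \<in> Hom E x y" for f x y
      using that by (auto simp: Hom_iff intro!: counit_natural)
    show "farr L (unit (fobj R x)) \<in> Hom E (fobj (L \<circ>\<^sub>F R) x) (fobj (L \<circ>\<^sub>F R \<circ>\<^sub>F (L \<circ>\<^sub>F R)) x)"
      if "x \<in> Obj E" for x
      using that by (simp add: Hom_iff)
    show "farr L (unit (fobj R y)) \<cdot>\<^bsub>E\<^esub> farr (L \<circ>\<^sub>F R) f =
        farr (L \<circ>\<^sub>F R \<circ>\<^sub>F (L \<circ>\<^sub>F R)) f \<cdot>\<^bsub>E\<^esub> farr L (unit (fobj R x))"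
      if "f \<in> Hom E x y" for f x y
      using that unit_natural[of "farr R f" "fobj R x" "fobj R y"]
      by (auto simp: Hom_iff simp flip: L.farr_comp_simp)
  next
    fix x assume x: "x \<in> Obj E"
    show "farr (L \<circ>\<^sub>F R) (farr L (unit (fobj R x))) \<cdot>\<^bsub>E\<^esub> farr L (unit (fobj R x)) =
         farr L (unit (fobj R (fobj (L \<circ>\<^sub>F R) x))) \<cdot>\<^bsub>E\<^esub> farr L (unit (fobj R x))"
      using x unit_natural[of "unit (fobj R x)" "fobj R x"] by (simp flip: L.farr_comp_simp)
    show "counit (fobj (L \<circ>\<^sub>F R) x) \<cdot>\<^bsub>E\<^esub> farr L (unit (fobj R x)) = Ident E (fobj (L \<circ>\<^sub>F R) x)"
      using x counit_tr[of "fobj R x" "Ident E (fobj L (fobj R x))"] by (simp add: adj_unit_def)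
    show "farr (L \<circ>\<^sub>F R) (counit x) \<cdot>\<^bsub>E\<^esub> farr L (unit (fobj R x)) = Ident E (fobj (L \<circ>\<^sub>F R) x)"
      using x tr_eq_unit[of "fobj R x" "counit x" x, symmetric] by (simp flip: L.farr_comp_simp)
  qed
qed

end

lemma id_adjunction:
  assumes "preadditive_category C"
  shows "adjunction C C id_func id_func id_adj"
proof -
  interpret preadditive_category C by fact
  interpret additive_functor C C id_func by (rule id_functor)
  show ?thesis by unfold_locales (auto simp: id_adj_def bij_betw_def inj_on_def)
qed

lemma adjunction_comp:
  assumes "adjunction D E L R \<phi>" "adjunction E K L' R' \<phi>'"
  shows "adjunction D K (L' \<circ>\<^sub>F L) (R \<circ>\<^sub>F R') (comp_adj L R' \<phi> \<phi>')"
proof -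
  interpret A: adjunction D E L R \<phi> by fact
  interpret A': adjunction E K L' R' \<phi>' by fact
  interpret L: additive_functor D K "L' \<circ>\<^sub>F L"
    by (rule additive_functor_comp) unfold_locales
  interpret R: additive_functor K D "R \<circ>\<^sub>F R'"
    by (rule additive_functor_comp) unfold_locales
  show ?thesis
  proof unfold_locales
    fix d e assume "d \<in> Obj D" "e \<in> Obj K"
    then show "bij_betw (comp_adj L R' \<phi> \<phi>' d e) (Hom K (fobj (L' \<circ>\<^sub>F L) d) e) (Hom D d (fobj (R \<circ>\<^sub>F R') e))"
      using bij_betw_trans[OF A'.adj_bij[of "fobj L d" e] A.adj_bij[of d "fobj R' e"]]
      by (simp add: comp_adj_def[abs_def] comp_def)
  next
    fix u d' d e h
    assume "u \<in> Hom D d' d" "e \<in> Obj K" "h \<in> Hom K (fobj (L' \<circ>\<^sub>F L) d) e"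
    then show "comp_adj L R' \<phi> \<phi>' d' e (h \<cdot>\<^bsub>K\<^esub> farr (L' \<circ>\<^sub>F L) u) = comp_adj L R' \<phi> \<phi>' d e h \<cdot>\<^bsub>D\<^esub> u"
      using A'.tr_precomp[of "farr L u" h e "fobj L d'"] A.tr_precomp[of u "\<phi>' (fobj L d) e h" "fobj R' e" d']
      by (auto simp: Hom_iff comp_adj_def)
  next
    fix d v e e' h
    assume "d \<in> Obj D" "v \<in> Hom K e e'" "h \<in> Hom K (fobj (L' \<circ>\<^sub>F L) d) e"
    then show "comp_adj L R' \<phi> \<phi>' d e' (v \<cdot>\<^bsub>K\<^esub> h) = farr (R \<circ>\<^sub>F R') v \<cdot>\<^bsub>D\<^esub> comp_adj L R' \<phi> \<phi>' d e h"
      using A'.tr_postcomp[of v h "fobj L d" e'] A.tr_postcomp[of "farr R' v" "\<phi>' (fobj L d) e h" d "fobj R' e'"]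
      by (auto simp: Hom_iff comp_adj_def)
  qed
qed


section \<open>Adjunctions from representable families of arrows\<close>

text \<open>An adjunction between \<open>\<nu>\<close> and \<open>\<nu>'\<close> amounts to a bimodule \<open>P\<close> with natural bijections
  \<open>A'(\<nu> m, n) \<cong> P m n \<cong> A(m, \<nu>' n)\<close>. Here the elements of the bimodule are arrows of a category
  \<open>D\<close>, on which \<open>A\<close> and \<open>A'\<close> act by composition through functors \<open>J\<close> and \<open>K\<close>; the bijections are
  then given by universal arrows.\<close>

locale arrow_bimodule = J: additive_functor A D J + K: additive_functor A' D K
  for A :: "('o1, 'a1) cat" and A' :: "('o2, 'a2) cat" and D :: "('o3, 'a3) cat"
    and J :: "('o1, 'a1, 'o3, 'a3) func" and K :: "('o2, 'a2, 'o3, 'a3) func" +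
  fixes P :: "'o1 \<Rightarrow> 'o2 \<Rightarrow> 'a3 set"
  assumes bimodule_hom:
      "f \<in> P m n \<Longrightarrow> m \<in> Obj A \<and> n \<in> Obj A' \<and> f \<in> Hom D (fobj J m) (fobj K n)"
    and act_left: "\<lbrakk>f \<in> P m n; u \<in> Hom A m' m\<rbrakk> \<Longrightarrow> f \<cdot>\<^bsub>D\<^esub> farr J u \<in> P m' n"
    and act_right: "\<lbrakk>f \<in> P m n; v \<in> Hom A' n n'\<rbrakk> \<Longrightarrow> farr K v \<cdot>\<^bsub>D\<^esub> f \<in> P m n'"
begin

definition universal_from :: "'o1 \<Rightarrow> 'o2 \<Rightarrow> 'a3 \<Rightarrow> bool" where
  "universal_from m n p \<longleftrightarrow> p \<in> P m n \<and>
     (\<forall>n'. \<forall>f \<in> P m n'. \<exists>!h. h \<in> Hom A' n n' \<and> farr K h \<cdot>\<^bsub>D\<^esub> p = f)"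

definition universal_to :: "'o1 \<Rightarrow> 'o2 \<Rightarrow> 'a3 \<Rightarrow> bool" where
  "universal_to m n q \<longleftrightarrow> q \<in> P m n \<and>
     (\<forall>m'. \<forall>f \<in> P m' n. \<exists>!g. g \<in> Hom A m' m \<and> q \<cdot>\<^bsub>D\<^esub> farr J g = f)"

lemma bimodule_arr [simp]:
  assumes "f \<in> P m n"
  shows "f \<in> Arr D" "Dom D f = fobj J m" "Cod D f = fobj K n"
  using bimodule_hom[OF assms] by (auto simp: Hom_iff)

lemma universal_fromD:
  assumes "universal_from m n p"
  shows "p \<in> P m n" "f \<in> P m n' \<Longrightarrow> \<exists>h \<in> Hom A' n n'. farr K h \<cdot>\<^bsub>D\<^esub> p = f"
    and "\<lbrakk>h \<in> Hom A' n n'; h' \<in> Hom A' n n'; farr K h \<cdot>\<^bsub>D\<^esub> p = farr K h' \<cdot>\<^bsub>D\<^esub> p\<rbrakk> \<Longrightarrow> h = h'"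
proof -
  show p: "p \<in> P m n" using assms by (simp add: universal_from_def)
  show "f \<in> P m n' \<Longrightarrow> \<exists>h \<in> Hom A' n n'. farr K h \<cdot>\<^bsub>D\<^esub> p = f"
    using assms unfolding universal_from_def by blast
  show "\<lbrakk>h \<in> Hom A' n n'; h' \<in> Hom A' n n'; farr K h \<cdot>\<^bsub>D\<^esub> p = farr K h' \<cdot>\<^bsub>D\<^esub> p\<rbrakk> \<Longrightarrow> h = h'"
    using act_right[OF p, of h' n'] assms unfolding universal_from_def by blast
qed

lemma universal_toD:
  assumes "universal_to m n q"
  shows "q \<in> P m n" "f \<in> P m' n \<Longrightarrow> \<exists>g \<in> Hom A m' m. q \<cdot>\<^bsub>D\<^esub> farr J g = f"
    and "\<lbrakk>g \<in> Hom A m' m; g' \<in> Hom A m' m; q \<cdot>\<^bsub>D\<^esub> farr J g = q \<cdot>\<^bsub>D\<^esub> farr J g'\<rbrakk> \<Longrightarrow> g = g'"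
proof -
  show q: "q \<in> P m n" using assms by (simp add: universal_to_def)
  show "f \<in> P m' n \<Longrightarrow> \<exists>g \<in> Hom A m' m. q \<cdot>\<^bsub>D\<^esub> farr J g = f"
    using assms unfolding universal_to_def by blast
  show "\<lbrakk>g \<in> Hom A m' m; g' \<in> Hom A m' m; q \<cdot>\<^bsub>D\<^esub> farr J g = q \<cdot>\<^bsub>D\<^esub> farr J g'\<rbrakk> \<Longrightarrow> g = g'"
    using act_left[OF q, of g' m'] assms unfolding universal_to_def by blast
qed

lemma universal_to_iso:
  assumes p: "universal_to m n p" and p': "universal_to m' n p'"
    and g: "g \<in> Hom A m m'" "p' \<cdot>\<^bsub>D\<^esub> farr J g = p"
  shows "is_iso A g"
proof -
  obtain k where k: "k \<in> Hom A m' m" "p \<cdot>\<^bsub>D\<^esub> farr J k = p'"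
    using universal_toD(2)[OF p universal_toD(1)[OF p']] by blast
  note pP = universal_toD(1)[OF p] and pP' = universal_toD(1)[OF p']
  have obj: "m \<in> Obj A" "m' \<in> Obj A" using bimodule_hom[OF pP] bimodule_hom[OF pP'] by auto
  have eqs: "p \<cdot>\<^bsub>D\<^esub> farr J (k \<cdot>\<^bsub>A\<^esub> g) = p" "p' \<cdot>\<^bsub>D\<^esub> farr J (g \<cdot>\<^bsub>A\<^esub> k) = p'"
    using k g pP pP' J.D.comp_extend[OF k(2), of "farr J g"] J.D.comp_extend[OF g(2), of "farr J k"]
    by (simp_all add: Hom_iff)
  have "k \<cdot>\<^bsub>A\<^esub> g = Ident A m"
    by (rule universal_toD(3)[OF p, of _ m]) (use k g obj pP eqs in \<open>simp_all add: Hom_iff\<close>)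
  moreover have "g \<cdot>\<^bsub>A\<^esub> k = Ident A m'"
    by (rule universal_toD(3)[OF p', of _ m']) (use k g obj pP' eqs in \<open>simp_all add: Hom_iff\<close>)
  ultimately show ?thesis using k(1) g(1) by (auto simp: is_iso_def Hom_iff)
qed

lemma universal_from_iso:
  assumes p: "universal_from m n p" and p': "universal_from m n' p'"
  obtains w w' where "w \<in> Hom A' n n'" "w' \<in> Hom A' n' n" "farr K w \<cdot>\<^bsub>D\<^esub> p = p'"
    "w' \<cdot>\<^bsub>A'\<^esub> w = Ident A' n" "w \<cdot>\<^bsub>A'\<^esub> w' = Ident A' n'"
proof -
  note pP = universal_fromD(1)[OF p] and pP' = universal_fromD(1)[OF p']
  have obj: "n \<in> Obj A'" "n' \<in> Obj A'" using bimodule_hom[OF pP] bimodule_hom[OF pP'] by auto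
  obtain w where w: "w \<in> Hom A' n n'" "farr K w \<cdot>\<^bsub>D\<^esub> p = p'"
    using universal_fromD(2)[OF p pP'] by blast
  obtain w' where w': "w' \<in> Hom A' n' n" "farr K w' \<cdot>\<^bsub>D\<^esub> p' = p"
    using universal_fromD(2)[OF p' pP] by blast
  have eqs: "farr K (w' \<cdot>\<^bsub>A'\<^esub> w) \<cdot>\<^bsub>D\<^esub> p = p" "farr K (w \<cdot>\<^bsub>A'\<^esub> w') \<cdot>\<^bsub>D\<^esub> p' = p'"
    using w w' pP pP' by (simp_all add: Hom_iff)
  have "w' \<cdot>\<^bsub>A'\<^esub> w = Ident A' n"
    by (rule universal_fromD(3)[OF p, of _ n]) (use w w' obj pP eqs in \<open>simp_all add: Hom_iff\<close>)
  moreover have "w \<cdot>\<^bsub>A'\<^esub> w' = Ident A' n'"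
    by (rule universal_fromD(3)[OF p', of _ n']) (use w w' obj pP' eqs in \<open>simp_all add: Hom_iff\<close>)
  ultimately show ?thesis using that w w'(1) by blast
qed

text \<open>Two universal arrows out of \<open>m\<close> differ by an isomorphism of their targets, and composition
  with an isomorphism preserves the universal property in the other variable.\<close>

lemma universal_to_transfer:
  assumes p: "universal_from m n p" and p': "universal_from m n' p'"
    and couniv: "universal_to m n' p'"
  shows "universal_to m n p"
proof -
  obtain w w' where w: "w \<in> Hom A' n n'" "w' \<in> Hom A' n' n" "farr K w \<cdot>\<^bsub>D\<^esub> p = p'"
    "w' \<cdot>\<^bsub>A'\<^esub> w = Ident A' n" "w \<cdot>\<^bsub>A'\<^esub> w' = Ident A' n'"
    using universal_from_iso[OF p p'] .
  note pP = universal_fromD(1)[OF p] and pP' = universal_fromD(1)[OF p']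
  have obj: "n \<in> Obj A'" "n' \<in> Obj A'" using bimodule_hom[OF pP] bimodule_hom[OF pP'] by auto
  have cancel: "f = f'" if "f \<in> P l n" "f' \<in> P l n" "farr K w \<cdot>\<^bsub>D\<^esub> f = farr K w \<cdot>\<^bsub>D\<^esub> f'" for l f f'
  proof -
    have "farr K (w' \<cdot>\<^bsub>A'\<^esub> w) \<cdot>\<^bsub>D\<^esub> f = farr K (w' \<cdot>\<^bsub>A'\<^esub> w) \<cdot>\<^bsub>D\<^esub> f'"
      using w(1,2) that by (simp add: Hom_iff)
    then show ?thesis using that obj by (simp add: w(4))
  qed
  show ?thesis
    unfolding universal_to_def
  proof (intro conjI allI ballI ex_ex1I pP)
    fix l f assume f: "f \<in> P l n"
    then obtain g where g: "g \<in> Hom A l m" "p' \<cdot>\<^bsub>D\<^esub> farr J g = farr K w \<cdot>\<^bsub>D\<^esub> f"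
      using universal_toD(2)[OF couniv act_right[OF f w(1)]] by blast
    have "farr K w \<cdot>\<^bsub>D\<^esub> (p \<cdot>\<^bsub>D\<^esub> farr J g) = farr K w \<cdot>\<^bsub>D\<^esub> f"
      using J.D.comp_extend[OF w(3), of "farr J g"] g w(1) pP by (simp add: Hom_iff)
    then have "p \<cdot>\<^bsub>D\<^esub> farr J g = f" by (rule cancel[OF act_left[OF pP g(1)] f])
    with g(1) show "\<exists>g. g \<in> Hom A l m \<and> p \<cdot>\<^bsub>D\<^esub> farr J g = f" by blast
  next
    fix l f g g'
    assume g: "g \<in> Hom A l m \<and> p \<cdot>\<^bsub>D\<^esub> farr J g = f" and g': "g' \<in> Hom A l m \<and> p \<cdot>\<^bsub>D\<^esub> farr J g' = f"
    have "farr K w \<cdot>\<^bsub>D\<^esub> (p \<cdot>\<^bsub>D\<^esub> farr J g) = farr K w \<cdot>\<^bsub>D\<^esub> (p \<cdot>\<^bsub>D\<^esub> farr J g')" using g g' by simp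
    then have "p' \<cdot>\<^bsub>D\<^esub> farr J g = p' \<cdot>\<^bsub>D\<^esub> farr J g'"
      using J.D.comp_extend[OF w(3), of "farr J g"] J.D.comp_extend[OF w(3), of "farr J g'"] g g' w(1) pP
      by (simp add: Hom_iff)
    then show "g = g'" using universal_toD(3)[OF couniv, of g l g'] g g' by blast
  qed
qed

text \<open>Universal arrows \<open>p m\<close> and \<open>q n\<close> are chosen on objects, and their universal properties
  force the action on arrows as well as the transposition \<open>\<theta>\<close>. The last equation determines
  the unit: it is the arrow that factors \<open>p m\<close> through \<open>q\<close>, so the unit at \<open>m\<close> is
  invertible as soon as \<open>p m\<close> is universal in both variables.\<close>

lemma representable_adjunction:
  assumes "\<And>m. m \<in> Obj A \<Longrightarrow> \<exists>n p. universal_from m n p"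
    and "\<And>n. n \<in> Obj A' \<Longrightarrow> \<exists>m q. universal_to m n q"
  obtains \<nu> \<nu>' \<theta> p q where "adjunction A A' \<nu> \<nu>' \<theta>"
    "\<And>m. m \<in> Obj A \<Longrightarrow> universal_from m (fobj \<nu> m) (p m)"
    "\<And>u m m'. u \<in> Hom A m m' \<Longrightarrow> farr K (farr \<nu> u) \<cdot>\<^bsub>D\<^esub> p m = p m' \<cdot>\<^bsub>D\<^esub> farr J u"
    "\<And>n. n \<in> Obj A' \<Longrightarrow> universal_to (fobj \<nu>' n) n (q n)"
    "\<And>m n h. \<lbrakk>m \<in> Obj A; h \<in> Hom A' (fobj \<nu> m) n\<rbrakk> \<Longrightarrow> q n \<cdot>\<^bsub>D\<^esub> farr J (\<theta> m n h) = farr K h \<cdot>\<^bsub>D\<^esub> p m"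
proof -
  obtain N p where p: "\<And>m. m \<in> Obj A \<Longrightarrow> universal_from m (N m) (p m)"
    using assms(1) by metis
  obtain N' q where q: "\<And>n. n \<in> Obj A' \<Longrightarrow> universal_to (N' n) n (q n)"
    using assms(2) by metis
  note pP = universal_fromD(1)[OF p] and qP = universal_toD(1)[OF q]
  note [simp] = bimodule_arr[OF pP] bimodule_arr[OF qP]
  have objN [simp]: "m \<in> Obj A \<Longrightarrow> N m \<in> Obj A'" "n \<in> Obj A' \<Longrightarrow> N' n \<in> Obj A" for m n
    using bimodule_hom[OF pP] bimodule_hom[OF qP] by blast+
  define \<nu> where "\<nu> = \<lparr>fobj = N, farr = \<lambda>u. SOME h. h \<in> Hom A' (N (Dom A u)) (N (Cod A u)) \<and>
    farr K h \<cdot>\<^bsub>D\<^esub> p (Dom A u) = p (Cod A u) \<cdot>\<^bsub>D\<^esub> farr J u\<rparr>"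
  define \<nu>' where "\<nu>' = \<lparr>fobj = N', farr = \<lambda>v. SOME g. g \<in> Hom A (N' (Dom A' v)) (N' (Cod A' v)) \<and>
    q (Cod A' v) \<cdot>\<^bsub>D\<^esub> farr J g = farr K v \<cdot>\<^bsub>D\<^esub> q (Dom A' v)\<rparr>"
  define \<theta> where "\<theta> m n h = (SOME g. g \<in> Hom A m (N' n) \<and> q n \<cdot>\<^bsub>D\<^esub> farr J g = farr K h \<cdot>\<^bsub>D\<^esub> p m)" for m n h
  have fobjs [simp]: "fobj \<nu> = N" "fobj \<nu>' = N'" by (simp_all add: \<nu>_def \<nu>'_def)
  have "farr \<nu> u \<in> Hom A' (N (Dom A u)) (N (Cod A u)) \<and>
      farr K (farr \<nu> u) \<cdot>\<^bsub>D\<^esub> p (Dom A u) = p (Cod A u) \<cdot>\<^bsub>D\<^esub> farr J u" if u: "u \<in> Arr A" for u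
    unfolding \<nu>_def func.simps
    by (rule someI_ex) (use universal_fromD(2)[OF p act_left[OF pP J.C.arr_hom[OF u]]] u in auto)
  then have nu [simp]: "farr \<nu> u \<in> Arr A'" "Dom A' (farr \<nu> u) = N (Dom A u)" "Cod A' (farr \<nu> u) = N (Cod A u)"
    and nu_p: "Dom A u = m \<Longrightarrow> farr K (farr \<nu> u) \<cdot>\<^bsub>D\<^esub> p m = p (Cod A u) \<cdot>\<^bsub>D\<^esub> farr J u"
    if "u \<in> Arr A" for u m
    using that by (auto simp: Hom_iff)
  have "farr \<nu>' v \<in> Hom A (N' (Dom A' v)) (N' (Cod A' v)) \<and>
      q (Cod A' v) \<cdot>\<^bsub>D\<^esub> farr J (farr \<nu>' v) = farr K v \<cdot>\<^bsub>D\<^esub> q (Dom A' v)" if v: "v \<in> Arr A'" for v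
    unfolding \<nu>'_def func.simps
    by (rule someI_ex) (use universal_toD(2)[OF q act_right[OF qP K.C.arr_hom[OF v]]] v in auto)
  then have nu' [simp]: "farr \<nu>' v \<in> Arr A" "Dom A (farr \<nu>' v) = N' (Dom A' v)" "Cod A (farr \<nu>' v) = N' (Cod A' v)"
    and nu'_q: "Cod A' v = n \<Longrightarrow> q n \<cdot>\<^bsub>D\<^esub> farr J (farr \<nu>' v) = farr K v \<cdot>\<^bsub>D\<^esub> q (Dom A' v)"
    if "v \<in> Arr A'" for v n
    using that by (auto simp: Hom_iff)
  have "\<theta> m n h \<in> Hom A m (N' n) \<and> q n \<cdot>\<^bsub>D\<^esub> farr J (\<theta> m n h) = farr K h \<cdot>\<^bsub>D\<^esub> p m"
    if m: "m \<in> Obj A" and h: "h \<in> Hom A' (N m) n" for m n h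
  proof -
    have n: "n \<in> Obj A'" using h by (auto simp: Hom_iff)
    show ?thesis unfolding \<theta>_def
      by (rule someI_ex) (use universal_toD(2)[OF q[OF n] act_right[OF pP[OF m] h]] in blast)
  qed
  then have th [simp]: "\<theta> m n h \<in> Arr A" "Dom A (\<theta> m n h) = m" "Cod A (\<theta> m n h) = N' n"
    and th_q: "q n \<cdot>\<^bsub>D\<^esub> farr J (\<theta> m n h) = farr K h \<cdot>\<^bsub>D\<^esub> p m"
    if "m \<in> Obj A" "h \<in> Arr A'" "Dom A' h = N m" "Cod A' h = n" for m n h
    using that by (auto simp: Hom_iff)
  have eqA': "h = h'" if "farr K h \<cdot>\<^bsub>D\<^esub> p m = farr K h' \<cdot>\<^bsub>D\<^esub> p m" "m \<in> Obj A" "h \<in> Arr A'" "h' \<in> Arr A'"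
    "Dom A' h = N m" "Dom A' h' = N m" "Cod A' h = Cod A' h'" for h h' m
    by (rule universal_fromD(3)[OF p[OF that(2)], of _ "Cod A' h'"]) (use that in \<open>simp_all add: Hom_iff\<close>)
  have eqA: "g = g'" if "q n \<cdot>\<^bsub>D\<^esub> farr J g = q n \<cdot>\<^bsub>D\<^esub> farr J g'" "n \<in> Obj A'" "g \<in> Arr A" "g' \<in> Arr A"
    "Cod A g = N' n" "Cod A g' = N' n" "Dom A g = Dom A g'" for g g' n
    by (rule universal_toD(3)[OF q[OF that(2)], of _ "Dom A g'"]) (use that in \<open>simp_all add: Hom_iff\<close>)
  interpret \<nu>: additive_functor A A' \<nu>
  proof unfold_locales
    fix f g x y z
    show "x \<in> Obj A \<Longrightarrow> fobj \<nu> x \<in> Obj A'" by simp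
    show "f \<in> Hom A x y \<Longrightarrow> farr \<nu> f \<in> Hom A' (fobj \<nu> x) (fobj \<nu> y)" by (simp add: Hom_iff)
    show "farr \<nu> (Ident A x) = Ident A' (fobj \<nu> x)" if "x \<in> Obj A"
      by (rule eqA'[of _ x]) (use that in \<open>simp_all add: nu_p\<close>)
    show "farr \<nu> (g \<cdot>\<^bsub>A\<^esub> f) = farr \<nu> g \<cdot>\<^bsub>A'\<^esub> farr \<nu> f" if "f \<in> Hom A x y" "g \<in> Hom A y z"
      by (rule eqA'[of _ x])
        (use that in \<open>auto simp: nu_p Hom_iff J.D.comp_extend[OF nu_p]\<close>)
    show "farr \<nu> (Add A f g) = Add A' (farr \<nu> f) (farr \<nu> g)" if "f \<in> Hom A x y" "g \<in> Hom A x y"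
      by (rule eqA'[of _ x]) (use that in \<open>auto simp: nu_p Hom_iff\<close>)
  qed
  interpret \<nu>': additive_functor A' A \<nu>'
  proof unfold_locales
    fix f g x y z
    show "x \<in> Obj A' \<Longrightarrow> fobj \<nu>' x \<in> Obj A" by simp
    show "f \<in> Hom A' x y \<Longrightarrow> farr \<nu>' f \<in> Hom A (fobj \<nu>' x) (fobj \<nu>' y)" by (simp add: Hom_iff)
    show "farr \<nu>' (Ident A' x) = Ident A (fobj \<nu>' x)" if "x \<in> Obj A'"
      by (rule eqA[of x]) (use that in \<open>simp_all add: nu'_q\<close>)
    show "farr \<nu>' (g \<cdot>\<^bsub>A'\<^esub> f) = farr \<nu>' g \<cdot>\<^bsub>A\<^esub> farr \<nu>' f" if "f \<in> Hom A' x y" "g \<in> Hom A' y z"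
      by (rule eqA[of z])
        (use that in \<open>auto simp: nu'_q Hom_iff J.D.comp_extend[OF nu'_q]\<close>)
    show "farr \<nu>' (Add A' f g) = Add A (farr \<nu>' f) (farr \<nu>' g)" if "f \<in> Hom A' x y" "g \<in> Hom A' x y"
      by (rule eqA[of y]) (use that in \<open>auto simp: nu'_q Hom_iff\<close>)
  qed
  have adj: "adjunction A A' \<nu> \<nu>' \<theta>"
  proof unfold_locales
    fix m n assume m: "m \<in> Obj A" and n: "n \<in> Obj A'"
    show "bij_betw (\<theta> m n) (Hom A' (fobj \<nu> m) n) (Hom A m (fobj \<nu>' n))"
    proof (rule bij_betwI')
      fix h h' assume "h \<in> Hom A' (fobj \<nu> m) n" "h' \<in> Hom A' (fobj \<nu> m) n"
      then show "\<theta> m n h = \<theta> m n h' \<longleftrightarrow> h = h'"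
        using eqA'[of h m h'] m th_q[of m h n, symmetric] th_q[of m h' n, symmetric]
        by (auto simp only: Hom_iff fobjs)
    next
      fix h assume "h \<in> Hom A' (fobj \<nu> m) n"
      then show "\<theta> m n h \<in> Hom A m (fobj \<nu>' n)" using m by (simp add: Hom_iff)
    next
      fix g assume g: "g \<in> Hom A m (fobj \<nu>' n)"
      then obtain h where h: "h \<in> Hom A' (N m) n" "farr K h \<cdot>\<^bsub>D\<^esub> p m = q n \<cdot>\<^bsub>D\<^esub> farr J g"
        using universal_fromD(2)[OF p[OF m] act_left[OF qP[OF n], of g m]] by auto
      have "g = \<theta> m n h"
        by (rule eqA[of n]) (use g h m n in \<open>simp_all add: th_q Hom_iff\<close>)
      then show "\<exists>h \<in> Hom A' (fobj \<nu> m) n. g = \<theta> m n h" using h(1) by auto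
    qed
  next
    fix u m' m n h assume u: "u \<in> Hom A m' m" and n: "n \<in> Obj A'" and h: "h \<in> Hom A' (fobj \<nu> m) n"
    show "\<theta> m' n (h \<cdot>\<^bsub>A'\<^esub> farr \<nu> u) = \<theta> m n h \<cdot>\<^bsub>A\<^esub> u"
      by (rule eqA[of n])
        (use u n h in \<open>auto simp: Hom_iff th_q nu_p J.D.comp_extend[OF th_q]\<close>)
  next
    fix m v n n' h assume m: "m \<in> Obj A" and v: "v \<in> Hom A' n n'" and h: "h \<in> Hom A' (fobj \<nu> m) n"
    show "\<theta> m n' (v \<cdot>\<^bsub>A'\<^esub> h) = farr \<nu>' v \<cdot>\<^bsub>A\<^esub> \<theta> m n h"
      by (rule eqA[of n'])
        (use m v h in \<open>auto simp: Hom_iff th_q nu'_q J.D.comp_extend[OF nu'_q]\<close>)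
  qed
  show ?thesis
    by (rule that[OF adj, of p q]) (use p q in \<open>auto simp: Hom_iff nu_p th_q\<close>)
qed

end


section \<open>The Eilenberg-Moore category\<close>

lemma em_forgetful_simps [simp]:
  "fobj em_forgetful m = fst m" "farr em_forgetful (m, f, n) = f"
  by (simp_all add: em_forgetful_def)

context monad
begin

abbreviation comp_B (infixl "\<bullet>" 70) where
  "g \<bullet> f \<equiv> g \<cdot>\<^bsub>B\<^esub> f"

abbreviation M :: "('o \<times> 'a, ('o, 'a) em_arr) cat" where
  "M \<equiv> em_category B T \<eta> \<mu>"

abbreviation F :: "('o, 'a, 'o \<times> 'a, ('o, 'a) em_arr) func" where
  "F \<equiv> em_free B T \<mu>"

abbreviation U :: "('o \<times> 'a, ('o, 'a) em_arr, 'o, 'a) func" where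
  "U \<equiv> em_forgetful"

lemma em_obj_iff: "(x, s) \<in> Obj M \<longleftrightarrow> x \<in> Obj B \<and> s \<in> Arr B \<and> Dom B s = fobj T x \<and> Cod B s = x \<and>
    s \<bullet> \<eta> x = Ident B x \<and> s \<bullet> \<mu> x = s \<bullet> farr T s"
  by (auto simp: em_category_def em_module_def Hom_iff)

lemma em_obj [simp]:
  assumes "m \<in> Obj M"
  shows "fst m \<in> Obj B" "snd m \<in> Arr B" "Dom B (snd m) = fobj T (fst m)" "Cod B (snd m) = fst m"
    "snd m \<bullet> \<eta> (fst m) = Ident B (fst m)"
  using assms by (cases m, simp add: em_obj_iff)+

lemma em_obj_assoc: "m \<in> Obj M \<Longrightarrow> snd m \<bullet> \<mu> (fst m) = snd m \<bullet> farr T (snd m)"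
  by (cases m) (simp add: em_obj_iff)

lemma em_arr_iff: "(m, f, n) \<in> Arr M \<longleftrightarrow> m \<in> Obj M \<and> n \<in> Obj M \<and> f \<in> Arr B \<and>
    Dom B f = fst m \<and> Cod B f = fst n \<and> f \<bullet> snd m = snd n \<bullet> farr T f"
  by (cases m; cases n) (auto simp: em_category_def Hom_iff)

lemma em_dom_cod [simp]: "Dom M (m, f, n) = m" "Cod M (m, f, n) = n"
  by (simp_all add: em_category_def)

lemma em_ident_tuple: "Ident M m = (m, Ident B (fst m), m)"
  by (simp add: em_category_def)

lemma em_zero_tuple: "Zero M m n = (m, Zero B (fst m) (fst n), n)"
  by (simp add: em_category_def)

lemma em_comp_tuple: "(m', g, n') \<cdot>\<^bsub>M\<^esub> (m, f, n) = (m, g \<bullet> f, n')"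
  by (simp add: em_category_def)

lemma em_add_tuple: "Add M (m, f, n) (m', g, n') = (m, Add B f g, n)"
  by (simp add: em_category_def)

lemma em_forget_comp [simp]:
  "farr U (g \<cdot>\<^bsub>M\<^esub> f) = farr U g \<bullet> farr U f" "farr U (Add M f g) = Add B (farr U f) (farr U g)"
  "farr U (Ident M m) = Ident B (fst m)" "farr U (Zero M m n) = Zero B (fst m) (fst n)"
  by (cases f; cases g; simp add: em_comp_tuple em_add_tuple em_ident_tuple em_zero_tuple)+

lemma em_arr_tuple: "h = (Dom M h, farr U h, Cod M h)"
  by (cases h) simp

lemma em_arr_objs: "h \<in> Arr M \<Longrightarrow> Dom M h \<in> Obj M" "h \<in> Arr M \<Longrightarrow> Cod M h \<in> Obj M"
  by (cases h, auto simp: em_arr_iff)+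

lemma em_forget_arr [simp]:
  assumes "h \<in> Arr M"
  shows "farr U h \<in> Arr B" "Dom B (farr U h) = fst (Dom M h)" "Cod B (farr U h) = fst (Cod M h)"
  using assms by (cases h, simp add: em_arr_iff)+

lemma em_linear:
  "h \<in> Arr M \<Longrightarrow> Dom M h = m \<Longrightarrow> Cod M h = n \<Longrightarrow> farr U h \<bullet> snd m = snd n \<bullet> farr T (farr U h)"
  using em_arr_iff[of m "farr U h" n] em_arr_tuple[of h] by simp

lemma em_eqI:
  assumes "Dom M h = Dom M h'" "Cod M h = Cod M h'" "farr U h = farr U h'"
  shows "h = h'"
  using assms em_arr_tuple by metis

lemma em_hom_group:
  assumes m: "m \<in> Obj M" and n: "n \<in> Obj M"
  shows "comm_group (Hom_group M m n)"
proof -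
  note [simp] = em_zero_tuple
  interpret G: comm_group "Hom_group B (fst m) (fst n)" using T.C.hom_group m n by simp
  have hom: "h \<in> Hom M m n \<longleftrightarrow> (\<exists>f. h = (m, f, n) \<and> f \<in> Arr B \<and> Dom B f = fst m \<and> Cod B f = fst n \<and>
      f \<bullet> snd m = snd n \<bullet> farr T f)" for h
    using m n by (cases h) (auto simp: Hom_iff em_arr_iff)
  have comm: "Add B a b = Add B b a" if "a \<in> Arr B" "b \<in> Arr B" "Dom B a = fst m" "Dom B b = fst m"
    "Cod B a = fst n" "Cod B b = fst n" for a b
    using G.m_comm[of a b] that by (simp add: Hom_iff)
  have assoc: "Add B (Add B a b) c = Add B a (Add B b c)" if "a \<in> Arr B" "b \<in> Arr B" "c \<in> Arr B"
    "Dom B a = fst m" "Dom B b = fst m" "Dom B c = fst m"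
    "Cod B a = fst n" "Cod B b = fst n" "Cod B c = fst n" for a b c
    using G.m_assoc[of a b c] that by (simp add: Hom_iff)
  show ?thesis
  proof (rule comm_groupI, simp_all only: monoid.simps partial_object.simps)
    fix f g assume fg: "f \<in> Hom M m n" "g \<in> Hom M m n"
    then show "Add M f g \<in> Hom M m n"
      using m n by (auto simp: hom em_add_tuple)
    show "Add M f g = Add M g f"
      using fg by (auto simp: hom em_add_tuple intro: comm)
  next
    show "Zero M m n \<in> Hom M m n" using m n by (auto simp: hom)
  next
    fix f g h assume "f \<in> Hom M m n" "g \<in> Hom M m n" "h \<in> Hom M m n"
    then show "Add M (Add M f g) h = Add M f (Add M g h)"
      by (auto simp: hom em_add_tuple intro: assoc)
  next
    fix f assume f: "f \<in> Hom M m n"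
    then show "Add M (Zero M m n) f = f" using m n by (auto simp: hom em_add_tuple)
    obtain k where k: "f = (m, k, n)" "k \<in> Hom B (fst m) (fst n)" "k \<bullet> snd m = snd n \<bullet> farr T k"
      using f hom[of f] by (auto simp: Hom_def)
    \<comment> \<open>The negative of a module morphism is one because addition is cancellable.\<close>
    let ?k = "inv\<^bsub>Hom_group B (fst m) (fst n)\<^esub> k"
    have k': "?k \<in> Hom B (fst m) (fst n)" "Add B ?k k = Zero B (fst m) (fst n)"
      using G.inv_closed[of k] G.l_inv[of k] k(2) by simp_all
    interpret G': comm_group "Hom_group B (fobj T (fst m)) (fst n)" using T.C.hom_group m n by simp
    have "Add B ?k k \<bullet> snd m = snd n \<bullet> farr T (Add B ?k k)"
      unfolding k'(2) using m n by simp
    then have "Add B (?k \<bullet> snd m) (k \<bullet> snd m) = Add B (snd n \<bullet> farr T ?k) (k \<bullet> snd m)"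
      using m n k k'(1) by (simp add: Hom_iff)
    then have "?k \<bullet> snd m = snd n \<bullet> farr T ?k"
      using G'.right_cancel[of "k \<bullet> snd m" "?k \<bullet> snd m" "snd n \<bullet> farr T ?k"] m n k k' by (simp add: Hom_iff)
    then have "(m, ?k, n) \<in> Hom M m n" "Add M (m, ?k, n) f = Zero M m n"
      using k k' hom[of "(m, ?k, n)"] by (auto simp: em_add_tuple Hom_def)
    then show "\<exists>g\<in>Hom M m n. Add M g f = Zero M m n" by blast
  qed
qed

lemma em_preadditive: "preadditive_category M"
proof (rule preadditive_category.intro)
  fix f assume "f \<in> Arr M"
  then show "Dom M f \<in> Obj M" "Cod M f \<in> Obj M" by (rule em_arr_objs)+
next
  fix x assume "x \<in> Obj M"
  then show "Ident M x \<in> Hom M x x" by (simp add: Hom_iff em_arr_iff em_ident_tuple)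
next
  fix f g x y z assume f: "f \<in> Hom M x y" and g: "g \<in> Hom M y z"
  have "(farr U g \<bullet> farr U f) \<bullet> snd x = snd z \<bullet> farr T (farr U g \<bullet> farr U f)"
    using f g em_arr_objs[of f] em_arr_objs[of g] em_linear[of f x y] em_linear[of g y z]
      T.C.comp_extend[of "farr U g" "snd y" _ "farr T (farr U f)"] by (auto simp: Hom_iff)
  moreover have "g \<cdot>\<^bsub>M\<^esub> f = (Dom M f, farr U g \<bullet> farr U f, Cod M g)"
    by (cases f; cases g) (simp add: em_comp_tuple)
  ultimately show "g \<cdot>\<^bsub>M\<^esub> f \<in> Hom M x z"
    using f g em_arr_objs[of f] em_arr_objs[of g] by (auto simp: Hom_iff em_arr_iff)
next
  fix f x y assume f: "f \<in> Hom M x y"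
  obtain h where h: "f = (x, h, y)" "h \<in> Arr B" "Dom B h = fst x" "Cod B h = fst y"
    using f by (cases f) (auto simp: Hom_iff em_arr_iff)
  show "f \<cdot>\<^bsub>M\<^esub> Ident M x = f" "Ident M y \<cdot>\<^bsub>M\<^esub> f = f" using h by (simp_all add: em_comp_tuple em_ident_tuple)
next
  fix f g h w x y z assume "f \<in> Hom M w x" "g \<in> Hom M x y" "h \<in> Hom M y z"
  then show "h \<cdot>\<^bsub>M\<^esub> (g \<cdot>\<^bsub>M\<^esub> f) = h \<cdot>\<^bsub>M\<^esub> g \<cdot>\<^bsub>M\<^esub> f"
    by (cases f; cases g; cases h) (auto simp: em_comp_tuple Hom_iff em_arr_iff)
next
  fix f f' g x y z assume "f \<in> Hom M x y" "f' \<in> Hom M x y" "g \<in> Hom M y z"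
  then show "g \<cdot>\<^bsub>M\<^esub> Add M f f' = Add M (g \<cdot>\<^bsub>M\<^esub> f) (g \<cdot>\<^bsub>M\<^esub> f')"
    by (cases f; cases f'; cases g) (auto simp: em_comp_tuple em_add_tuple Hom_iff em_arr_iff)
next
  fix f g g' x y z assume "f \<in> Hom M x y" "g \<in> Hom M y z" "g' \<in> Hom M y z"
  then show "Add M g g' \<cdot>\<^bsub>M\<^esub> f = Add M (g \<cdot>\<^bsub>M\<^esub> f) (g' \<cdot>\<^bsub>M\<^esub> f)"
    by (cases f; cases g; cases g') (auto simp: em_comp_tuple em_add_tuple Hom_iff em_arr_iff)
qed (rule em_hom_group)

end

sublocale monad \<subseteq> M: preadditive_category M
  by (rule em_preadditive)

context monad
begin

lemma em_forgetful_functor: "additive_functor M B U"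
  by unfold_locales (auto simp: Hom_iff)

lemma em_forgetful_faithful: "faithful_functor M B U"
  using em_forgetful_functor
  by (auto simp: faithful_functor_def inj_on_def Hom_iff intro!: em_eqI)

lemma em_free_obj [simp]: "fobj F x = (fobj T x, \<mu> x)"
  by (simp add: em_free_def)

lemma em_free_in_Obj [simp]: "x \<in> Obj B \<Longrightarrow> (fobj T x, \<mu> x) \<in> Obj M"
  using mult_assoc mult_unit_left by (simp add: em_obj_iff)

lemma em_forget_free [simp]: "farr U (farr F f) = farr T f"
  by (simp add: em_free_def)

lemma em_free_arr [simp]:
  assumes "f \<in> Arr B"
  shows "farr F f \<in> Arr M" "Dom M (farr F f) = (fobj T (Dom B f), \<mu> (Dom B f))"
    "Cod M (farr F f) = (fobj T (Cod B f), \<mu> (Cod B f))"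
  using assms \<mu>.naturality[of f] by (auto simp: em_free_def em_arr_iff)

lemma em_free_functor: "additive_functor B M F"
  by unfold_locales (auto simp: Hom_iff intro!: em_eqI)

lemma em_forgetful_comp_free: "U \<circ>\<^sub>F F = T"
  by (cases T) (simp add: comp_func_def em_free_def em_forgetful_def comp_def)

text \<open>The inverse of the adjunction bijection sends \<open>g : x \<rightarrow> U m\<close> to \<open>s \<bullet> T g\<close>, where \<open>s\<close> is the
  structure morphism of \<open>m\<close>.\<close>

lemma em_extend:
  assumes "g \<in> Arr B" "Dom B g = x" "Cod B g = fst m" "m \<in> Obj M"
  shows "((fobj T x, \<mu> x), snd m \<bullet> farr T g, m) \<in> Arr M" "(snd m \<bullet> farr T g) \<bullet> \<eta> x = g"
proof -
  have x: "x \<in> Obj B" using assms by auto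
  have "(snd m \<bullet> farr T g) \<bullet> \<mu> x = snd m \<bullet> farr T (snd m \<bullet> farr T g)"
    using assms x \<mu>.naturality[of g x "fst m"] T.C.comp_extend[OF em_obj_assoc, of m "farr T (farr T g)"]
    by simp
  then show "((fobj T x, \<mu> x), snd m \<bullet> farr T g, m) \<in> Arr M"
    using assms x by (simp add: em_arr_iff)
  show "(snd m \<bullet> farr T g) \<bullet> \<eta> x = g"
    using assms x \<eta>.naturality[of g x "fst m"] T.C.comp_extend[OF em_obj(5), of m g] by simp
qed

lemma em_extend_unique:
  assumes "h \<in> Arr M" "Dom M h = (fobj T x, \<mu> x)" "Cod M h = m" "x \<in> Obj B"
  shows "farr U h = snd m \<bullet> farr T (farr U h \<bullet> \<eta> x)"
proof -
  have "snd m \<bullet> farr T (farr U h \<bullet> \<eta> x) = (farr U h \<bullet> \<mu> x) \<bullet> farr T (\<eta> x)"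
    using assms em_arr_objs(2)[of h] em_linear[OF assms(1-3)]
      T.C.comp_extend[OF em_linear[OF assms(1-3)], of "farr T (\<eta> x)"] by simp
  also have "\<dots> = farr U h" using assms mult_unit_right[of x] by simp
  finally show ?thesis by simp
qed

lemma em_adjunction: "adjunction B M F U (em_adj B \<eta>)"
proof -
  interpret F: additive_functor B M F by (rule em_free_functor)
  interpret U: additive_functor M B U by (rule em_forgetful_functor)
  show ?thesis
  proof
    fix x m assume x: "x \<in> Obj B" and m: "m \<in> Obj M"
    show "bij_betw (em_adj B \<eta> x m) (Hom M (fobj F x) m) (Hom B x (fobj U m))"
    proof (rule bij_betwI')
      fix h h' assume hh': "h \<in> Hom M (fobj F x) m" "h' \<in> Hom M (fobj F x) m"
      have "h = h'" if "em_adj B \<eta> x m h = em_adj B \<eta> x m h'"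
      proof (rule em_eqI)
        show "farr U h = farr U h'"
          using em_extend_unique[of h x m] em_extend_unique[of h' x m] that x hh'
          by (simp only: Hom_iff em_adj_def em_free_obj)
      qed (use hh' in \<open>simp_all add: Hom_iff\<close>)
      then show "em_adj B \<eta> x m h = em_adj B \<eta> x m h' \<longleftrightarrow> h = h'" by blast
    next
      fix h assume "h \<in> Hom M (fobj F x) m"
      then show "em_adj B \<eta> x m h \<in> Hom B x (fobj U m)" using x by (simp add: Hom_iff em_adj_def)
    next
      fix g assume "g \<in> Hom B x (fobj U m)"
      then show "\<exists>h \<in> Hom M (fobj F x) m. g = em_adj B \<eta> x m h"
        using em_extend[of g x m] m
        by (intro bexI[of _ "(fobj F x, snd m \<bullet> farr T g, m)"]) (simp_all add: Hom_iff em_adj_def)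
    qed
  next
    fix u d' d e h assume "u \<in> Hom B d' d" "e \<in> Obj M" "h \<in> Hom M (fobj F d) e"
    then show "em_adj B \<eta> d' e (h \<cdot>\<^bsub>M\<^esub> farr F u) = em_adj B \<eta> d e h \<bullet> u"
      using \<eta>.naturality[of u d' d] by (auto simp: Hom_iff em_adj_def)
  next
    fix d v e e' h assume "d \<in> Obj B" "v \<in> Hom M e e'" "h \<in> Hom M (fobj F d) e"
    then show "em_adj B \<eta> d e' (v \<cdot>\<^bsub>M\<^esub> h) = farr U v \<bullet> em_adj B \<eta> d e h"
      by (simp add: Hom_iff em_adj_def)
  qed
qed

end


section \<open>From a Nakayama functor to an ambidextrous adjunction\<close>

text \<open>The transpose of \<open>L h\<close> is \<open>unit d' \<cdot> h\<close>. So transposition, which is bijective, identifies the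
  map \<open>h \<mapsto> L h\<close> with composition with the unit at \<open>d'\<close>.\<close>

lemma (in adjunction) fully_faithful_if_unit_iso:
  assumes d: "d \<in> Obj D" "d' \<in> Obj D" and iso: "is_iso D (unit d')"
  shows "bij_betw (farr L) (Hom D d d') (Hom E (fobj L d) (fobj L d'))"
proof (rule bij_betwI')
  obtain w where w: "w \<in> Arr D" "Dom D w = fobj R (fobj L d')" "Cod D w = d'"
    "w \<cdot>\<^bsub>D\<^esub> unit d' = Ident D d'" "unit d' \<cdot>\<^bsub>D\<^esub> w = Ident D (fobj R (fobj L d'))"
    using iso d by (auto simp: is_iso_def Hom_iff)
  fix h h' assume h: "h \<in> Hom D d d'" "h' \<in> Hom D d d'"
  show "farr L h = farr L h' \<longleftrightarrow> h = h'"
  proof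
    assume "farr L h = farr L h'"
    then have "unit d' \<cdot>\<^bsub>D\<^esub> h = unit d' \<cdot>\<^bsub>D\<^esub> h'"
      using tr_farr[of h d d'] tr_farr[of h' d d'] h by (simp add: Hom_iff)
    then have "w \<cdot>\<^bsub>D\<^esub> (unit d' \<cdot>\<^bsub>D\<^esub> h) = w \<cdot>\<^bsub>D\<^esub> (unit d' \<cdot>\<^bsub>D\<^esub> h')" by simp
    then show "h = h'"
      using L.C.comp_extend[OF w(4), of h] L.C.comp_extend[OF w(4), of h'] w(1-3) h d by (simp add: Hom_iff)
  qed simp
next
  fix h assume "h \<in> Hom D d d'"
  then show "farr L h \<in> Hom E (fobj L d) (fobj L d')" by (simp add: Hom_iff)
next
  obtain w where w: "w \<in> Arr D" "Dom D w = fobj R (fobj L d')" "Cod D w = d'"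
    "unit d' \<cdot>\<^bsub>D\<^esub> w = Ident D (fobj R (fobj L d'))"
    using iso d by (auto simp: is_iso_def Hom_iff)
  fix k assume k: "k \<in> Hom E (fobj L d) (fobj L d')"
  let ?h = "w \<cdot>\<^bsub>D\<^esub> \<phi> d (fobj L d') k"
  have h: "?h \<in> Hom D d d'" using k d w by (simp add: Hom_iff)
  have "\<phi> d (fobj L d') (farr L ?h) = \<phi> d (fobj L d') k"
    using tr_farr[of ?h d d'] h L.C.comp_extend[OF w(4), of "\<phi> d (fobj L d') k"] w(1-3) k d
    by (simp add: Hom_iff)
  then have "k = farr L ?h"
    by (rule tr_inj[symmetric]) (use h k d in \<open>simp_all add: Hom_iff\<close>)
  then show "\<exists>h \<in> Hom D d d'. k = farr L h" using h by blast
qed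

context monad
begin

text \<open>If \<open>U\<close> has a right adjoint of the form \<open>\<nu> \<circ>\<^sub>F F\<close>, then \<open>T = U \<circ>\<^sub>F F\<close> has the right
  adjoint \<open>U \<circ>\<^sub>F \<nu> \<circ>\<^sub>F F\<close>, which is the comonad of that adjunction. If \<open>\<nu>\<close> is moreover
  fully faithful on free modules, then
  \<open>B(U (\<nu> (F x)), y) \<cong> M(\<nu> (F x), \<nu> (F y)) \<cong> M(F x, F y) \<cong> B(x, T y)\<close>
  makes it a left adjoint of \<open>T\<close> as well.\<close>

lemma ambidextrous_if_fully_faithful_on_free:
  assumes nu: "additive_functor M M \<nu>" and H: "adjunction M B U (\<nu> \<circ>\<^sub>F F) \<psi>'"
    and ff: "\<And>x y. \<lbrakk>x \<in> Obj B; y \<in> Obj B\<rbrakk> \<Longrightarrow>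
      bij_betw (farr \<nu>) (Hom M (fobj F x) (fobj F y)) (Hom M (fobj \<nu> (fobj F x)) (fobj \<nu> (fobj F y)))"
  shows "\<exists>S \<epsilon> \<Delta>. comonad B S \<epsilon> \<Delta> \<and> ambidextrous_adjunction B S \<epsilon> \<Delta> T \<eta> \<mu>"
proof -
  interpret \<nu>: additive_functor M M \<nu> by (rule nu)
  interpret F: additive_functor B M F by (rule em_free_functor)
  interpret H: adjunction M B U "\<nu> \<circ>\<^sub>F F" \<psi>' by (rule H)
  define S where "S = U \<circ>\<^sub>F (\<nu> \<circ>\<^sub>F F)"
  define \<epsilon> where "\<epsilon> = H.counit"
  define \<delta> where "\<delta> x = H.unit (fobj \<nu> (fobj F x))" for x
  define \<Delta> where "\<Delta> x = farr U (\<delta> x)" for x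
  have S [simp]: "fobj S x = fst (fobj \<nu> (fobj F x))" "farr S f = farr U (farr \<nu> (farr F f))" for x f
    by (simp_all add: S_def)
  have \<delta> [simp]: "\<delta> x \<in> Arr M" "Dom M (\<delta> x) = fobj \<nu> (fobj F x)"
    "Cod M (\<delta> x) = fobj \<nu> (fobj F (fst (fobj \<nu> (fobj F x))))" if "x \<in> Obj B" for x
    using that by (simp_all add: \<delta>_def)
  have nuF [simp]: "x \<in> Obj B \<Longrightarrow> fobj \<nu> (fobj T x, \<mu> x) \<in> Obj M" for x
    using \<nu>.fobj_in_Obj[of "fobj F x"] by simp
  have com: "comonad B S \<epsilon> \<Delta>"
    using H.comonad by (simp add: S_def \<epsilon>_def \<Delta>_def[abs_def] \<delta>_def)
  interpret comonad B S \<epsilon> \<Delta> by (rule com)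
  note comonad_nat = \<Delta>.nat_trans_axioms \<epsilon>.nat_trans_axioms
  note monad_nat = \<mu>.nat_trans_axioms \<eta>.nat_trans_axioms
  have id_adj: "adjunction B B id_func id_func id_adj"
    by (rule id_adjunction) unfold_locales

  \<comment> \<open>The right adjoint: compose the adjunctions of \<open>F\<close> and \<open>U\<close> and of \<open>U\<close> and \<open>\<nu> \<circ>\<^sub>F F\<close>.\<close>
  define \<psi> where "\<psi> = comp_adj F (\<nu> \<circ>\<^sub>F F) (em_adj B \<eta>) \<psi>'"
  have \<psi>: "\<psi> x y h = farr U (\<psi>' (fobj F x) y h) \<bullet> \<eta> x" for x y h
    by (simp add: \<psi>_def comp_adj_def em_adj_def)
  have adj\<psi>: "adjunction B B T S \<psi>"
    using adjunction_comp[OF em_adjunction H] by (simp add: S_def \<psi>_def em_forgetful_comp_free)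
  have conj_mult: "comp_adj T S \<psi> \<psi> x y (h \<bullet> \<mu> x) = \<Delta> y \<bullet> \<psi> x y h"
    if x: "x \<in> Obj B" and h: "h \<in> Hom B (fobj T x) y" for x y h
  proof -
    have y: "y \<in> Obj B" using h by (auto simp: Hom_iff)
    have mu: "(fobj F (fobj T x), \<mu> x, fobj F x) \<in> Arr M"
      using x mult_assoc[of x] by (simp add: em_arr_iff)
    let ?p = "\<psi>' (fobj F x) y h"
    have "\<psi>' (fobj F (fobj T x)) y (h \<bullet> \<mu> x) = ?p \<cdot>\<^bsub>M\<^esub> (fobj F (fobj T x), \<mu> x, fobj F x)"
      using H.tr_precomp[OF mu, of h y] h x by (simp add: Hom_iff)
    then have "\<psi> (fobj T x) y (h \<bullet> \<mu> x) = farr U ?p"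
      using x h mult_unit_left[of x] by (simp add: \<psi> Hom_iff)
    moreover have "\<psi>' (fobj F x) (fobj S y) (farr U ?p) = \<delta> y \<cdot>\<^bsub>M\<^esub> ?p"
      using H.tr_farr[of ?p "fobj F x" "fobj (\<nu> \<circ>\<^sub>F F) y"] x h by (simp add: \<delta>_def Hom_iff)
    ultimately show ?thesis
      using x y h by (simp add: comp_adj_def \<psi> \<Delta>_def Hom_iff)
  qed
  have conj_unit: "h \<bullet> \<eta> x = \<epsilon> y \<bullet> \<psi> x y h" if x: "x \<in> Obj B" and h: "h \<in> Hom B (fobj T x) y" for x y h
  proof -
    have "y \<in> Obj B" using h by (auto simp: Hom_iff)
    then show ?thesis
      using H.counit_tr[of "fobj F x" h y] T.C.comp_extend[OF H.counit_tr[of "fobj F x" h y], of "\<eta> x"] x h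
      by (simp add: \<psi> \<epsilon>_def Hom_iff)
  qed
  have right: "monad_left_adjoint_comonad B T \<eta> \<mu> S \<epsilon> \<Delta>"
    unfolding monad_left_adjoint_comonad_def conjugate_def
    using adj\<psi> adjunction_comp[OF adj\<psi> adj\<psi>] id_adj monad_nat comonad_nat com monad_axioms
    by (auto simp: conj_mult conj_unit id_adj_def intro!: exI[of _ \<psi>])

  \<comment> \<open>The left adjoint: \<open>\<kappa>\<close> inverts \<open>\<nu>\<close> on morphisms between free modules.\<close>
  define \<kappa> where "\<kappa> x y = inv_into (Hom M (fobj F x) (fobj F y)) (farr \<nu>)" for x y
  have \<kappa>: "\<kappa> x y k \<in> Arr M" "Dom M (\<kappa> x y k) = fobj F x" "Cod M (\<kappa> x y k) = fobj F y"
      "farr \<nu> (\<kappa> x y k) = k"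
    if "x \<in> Obj B" "y \<in> Obj B" "k \<in> Arr M" "Dom M k = fobj \<nu> (fobj F x)" "Cod M k = fobj \<nu> (fobj F y)" for x y k
  proof -
    have "k \<in> farr \<nu> ` Hom M (fobj F x) (fobj F y)"
      using ff[OF that(1,2)] that by (simp add: bij_betw_def Hom_iff)
    then have "\<kappa> x y k \<in> Hom M (fobj F x) (fobj F y)" "farr \<nu> (\<kappa> x y k) = k"
      unfolding \<kappa>_def by (auto intro: inv_into_into f_inv_into_f)
    then show "\<kappa> x y k \<in> Arr M" "Dom M (\<kappa> x y k) = fobj F x" "Cod M (\<kappa> x y k) = fobj F y"
      "farr \<nu> (\<kappa> x y k) = k" by (simp_all add: Hom_iff)
  qed
  have \<kappa>_eq: "\<kappa> x y k = h" if "x \<in> Obj B" "y \<in> Obj B" "h \<in> Arr M" "Dom M h = fobj F x" "Cod M h = fobj F y"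
    "farr \<nu> h = k" for x y h k
    unfolding \<kappa>_def using that ff[OF that(1,2)]
    by (auto simp: bij_betw_def Hom_iff intro!: inv_into_f_eq)
  define \<phi> where "\<phi> x y h = farr U (\<kappa> x y (\<psi>' (fobj \<nu> (fobj F x)) y h)) \<bullet> \<eta> x" for x y h
  have adj\<phi>: "adjunction B B S T \<phi>"
  proof
    fix x y assume x: "x \<in> Obj B" and y: "y \<in> Obj B"
    have "bij_betw (em_adj B \<eta> x (fobj F y) \<circ> (\<kappa> x y \<circ> \<psi>' (fobj \<nu> (fobj F x)) y))
      (Hom B (fst (fobj \<nu> (fobj F x))) y) (Hom B x (fst (fobj F y)))"
    proof (intro bij_betw_trans)
      show "bij_betw (\<psi>' (fobj \<nu> (fobj F x)) y) (Hom B (fst (fobj \<nu> (fobj F x))) y)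
          (Hom M (fobj \<nu> (fobj F x)) (fobj \<nu> (fobj F y)))"
        using H.adj_bij[of "fobj \<nu> (fobj F x)" y] x y by simp
      show "bij_betw (\<kappa> x y) (Hom M (fobj \<nu> (fobj F x)) (fobj \<nu> (fobj F y))) (Hom M (fobj F x) (fobj F y))"
        unfolding \<kappa>_def by (rule bij_betw_inv_into[OF ff[OF x y]])
      show "bij_betw (em_adj B \<eta> x (fobj F y)) (Hom M (fobj F x) (fobj F y)) (Hom B x (fst (fobj F y)))"
        using adjunction.adj_bij[OF em_adjunction, of x "fobj F y"] x y by simp
    qed
    moreover have "em_adj B \<eta> x (fobj F y) \<circ> (\<kappa> x y \<circ> \<psi>' (fobj \<nu> (fobj F x)) y) = \<phi> x y"
      by (simp add: fun_eq_iff \<phi>_def em_adj_def)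
    ultimately show "bij_betw (\<phi> x y) (Hom B (fobj S x) y) (Hom B x (fobj T y))" by simp
  next
    fix u x' x y h assume u: "u \<in> Hom B x' x" and y: "y \<in> Obj B" and h: "h \<in> Hom B (fobj S x) y"
    let ?k = "\<psi>' (fobj \<nu> (fobj F x)) y h"
    have x: "x \<in> Obj B" "x' \<in> Obj B" using u by (auto simp: Hom_iff)
    have k: "?k \<in> Arr M" "Dom M ?k = fobj \<nu> (fobj F x)" "Cod M ?k = fobj \<nu> (fobj F y)"
      using h x by (simp_all add: Hom_iff)
    have "\<psi>' (fobj \<nu> (fobj F x')) y (h \<bullet> farr S u) = ?k \<cdot>\<^bsub>M\<^esub> farr \<nu> (farr F u)"
      using H.tr_precomp[of "farr \<nu> (farr F u)" h y] u h by (simp add: Hom_iff)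
    moreover have "\<kappa> x' y (?k \<cdot>\<^bsub>M\<^esub> farr \<nu> (farr F u)) = \<kappa> x y ?k \<cdot>\<^bsub>M\<^esub> farr F u"
      by (rule \<kappa>_eq) (use \<kappa>[OF x(1) y k] x y u k in \<open>simp_all add: Hom_iff\<close>)
    ultimately show "\<phi> x' y (h \<bullet> farr S u) = \<phi> x y h \<bullet> u"
      using \<kappa>[OF x(1) y k] x u \<eta>.naturality[of u x' x] by (simp add: \<phi>_def Hom_iff)
  next
    fix x v y y' h assume x: "x \<in> Obj B" and v: "v \<in> Hom B y y'" and h: "h \<in> Hom B (fobj S x) y"
    let ?k = "\<psi>' (fobj \<nu> (fobj F x)) y h"
    have y: "y \<in> Obj B" "y' \<in> Obj B" using v by (auto simp: Hom_iff)
    have k: "?k \<in> Arr M" "Dom M ?k = fobj \<nu> (fobj F x)" "Cod M ?k = fobj \<nu> (fobj F y)"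
      using h x by (simp_all add: Hom_iff)
    have "\<psi>' (fobj \<nu> (fobj F x)) y' (v \<bullet> h) = farr \<nu> (farr F v) \<cdot>\<^bsub>M\<^esub> ?k"
      using H.tr_postcomp[of v h "fobj \<nu> (fobj F x)" y'] x v h by (simp add: Hom_iff)
    moreover have "\<kappa> x y' (farr \<nu> (farr F v) \<cdot>\<^bsub>M\<^esub> ?k) = farr F v \<cdot>\<^bsub>M\<^esub> \<kappa> x y ?k"
      by (rule \<kappa>_eq) (use \<kappa>[OF x y(1) k] x y v k in \<open>simp_all add: Hom_iff\<close>)
    ultimately show "\<phi> x y' (v \<bullet> h) = farr T v \<bullet> \<phi> x y h"
      using \<kappa>[OF x y(1) k] x v by (simp add: \<phi>_def Hom_iff)
  qed
  have conj_comult: "\<phi> x y (h \<bullet> \<Delta> x) = \<mu> y \<bullet> comp_adj S T \<phi> \<phi> x y h"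
    if x: "x \<in> Obj B" and h: "h \<in> Hom B (fobj S (fobj S x)) y" for x y h
  proof -
    have y: "y \<in> Obj B" using h by (auto simp: Hom_iff)
    have Sx: "fobj S x \<in> Obj B" using x by (rule S.fobj_in_Obj)
    let ?k = "\<psi>' (fobj \<nu> (fobj F (fobj S x))) y h"
    have k: "?k \<in> Arr M" "Dom M ?k = fobj \<nu> (fobj F (fobj S x))" "Cod M ?k = fobj \<nu> (fobj F y)"
      using h x by (simp_all add: Hom_iff)
    \<comment> \<open>Both sides will be equal to \<open>U a \<bullet> U c \<bullet> \<eta> x\<close>, where \<open>\<nu> a\<close> is the transpose of \<open>h\<close> and \<open>\<nu> c\<close>
      is the unit \<open>\<delta> x\<close>.\<close>
    define a where "a = \<kappa> (fobj S x) y ?k"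
    define c where "c = \<kappa> x (fobj S x) (\<delta> x)"
    have a: "a \<in> Arr M" "Dom M a = fobj F (fobj S x)" "Cod M a = fobj F y" "farr \<nu> a = ?k"
      unfolding a_def using \<kappa>[OF Sx y k] .
    have c: "c \<in> Arr M" "Dom M c = fobj F x" "Cod M c = fobj F (fobj S x)" "farr \<nu> c = \<delta> x"
      unfolding c_def using \<kappa>[OF x Sx, of "\<delta> x"] x by simp_all
    define g where "g = farr U a \<bullet> \<eta> (fobj S x)"
    have g: "g \<in> Arr B" "Dom B g = fobj S x" "Cod B g = fobj T y"
      using a Sx by (simp_all add: g_def)
    have "\<psi>' (fobj \<nu> (fobj F x)) y (h \<bullet> \<Delta> x) = ?k \<cdot>\<^bsub>M\<^esub> \<delta> x"
      using H.tr_precomp[of "\<delta> x" h y] x h by (simp add: \<Delta>_def Hom_iff)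
    moreover have "\<kappa> x y (?k \<cdot>\<^bsub>M\<^esub> \<delta> x) = a \<cdot>\<^bsub>M\<^esub> c"
      by (rule \<kappa>_eq) (use a c x y in simp_all)
    ultimately have 1: "\<phi> x y (h \<bullet> \<Delta> x) = farr U a \<bullet> (farr U c \<bullet> \<eta> x)"
      using a c x by (simp add: \<phi>_def)
    have "\<psi>' (fobj \<nu> (fobj F x)) (fobj T y) g = farr \<nu> (farr F g) \<cdot>\<^bsub>M\<^esub> \<delta> x"
      using H.tr_eq_unit[of "fobj \<nu> (fobj F x)" g "fobj T y"] x g by (simp add: \<delta>_def)
    moreover have "\<kappa> x (fobj T y) (farr \<nu> (farr F g) \<cdot>\<^bsub>M\<^esub> \<delta> x) = farr F g \<cdot>\<^bsub>M\<^esub> c"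
      by (rule \<kappa>_eq) (use g c x y in simp_all)
    ultimately have 2: "\<phi> x (fobj T y) g = farr T g \<bullet> (farr U c \<bullet> \<eta> x)"
      using g c x by (simp add: \<phi>_def)
    have "farr U a = \<mu> y \<bullet> farr T g"
      using em_extend_unique[of a "fobj S x" "fobj F y"] a Sx unfolding g_def by simp
    then have "farr U a \<bullet> (farr U c \<bullet> \<eta> x) = \<mu> y \<bullet> (farr T g \<bullet> (farr U c \<bullet> \<eta> x))"
      using g c x y by simp
    then show ?thesis
      unfolding comp_adj_def 1 2[symmetric] by (simp add: \<phi>_def g_def a_def)
  qed
  have conj_counit: "\<phi> x y (h \<bullet> \<epsilon> x) = \<eta> y \<bullet> h" if h: "h \<in> Hom B x y" for x y h
  proof -
    have xy: "x \<in> Obj B" "y \<in> Obj B" using h by (auto simp: Hom_iff)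
    have "\<psi>' (fobj \<nu> (fobj F x)) y (h \<bullet> \<epsilon> x) = farr \<nu> (farr F h)"
      using H.tr_postcomp[of h "\<epsilon> x" "fobj \<nu> (fobj F x)" y] H.counit[of x] xy h
      by (simp add: \<epsilon>_def Hom_iff)
    moreover have "\<kappa> x y (farr \<nu> (farr F h)) = farr F h"
      by (rule \<kappa>_eq) (use h xy in \<open>simp_all add: Hom_iff\<close>)
    ultimately show ?thesis using \<eta>.naturality[of h x y] h by (simp add: \<phi>_def Hom_iff)
  qed
  have left: "comonad_left_adjoint_monad B S \<epsilon> \<Delta> T \<eta> \<mu>"
    unfolding comonad_left_adjoint_monad_def conjugate_def
    using adj\<phi> adjunction_comp[OF adj\<phi> adj\<phi>] id_adj monad_nat comonad_nat com monad_axioms conj_comult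
    by (auto simp: conj_counit id_adj_def intro!: exI[of _ \<phi>])
  show ?thesis
    unfolding ambidextrous_adjunction_def using com left right by blast
qed

lemma nakayama_imp_ambidextrous:
  assumes "nakayama_functor B M F U (em_adj B \<eta>) \<nu>"
  shows "\<exists>S \<epsilon> \<Delta>. comonad B S \<epsilon> \<Delta> \<and> ambidextrous_adjunction B S \<epsilon> \<Delta> T \<eta> \<mu>"
proof -
  obtain \<psi>' \<nu>' \<theta> where nu: "additive_functor M M \<nu>" and \<psi>': "adjunction M B U (\<nu> \<circ>\<^sub>F F) \<psi>'"
    and \<theta>: "adjunction M M \<nu> \<nu>' \<theta>" and iso: "\<And>x. x \<in> Obj B \<Longrightarrow> is_iso M (adj_unit M \<nu> \<theta> (fobj F x))"
    using assms unfolding nakayama_functor_def by blast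
  show ?thesis
  proof (rule ambidextrous_if_fully_faithful_on_free[OF nu \<psi>'])
    fix x y assume "x \<in> Obj B" "y \<in> Obj B"
    then show "bij_betw (farr \<nu>) (Hom M (fobj F x) (fobj F y)) (Hom M (fobj \<nu> (fobj F x)) (fobj \<nu> (fobj F y)))"
      by (intro adjunction.fully_faithful_if_unit_iso[OF \<theta>] iso) simp_all
  qed
qed

end


section \<open>The Eilenberg-Moore category is abelian\<close>

context preadditive_category
begin

lemma is_mono_if_kernel_zero:
  assumes "is_kernel C f k" "k = Zero C (Dom C k) (Cod C k)"
  shows "is_mono C f"
  unfolding is_mono_def
proof (intro conjI allI impI)
  note k = is_kernelD[OF assms(1)]
  show "f \<in> Arr C" by (rule k(1))
  fix x a b assume "a \<in> Hom C x (Dom C f) \<and> b \<in> Hom C x (Dom C f) \<and> f \<cdot> a = f \<cdot> b"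
  then have ab: "a \<in> Hom C x (Dom C f)" "b \<in> Hom C x (Dom C f)" "f \<cdot> a = f \<cdot> b" by auto
  obtain d where d: "d \<in> Hom C x (Dom C f)"
    "\<And>z h. h \<in> Hom C (Dom C f) z \<Longrightarrow> h \<cdot> d = Zero C x z \<longleftrightarrow> h \<cdot> a = h \<cdot> b"
    using ex_difference[OF ab(1,2)] by metis
  have "f \<cdot> d = Zero C x (Cod C f)" using d(2)[of f] ab(3) k(1) by (simp add: Hom_iff)
  then obtain u where u: "u \<in> Hom C x (Dom C k)" "k \<cdot> u = d"
    using k(5)[of d] d(1) by (auto simp: Hom_iff)
  have "Zero C (Dom C k) (Cod C k) \<cdot> u = Zero C x (Dom C f)"
    using u(1) k(1-3) by (auto simp: Hom_iff)
  then have "d = Zero C x (Dom C f)" using assms(2) u(2) by simp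
  then have "Ident C (Dom C f) \<cdot> d = Zero C x (Dom C f)" using d(1) by (simp add: Hom_iff)
  then have "Ident C (Dom C f) \<cdot> a = Ident C (Dom C f) \<cdot> b"
    using d(2)[of "Ident C (Dom C f)" "Dom C f"] k(1) by (simp add: Hom_iff)
  then show "a = b" using ab by (simp add: Hom_iff)
qed

lemma is_epi_if_cokernel_zero:
  assumes "is_cokernel C f c" "c = Zero C (Dom C c) (Cod C c)"
  shows "is_epi C f"
  unfolding is_epi_def
proof (intro conjI allI impI)
  note c = is_cokernelD[OF assms(1)]
  show "f \<in> Arr C" by (rule c(1))
  fix x a b assume "a \<in> Hom C (Cod C f) x \<and> b \<in> Hom C (Cod C f) x \<and> a \<cdot> f = b \<cdot> f"
  then have ab: "a \<in> Hom C (Cod C f) x" "b \<in> Hom C (Cod C f) x" "a \<cdot> f = b \<cdot> f" by auto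
  obtain d where d: "d \<in> Hom C (Cod C f) x"
    "\<And>z h. h \<in> Hom C z (Cod C f) \<Longrightarrow> d \<cdot> h = Zero C z x \<longleftrightarrow> a \<cdot> h = b \<cdot> h"
    using ex_difference[OF ab(1,2)] by metis
  have "d \<cdot> f = Zero C (Dom C f) x" using d(2)[of f] ab(3) c(1) by (simp add: Hom_iff)
  then obtain u where u: "u \<in> Hom C (Cod C c) x" "u \<cdot> c = d"
    using c(5)[of d] d(1) by (auto simp: Hom_iff)
  have "u \<cdot> Zero C (Dom C c) (Cod C c) = Zero C (Cod C f) x"
    using u(1) c(1-3) by (auto simp: Hom_iff)
  then have "d = Zero C (Cod C f) x" using assms(2) u(2) by simp
  then have "d \<cdot> Ident C (Cod C f) = Zero C (Cod C f) x" using d(1) by (simp add: Hom_iff)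
  then have "a \<cdot> Ident C (Cod C f) = b \<cdot> Ident C (Cod C f)"
    using d(2)[of "Ident C (Cod C f)" "Cod C f"] c(1) by (simp add: Hom_iff)
  then show "a = b" using ab by (simp add: Hom_iff)
qed

lemma kernel_of_mono_zero:
  assumes "is_mono C f" "is_kernel C f k"
  shows "k = Zero C (Dom C k) (Cod C k)"
proof -
  note k = is_kernelD[OF assms(2)]
  have "f \<cdot> k = f \<cdot> Zero C (Dom C k) (Cod C k)" using k(1-4) by simp
  moreover have "k \<in> Hom C (Dom C k) (Dom C f)" "Zero C (Dom C k) (Cod C k) \<in> Hom C (Dom C k) (Dom C f)"
    using k(1-3) by (simp_all add: Hom_iff)
  ultimately show ?thesis using assms(1) unfolding is_mono_def by blast
qed

lemma cokernel_of_epi_zero: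
  assumes "is_epi C f" "is_cokernel C f c"
  shows "c = Zero C (Dom C c) (Cod C c)"
proof -
  note c = is_cokernelD[OF assms(2)]
  have "c \<cdot> f = Zero C (Dom C c) (Cod C c) \<cdot> f" using c(1-4) by simp
  moreover have "c \<in> Hom C (Cod C f) (Cod C c)" "Zero C (Dom C c) (Cod C c) \<in> Hom C (Cod C f) (Cod C c)"
    using c(1-3) by (simp_all add: Hom_iff)
  ultimately show ?thesis using assms(1) unfolding is_epi_def by blast
qed

end

context monad
begin

lemma em_kernel_reflect:
  assumes f: "f \<in> Arr M" and k: "k \<in> Arr M" "Cod M k = Dom M f" and ker: "is_kernel B (farr U f) (farr U k)"
  shows "is_kernel M f k"
  unfolding is_kernel_def
proof (intro conjI allI ballI impI)
  note ker' = is_kernelD[OF ker]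
  show "f \<cdot>\<^bsub>M\<^esub> k = Zero M (Dom M k) (Cod M f)" using f k ker'(4) by (intro em_eqI) simp_all
  fix x g assume g: "g \<in> Hom M x (Dom M f)" and z: "f \<cdot>\<^bsub>M\<^esub> g = Zero M x (Cod M f)"
  have x: "x \<in> Obj M" using g by (auto simp: Hom_iff)
  have "farr U f \<bullet> farr U g = Zero B (fst x) (fst (Cod M f))"
    using arg_cong[OF z, of "farr U"] by simp
  then obtain u where u: "u \<in> Hom B (fst x) (fst (Dom M k))" "farr U k \<bullet> u = farr U g"
    using ker'(5)[of "farr U g"] f k g by (auto simp: Hom_iff)
  have "u \<bullet> snd x = snd (Dom M k) \<bullet> farr T u"
  proof (rule T.C.kernel_cancel[OF ker])
    have "farr U k \<bullet> (u \<bullet> snd x) = farr U g \<bullet> snd x"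
      using u g k x T.C.comp_extend[OF u(2), of "snd x"] by (simp add: Hom_iff)
    also have "\<dots> = snd (Dom M f) \<bullet> farr T (farr U k \<bullet> u)" using em_linear[of g x] g u(2) by (simp add: Hom_iff)
    also have "\<dots> = farr U k \<bullet> (snd (Dom M k) \<bullet> farr T u)"
      using u(1) k em_linear[of k "Dom M k" "Dom M f"] M.arr_objs[of k]
        T.C.comp_extend[OF em_linear[of k "Dom M k" "Dom M f"], of "farr T u"] by (simp add: Hom_iff)
    finally show "farr U k \<bullet> (u \<bullet> snd x) = farr U k \<bullet> (snd (Dom M k) \<bullet> farr T u)" .
  qed (use u(1) k x in \<open>simp_all add: Hom_iff\<close>)
  then have uM: "(x, u, Dom M k) \<in> Arr M" using u(1) x k by (simp add: em_arr_iff Hom_iff)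
  show "\<exists>!u. u \<in> Hom M x (Dom M k) \<and> k \<cdot>\<^bsub>M\<^esub> u = g"
  proof (rule ex_ex1I)
    have "k \<cdot>\<^bsub>M\<^esub> (x, u, Dom M k) = g"
      using uM k g u(2) by (intro em_eqI) (simp_all add: Hom_iff)
    then show "\<exists>u. u \<in> Hom M x (Dom M k) \<and> k \<cdot>\<^bsub>M\<^esub> u = g"
      using uM by (intro exI[of _ "(x, u, Dom M k)"]) (simp add: Hom_iff)
  next
    fix v w assume v: "v \<in> Hom M x (Dom M k) \<and> k \<cdot>\<^bsub>M\<^esub> v = g" and w: "w \<in> Hom M x (Dom M k) \<and> k \<cdot>\<^bsub>M\<^esub> w = g"
    have "farr U k \<bullet> farr U v = farr U k \<bullet> farr U w" using v w by (simp flip: em_forget_comp)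
    then have "farr U v = farr U w"
      by (rule T.C.kernel_cancel[OF ker, rotated -1]) (use v w k in \<open>simp_all add: Hom_iff\<close>)
    then show "v = w" using v w by (intro em_eqI) (simp_all add: Hom_iff)
  qed
qed (use f k in auto)

text \<open>The structure morphism of \<open>Dom f\<close> restricts to the kernel of \<open>U f\<close> because \<open>f\<close> is linear,
  and the module axioms of the restriction can be tested after composing with the monomorphism
  \<open>k\<close>.\<close>

lemma em_kernel_lift:
  assumes f: "f \<in> Arr M" and ker: "is_kernel B (farr U f) k"
  obtains k' where "k' \<in> Arr M" "Cod M k' = Dom M f" "farr U k' = k" "is_kernel M f k'"
proof -
  note k = is_kernelD[OF ker]
  define m where "m = Dom M f"
  have m: "m \<in> Obj M" "fst m \<in> Obj B" using f by (simp_all add: m_def)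
  have kd [simp]: "k \<in> Arr B" "Cod B k = fst m" using k f by (simp_all add: m_def)
  have "farr U f \<bullet> (snd m \<bullet> farr T k) = snd (Cod M f) \<bullet> farr T (farr U f \<bullet> k)"
    using f m em_linear[of f m "Cod M f"] T.C.comp_extend[OF em_linear[of f m "Cod M f"], of "farr T k"]
    by (simp add: m_def)
  also have "\<dots> = Zero B (fobj T (Dom B k)) (fst (Cod M f))" using k(4) f by simp
  finally obtain r where r: "r \<in> Hom B (fobj T (Dom B k)) (Dom B k)" "k \<bullet> r = snd m \<bullet> farr T k"
    using k(5)[of "snd m \<bullet> farr T k"] f m by (auto simp: Hom_iff m_def)
  have r' [simp]: "r \<in> Arr B" "Dom B r = fobj T (Dom B k)" "Cod B r = Dom B k"
    using r(1) by (auto simp: Hom_iff)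
  have kr: "k \<bullet> (r \<bullet> z) = snd m \<bullet> (farr T k \<bullet> z)" if z: "z \<in> Arr B" "Cod B z = fobj T (Dom B k)" for z
  proof -
    have "k \<bullet> (r \<bullet> z) = (snd m \<bullet> farr T k) \<bullet> z"
      by (rule T.C.comp_extend[OF r(2)]) (use z in simp_all)
    then show ?thesis using m z by simp
  qed
  note cancel = T.C.kernel_cancel[OF ker]
  have "r \<bullet> \<eta> (Dom B k) = Ident B (Dom B k)"
  proof (rule cancel)
    have "k \<bullet> (r \<bullet> \<eta> (Dom B k)) = snd m \<bullet> (farr T k \<bullet> \<eta> (Dom B k))"
      by (rule kr) simp_all
    also have "\<dots> = snd m \<bullet> (\<eta> (fst m) \<bullet> k)"
      using \<eta>.naturality[of k "Dom B k" "fst m"] by simp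
    also have "\<dots> = k \<bullet> Ident B (Dom B k)"
      using m T.C.comp_extend[OF em_obj(5)[OF m(1)], of k] by simp
    finally show "k \<bullet> (r \<bullet> \<eta> (Dom B k)) = k \<bullet> Ident B (Dom B k)" .
  qed simp_all
  moreover have "r \<bullet> \<mu> (Dom B k) = r \<bullet> farr T r"
  proof (rule cancel)
    have "k \<bullet> (r \<bullet> \<mu> (Dom B k)) = snd m \<bullet> (farr T k \<bullet> \<mu> (Dom B k))"
      by (rule kr) simp_all
    also have "\<dots> = snd m \<bullet> (farr T (snd m) \<bullet> farr T (farr T k))"
      using m \<mu>.naturality[of k "Dom B k" "fst m", symmetric]
        T.C.comp_extend[OF em_obj_assoc[OF m(1)], of "farr T (farr T k)"] by simp
    also have "\<dots> = snd m \<bullet> farr T (k \<bullet> r)" using m r(2) by simp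
    also have "\<dots> = k \<bullet> (r \<bullet> farr T r)"
      using kr[of "farr T r"] by simp
    finally show "k \<bullet> (r \<bullet> \<mu> (Dom B k)) = k \<bullet> (r \<bullet> farr T r)" .
  qed simp_all
  ultimately have "(Dom B k, r) \<in> Obj M" by (simp add: em_obj_iff)
  then have "((Dom B k, r), k, m) \<in> Arr M" using m r(2) by (simp add: em_arr_iff)
  moreover from this have "is_kernel M f ((Dom B k, r), k, m)"
    by (intro em_kernel_reflect f) (simp_all add: m_def ker)
  ultimately show ?thesis using that[of "((Dom B k, r), k, m)"] by (simp add: m_def)
qed

text \<open>Linearity of an induced arrow is an equation between arrows out of \<open>T (Cod c)\<close>; it is tested
  on \<open>T c\<close>, which is epimorphic by the last hypothesis.\<close>

lemma em_cokernel_reflect: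
  assumes f: "f \<in> Arr M" and c: "c \<in> Arr M" "Dom M c = Cod M f" and coker: "is_cokernel B (farr U f) (farr U c)"
    and Tcoker: "is_cokernel B (farr T (farr U f)) (farr T (farr U c))"
  shows "is_cokernel M f c"
  unfolding is_cokernel_def
proof (intro conjI allI ballI impI)
  note coker' = is_cokernelD[OF coker]
  show "c \<cdot>\<^bsub>M\<^esub> f = Zero M (Dom M f) (Cod M c)" using f c coker'(4) by (intro em_eqI) simp_all
  fix y g assume g: "g \<in> Hom M (Cod M f) y" and z: "g \<cdot>\<^bsub>M\<^esub> f = Zero M (Dom M f) y"
  have y: "y \<in> Obj M" using g by (auto simp: Hom_iff)
  have "farr U g \<bullet> farr U f = Zero B (fst (Dom M f)) (fst y)"
    using arg_cong[OF z, of "farr U"] by simp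
  then obtain u where u: "u \<in> Hom B (fst (Cod M c)) (fst y)" "u \<bullet> farr U c = farr U g"
    using coker'(5)[of "farr U g"] f c g by (auto simp: Hom_iff)
  have "u \<bullet> snd (Cod M c) = snd y \<bullet> farr T u"
  proof (rule T.C.cokernel_cancel[OF Tcoker])
    have "(u \<bullet> snd (Cod M c)) \<bullet> farr T (farr U c) = (u \<bullet> farr U c) \<bullet> snd (Cod M f)"
      using u(1) c em_linear[of c "Cod M f" "Cod M c"] M.arr_objs[of c] M.arr_objs[of f] f by (simp add: Hom_iff)
    also have "\<dots> = (snd y \<bullet> farr T u) \<bullet> farr T (farr U c)"
      using em_linear[of g "Cod M f" y] g u(1) c y T.farr_comp_simp[of "farr U c" u] by (simp add: u(2) Hom_iff)
    finally show "(u \<bullet> snd (Cod M c)) \<bullet> farr T (farr U c) = (snd y \<bullet> farr T u) \<bullet> farr T (farr U c)" .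
  qed (use u(1) c y in \<open>simp_all add: Hom_iff\<close>)
  then have uM: "(Cod M c, u, y) \<in> Arr M" using u(1) y c by (simp add: em_arr_iff Hom_iff)
  show "\<exists>!u. u \<in> Hom M (Cod M c) y \<and> u \<cdot>\<^bsub>M\<^esub> c = g"
  proof (rule ex_ex1I)
    have "(Cod M c, u, y) \<cdot>\<^bsub>M\<^esub> c = g"
      using uM c g u(2) by (intro em_eqI) (simp_all add: Hom_iff)
    then show "\<exists>u. u \<in> Hom M (Cod M c) y \<and> u \<cdot>\<^bsub>M\<^esub> c = g"
      using uM by (intro exI[of _ "(Cod M c, u, y)"]) (simp add: Hom_iff)
  next
    fix v w assume v: "v \<in> Hom M (Cod M c) y \<and> v \<cdot>\<^bsub>M\<^esub> c = g" and w: "w \<in> Hom M (Cod M c) y \<and> w \<cdot>\<^bsub>M\<^esub> c = g"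
    have "farr U v \<bullet> farr U c = farr U w \<bullet> farr U c" using v w by (simp flip: em_forget_comp)
    then have "farr U v = farr U w"
      by (rule T.C.cokernel_cancel[OF coker, rotated -1]) (use v w c in \<open>simp_all add: Hom_iff\<close>)
    then show "v = w" using v w by (intro em_eqI) (simp_all add: Hom_iff)
  qed
qed (use f c in auto)

text \<open>The structure morphism \<open>r\<close> of the quotient is induced from \<open>T c\<close>, which therefore has to be
  a cokernel itself; associativity of \<open>r\<close> is an equation between arrows out of \<open>T (T (Cod c))\<close>, which
  can be tested on \<open>T (T c)\<close>.\<close>

lemma em_cokernel_lift:
  assumes f: "f \<in> Arr M" and coker: "is_cokernel B (farr U f) c"
    and Tcoker: "is_cokernel B (farr T (farr U f)) (farr T c)"
    and TTcoker: "is_cokernel B (farr T (farr T (farr U f))) (farr T (farr T c))"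
  obtains c' where "c' \<in> Arr M" "Dom M c' = Cod M f" "farr U c' = c" "is_cokernel M f c'"
proof -
  note c = is_cokernelD[OF coker] and Tc = is_cokernelD[OF Tcoker]
  define m where "m = Cod M f"
  have m: "m \<in> Obj M" "fst m \<in> Obj B" using f by (simp_all add: m_def)
  have cd [simp]: "c \<in> Arr B" "Dom B c = fst m" using c f by (simp_all add: m_def)
  have "(c \<bullet> snd m) \<bullet> farr T (farr U f) = (c \<bullet> farr U f) \<bullet> snd (Dom M f)"
    using f m em_linear[of f "Dom M f" m] by (simp add: m_def)
  also have "\<dots> = Zero B (fobj T (fst (Dom M f))) (Cod B c)" using c(4) f by simp
  finally obtain r where r: "r \<in> Hom B (fobj T (Cod B c)) (Cod B c)" "r \<bullet> farr T c = c \<bullet> snd m"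
    using Tc(5)[of "c \<bullet> snd m"] f m by (auto simp: Hom_iff m_def)
  have r' [simp]: "r \<in> Arr B" "Dom B r = fobj T (Cod B c)" "Cod B r = Cod B c"
    using r(1) by (auto simp: Hom_iff)
  have "r \<bullet> \<eta> (Cod B c) = Ident B (Cod B c)"
    by (rule T.C.cokernel_cancel[OF coker])
      (use m \<eta>.naturality[of c "fst m" "Cod B c"] T.C.comp_extend[OF r(2), of "\<eta> (fst m)"] in simp_all)
  moreover have "r \<bullet> \<mu> (Cod B c) = r \<bullet> farr T r"
  proof (rule T.C.cokernel_cancel[OF TTcoker])
    have "(r \<bullet> \<mu> (Cod B c)) \<bullet> farr T (farr T c) = c \<bullet> (snd m \<bullet> \<mu> (fst m))"
      using m \<mu>.naturality[of c "fst m" "Cod B c"] T.C.comp_extend[OF r(2), of "\<mu> (fst m)"] by simp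
    also have "\<dots> = r \<bullet> farr T (c \<bullet> snd m)"
      using m em_obj_assoc[OF m(1)] T.C.comp_extend[OF r(2), of "farr T (snd m)"] by simp
    also have "\<dots> = (r \<bullet> farr T r) \<bullet> farr T (farr T c)" by (simp flip: r(2))
    finally show "(r \<bullet> \<mu> (Cod B c)) \<bullet> farr T (farr T c) = (r \<bullet> farr T r) \<bullet> farr T (farr T c)" .
  qed simp_all
  ultimately have "(Cod B c, r) \<in> Obj M" by (simp add: em_obj_iff)
  then have "(m, c, (Cod B c, r)) \<in> Arr M" using m r(2) by (simp add: em_arr_iff)
  moreover from this have "is_cokernel M f (m, c, (Cod B c, r))"
    by (intro em_cokernel_reflect f) (simp_all add: m_def coker Tcoker)
  ultimately show ?thesis using that[of "(m, c, (Cod B c, r))"] by (simp add: m_def)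
qed

text \<open>The unit law holds for the zero structure morphism because the identity of \<open>z\<close> is zero.\<close>

lemma em_zero_object:
  assumes "zero_object B z"
  shows "zero_object M (z, Zero B (fobj T z) z)"
proof -
  have z: "z \<in> Obj B" using assms by (simp add: zero_object_def)
  have from_z: "f = Zero B z x" "g = Zero B x z" if "f \<in> Hom B z x" "g \<in> Hom B x z" "x \<in> Obj B" for f g x
  proof -
    have "Zero B z x \<in> Hom B z x" "Zero B x z \<in> Hom B x z" using z that by (auto simp: Hom_iff)
    then show "f = Zero B z x" "g = Zero B x z" using assms that unfolding zero_object_def by blast+
  qed
  have endo: "Ident B z = Zero B z z" using from_z(1)[of "Ident B z" z "Ident B z"] z by (simp add: Hom_iff)
  have zM: "(z, Zero B (fobj T z) z) \<in> Obj M" using z endo by (simp add: em_obj_iff)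
  show ?thesis
    unfolding zero_object_def
  proof (intro conjI ballI zM)
    fix m assume m: "m \<in> Obj M"
    let ?z = "(z, Zero B (fobj T z) z)"
    have "Zero M ?z m \<in> Hom M ?z m" "Zero M m ?z \<in> Hom M m ?z" using zM m by (simp_all add: Hom_iff)
    moreover have "h = Zero M ?z m" if "h \<in> Hom M ?z m" for h
      using that m z from_z(1)[of "farr U h" "fst m" "Zero B (fst m) z"]
      by (intro em_eqI) (simp_all add: Hom_iff zM)
    moreover have "h = Zero M m ?z" if "h \<in> Hom M m ?z" for h
      using that m z from_z(2)[of "Zero B z (fst m)" "fst m" "farr U h"]
      by (intro em_eqI) (simp_all add: Hom_iff zM)
    ultimately show "\<exists>!f. f \<in> Hom M ?z m" "\<exists>!f. f \<in> Hom M m ?z" by blast+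
  qed
qed

text \<open>A biproduct \<open>p\<close> of the underlying objects carries the structure morphism with the components
  \<open>s \<bullet> T p\<^sub>1\<close> and \<open>t \<bullet> T p\<^sub>2\<close>; all required equations can be checked after composing with
  both projections.\<close>

lemma em_biproduct:
  assumes m: "m \<in> Obj M" and n: "n \<in> Obj M" and bi: "biproduct B (fst m) (fst n) p i1 i2 p1 p2"
  defines "r \<equiv> Add B (i1 \<bullet> (snd m \<bullet> farr T p1)) (i2 \<bullet> (snd n \<bullet> farr T p2))"
  shows "biproduct M m n (p, r) (m, i1, (p, r)) (n, i2, (p, r)) ((p, r), p1, m) ((p, r), p2, n)"
proof -
  have p [simp]: "p \<in> Obj B" "i1 \<in> Arr B" "Dom B i1 = fst m" "Cod B i1 = p" "i2 \<in> Arr B" "Dom B i2 = fst n" "Cod B i2 = p"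
    "p1 \<in> Arr B" "Dom B p1 = p" "Cod B p1 = fst m" "p2 \<in> Arr B" "Dom B p2 = p" "Cod B p2 = fst n"
    and eqs: "p1 \<bullet> i1 = Ident B (fst m)" "p2 \<bullet> i2 = Ident B (fst n)"
    "p2 \<bullet> i1 = Zero B (fst m) (fst n)" "p1 \<bullet> i2 = Zero B (fst n) (fst m)"
    "Add B (i1 \<bullet> p1) (i2 \<bullet> p2) = Ident B p"
    using bi by (auto simp: biproduct_def Hom_iff)
  note mn [simp] = m n em_obj(1-4)[OF m] em_obj(1-4)[OF n]
  have r [simp]: "r \<in> Arr B" "Dom B r = fobj T p" "Cod B r = p"
    by (simp_all add: r_def)
  have ext: "p1 \<bullet> (i1 \<bullet> z) = z" "p2 \<bullet> (i1 \<bullet> z) = Zero B (Dom B z) (fst n)"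
    if "z \<in> Arr B" "Cod B z = fst m" for z
    using that T.C.comp_extend[OF eqs(1), of z] T.C.comp_extend[OF eqs(3), of z] by simp_all
  have ext': "p2 \<bullet> (i2 \<bullet> z) = z" "p1 \<bullet> (i2 \<bullet> z) = Zero B (Dom B z) (fst m)"
    if "z \<in> Arr B" "Cod B z = fst n" for z
    using that T.C.comp_extend[OF eqs(2), of z] T.C.comp_extend[OF eqs(4), of z] by simp_all
  have p1r: "p1 \<bullet> r = snd m \<bullet> farr T p1" and p2r: "p2 \<bullet> r = snd n \<bullet> farr T p2"
    by (simp_all add: r_def ext ext')
  have p1r': "p1 \<bullet> (r \<bullet> z) = snd m \<bullet> (farr T p1 \<bullet> z)" and p2r': "p2 \<bullet> (r \<bullet> z) = snd n \<bullet> (farr T p2 \<bullet> z)"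
    if "z \<in> Arr B" "Cod B z = fobj T p" for z
    using that T.C.comp_extend[OF p1r, of z] T.C.comp_extend[OF p2r, of z] by simp_all
  have joint: "a = b" if "a \<in> Arr B" "b \<in> Arr B" "Dom B a = Dom B b" "Cod B a = p" "Cod B b = p"
    "p1 \<bullet> a = p1 \<bullet> b" "p2 \<bullet> a = p2 \<bullet> b" for a b
  proof -
    have "Add B (i1 \<bullet> p1) (i2 \<bullet> p2) \<bullet> a = Add B (i1 \<bullet> p1) (i2 \<bullet> p2) \<bullet> b"
      using that by simp
    then show ?thesis using that by (simp add: eqs(5))
  qed
  have "r \<bullet> \<eta> p = Ident B p"
  proof (rule joint)
    show "p1 \<bullet> (r \<bullet> \<eta> p) = p1 \<bullet> Ident B p"
      using \<eta>.naturality[of p1 p "fst m"] T.C.comp_extend[OF em_obj(5)[OF m], of p1] by (simp add: p1r')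
    show "p2 \<bullet> (r \<bullet> \<eta> p) = p2 \<bullet> Ident B p"
      using \<eta>.naturality[of p2 p "fst n"] T.C.comp_extend[OF em_obj(5)[OF n], of p2] by (simp add: p2r')
  qed simp_all
  moreover have "r \<bullet> \<mu> p = r \<bullet> farr T r"
  proof (rule joint)
    show "p1 \<bullet> (r \<bullet> \<mu> p) = p1 \<bullet> (r \<bullet> farr T r)"
      using \<mu>.naturality[of p1 p "fst m", symmetric] T.C.comp_extend[OF em_obj_assoc[OF m], of "farr T (farr T p1)"]
        arg_cong[OF p1r, of "farr T"] by (simp add: p1r')
    show "p2 \<bullet> (r \<bullet> \<mu> p) = p2 \<bullet> (r \<bullet> farr T r)"
      using \<mu>.naturality[of p2 p "fst n", symmetric] T.C.comp_extend[OF em_obj_assoc[OF n], of "farr T (farr T p2)"]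
        arg_cong[OF p2r, of "farr T"] by (simp add: p2r')
  qed simp_all
  ultimately have pr [simp]: "(p, r) \<in> Obj M" by (simp add: em_obj_iff)
  have TT: "farr T p1 \<bullet> farr T i1 = Ident B (fobj T (fst m))" "farr T p2 \<bullet> farr T i2 = Ident B (fobj T (fst n))"
    "farr T p2 \<bullet> farr T i1 = Zero B (fobj T (fst m)) (fobj T (fst n))"
    "farr T p1 \<bullet> farr T i2 = Zero B (fobj T (fst n)) (fobj T (fst m))"
    using eqs(1-4)[THEN arg_cong, of "farr T"] by simp_all
  have "i1 \<bullet> snd m = r \<bullet> farr T i1"
    by (rule joint) (simp_all add: ext p1r' p2r' TT)
  moreover have "i2 \<bullet> snd n = r \<bullet> farr T i2"
    by (rule joint) (simp_all add: ext' p1r' p2r' TT)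
  ultimately have arr: "(m, i1, (p, r)) \<in> Arr M" "(n, i2, (p, r)) \<in> Arr M"
    "((p, r), p1, m) \<in> Arr M" "((p, r), p2, n) \<in> Arr M"
    using p1r p2r by (simp_all add: em_arr_iff)
  show ?thesis
    unfolding biproduct_def
    using arr eqs by (simp add: Hom_iff em_comp_tuple em_add_tuple em_ident_tuple em_zero_tuple)
qed

text \<open>Kernels and cokernels are formed in \<open>B\<close>. In particular, a monomorphism of modules has zero
  kernel in \<open>B\<close> and hence is a monomorphism there; so it is the kernel in \<open>B\<close> of its cokernel, and
  thereby a kernel in \<open>M\<close>. The argument for epimorphisms is dual.\<close>

lemma em_abelian:
  assumes "abelian_category B" and "\<And>f c. is_cokernel B f c \<Longrightarrow> is_cokernel B (farr T f) (farr T c)"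
  shows "abelian_category M"
proof -
  interpret B: abelian_category B by fact
  have kernel: "\<exists>k. k \<in> Arr M \<and> Cod M k = Dom M f \<and> is_kernel B (farr U f) (farr U k) \<and> is_kernel M f k"
    if f: "f \<in> Arr M" for f
  proof -
    obtain k where "is_kernel B (farr U f) k" using B.ex_kernel f em_forget_arr(1) by blast
    then show ?thesis using em_kernel_lift[OF f] by metis
  qed
  have cokernel: "\<exists>c. c \<in> Arr M \<and> Dom M c = Cod M f \<and> is_cokernel B (farr U f) (farr U c) \<and> is_cokernel M f c"
    if f: "f \<in> Arr M" for f
  proof -
    obtain c where c: "is_cokernel B (farr U f) c" using B.ex_cokernel f em_forget_arr(1) by blast
    from em_cokernel_lift[OF f c assms(2)[OF c] assms(2)[OF assms(2)[OF c]]] c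
    show ?thesis by metis
  qed
  show ?thesis
  proof
    show "\<exists>z. zero_object M z" using B.ex_zero_object em_zero_object by blast
    show "\<exists>p i1 i2 p1 p2. biproduct M m n p i1 i2 p1 p2" if mn: "m \<in> Obj M" "n \<in> Obj M" for m n
    proof -
      obtain p i1 i2 p1 p2 where "biproduct B (fst m) (fst n) p i1 i2 p1 p2"
        using B.ex_biproduct[of "fst m" "fst n"] mn by auto
      then show ?thesis using em_biproduct[OF mn] by blast
    qed
    show "\<exists>k. is_kernel M f k" if "f \<in> Arr M" for f using kernel[OF that] by blast
    show "\<exists>c. is_cokernel M f c" if "f \<in> Arr M" for f using cokernel[OF that] by blast
    show "\<exists>f. is_kernel M f h" if h: "is_mono M h" for h
    proof -
      have hM: "h \<in> Arr M" using h by (simp add: is_mono_def)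
      obtain k where k: "k \<in> Arr M" "Cod M k = Dom M h" "is_kernel B (farr U h) (farr U k)" "is_kernel M h k"
        using kernel[OF hM] by blast
      obtain c where c: "c \<in> Arr M" "Dom M c = Cod M h" "is_cokernel B (farr U h) (farr U c)"
        using cokernel[OF hM] by blast
      have "farr U k = Zero B (fst (Dom M k)) (fst (Cod M k))"
        using arg_cong[OF M.kernel_of_mono_zero[OF h k(4)], of "farr U"] by simp
      then have "is_mono B (farr U h)"
        using T.C.is_mono_if_kernel_zero[OF k(3)] k(1) by simp
      then obtain f where "is_kernel B f (farr U h)" using B.mono_is_kernel by blast
      from T.C.mono_is_kernel_of_cokernel[OF this c(3)]
      have "is_kernel M c h" using em_kernel_reflect[OF c(1) hM] c(2) by simp
      then show ?thesis by blast
    qed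
    show "\<exists>f. is_cokernel M f h" if h: "is_epi M h" for h
    proof -
      have hM: "h \<in> Arr M" using h by (simp add: is_epi_def)
      obtain k where k: "k \<in> Arr M" "Cod M k = Dom M h" "is_kernel B (farr U h) (farr U k)"
        using kernel[OF hM] by blast
      obtain c where c: "c \<in> Arr M" "Dom M c = Cod M h" "is_cokernel B (farr U h) (farr U c)" "is_cokernel M h c"
        using cokernel[OF hM] by blast
      have "farr U c = Zero B (fst (Dom M c)) (fst (Cod M c))"
        using arg_cong[OF M.cokernel_of_epi_zero[OF h c(4)], of "farr U"] by simp
      then have "is_epi B (farr U h)"
        using T.C.is_epi_if_cokernel_zero[OF c(3)] c(1) by simp
      then obtain f where "is_cokernel B f (farr U h)" using B.epi_is_cokernel by blast
      from T.C.epi_is_cokernel_of_kernel[OF this k(3)]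
      have "is_cokernel M k h" using em_cokernel_reflect[OF k(1) hM] k(2) assms(2) by simp
      then show ?thesis by blast
    qed
  qed
qed

end


section \<open>From an ambidextrous adjunction to a Nakayama functor\<close>

lemma adjunction_if_couniversal:
  assumes L: "additive_functor A D L" and R: "additive_functor D A R"
    and e_arr: "\<And>d. d \<in> Obj D \<Longrightarrow> e d \<in> Hom D (fobj L (fobj R d)) d"
    and e_nat: "\<And>u d d'. u \<in> Hom D d d' \<Longrightarrow> e d' \<cdot>\<^bsub>D\<^esub> farr L (farr R u) = u \<cdot>\<^bsub>D\<^esub> e d"
    and univ: "\<And>a d f. \<lbrakk>a \<in> Obj A; f \<in> Hom D (fobj L a) d\<rbrakk> \<Longrightarrow>
      \<exists>!g. g \<in> Hom A a (fobj R d) \<and> e d \<cdot>\<^bsub>D\<^esub> farr L g = f"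
  shows "\<exists>\<psi>. adjunction A D L R \<psi>"
proof -
  interpret L: additive_functor A D L by (rule L)
  interpret R: additive_functor D A R by (rule R)
  define \<psi> where "\<psi> a d f = (THE g. g \<in> Hom A a (fobj R d) \<and> e d \<cdot>\<^bsub>D\<^esub> farr L g = f)" for a d f
  have e [simp]: "e d \<in> Arr D" "Dom D (e d) = fobj L (fobj R d)" "Cod D (e d) = d" if "d \<in> Obj D" for d
    using e_arr[OF that] by (simp_all add: Hom_iff)
  have \<psi>: "\<psi> a d f \<in> Hom A a (fobj R d) \<and> e d \<cdot>\<^bsub>D\<^esub> farr L (\<psi> a d f) = f"
    if "a \<in> Obj A" "f \<in> Hom D (fobj L a) d" for a d f
    unfolding \<psi>_def by (rule theI') (rule univ[OF that])
  have unique: "\<psi> a d f = g" if "a \<in> Obj A" "f \<in> Hom D (fobj L a) d" "g \<in> Hom A a (fobj R d)"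
    "e d \<cdot>\<^bsub>D\<^esub> farr L g = f" for a d f g
    using univ[OF that(1,2)] \<psi>[OF that(1,2)] that(3,4) by blast
  have "adjunction A D L R \<psi>"
  proof
    fix a d assume a: "a \<in> Obj A" and d: "d \<in> Obj D"
    show "bij_betw (\<psi> a d) (Hom D (fobj L a) d) (Hom A a (fobj R d))"
    proof (rule bij_betwI')
      fix f f' assume "f \<in> Hom D (fobj L a) d" "f' \<in> Hom D (fobj L a) d"
      then show "\<psi> a d f = \<psi> a d f' \<longleftrightarrow> f = f'" using \<psi>[OF a] by metis
    next
      fix f assume "f \<in> Hom D (fobj L a) d"
      then show "\<psi> a d f \<in> Hom A a (fobj R d)" using \<psi>[OF a] by blast
    next
      fix g assume g: "g \<in> Hom A a (fobj R d)"
      then have h: "e d \<cdot>\<^bsub>D\<^esub> farr L g \<in> Hom D (fobj L a) d" using d by (simp add: Hom_iff)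
      then show "\<exists>f \<in> Hom D (fobj L a) d. g = \<psi> a d f"
        using unique[OF a h g refl] by (intro bexI[OF _ h]) simp
    qed
  next
    fix u a' a d f assume u: "u \<in> Hom A a' a" and d: "d \<in> Obj D" and f: "f \<in> Hom D (fobj L a) d"
    have a: "a \<in> Obj A" "a' \<in> Obj A" using u by (auto simp: Hom_iff)
    note p = \<psi>[OF a(1) f]
    have "e d \<cdot>\<^bsub>D\<^esub> farr L (\<psi> a d f \<cdot>\<^bsub>A\<^esub> u) = (e d \<cdot>\<^bsub>D\<^esub> farr L (\<psi> a d f)) \<cdot>\<^bsub>D\<^esub> farr L u"
      using conjunct1[OF p] u d by (simp add: Hom_iff)
    also have "\<dots> = f \<cdot>\<^bsub>D\<^esub> farr L u" using p by simp
    finally show "\<psi> a' d (f \<cdot>\<^bsub>D\<^esub> farr L u) = \<psi> a d f \<cdot>\<^bsub>A\<^esub> u"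
      by (intro unique) (use a p u f in \<open>simp_all add: Hom_iff\<close>)
  next
    fix a v d d' f assume a: "a \<in> Obj A" and v: "v \<in> Hom D d d'" and f: "f \<in> Hom D (fobj L a) d"
    have d: "d \<in> Obj D" "d' \<in> Obj D" using v by (auto simp: Hom_iff)
    note p = \<psi>[OF a f]
    have "e d' \<cdot>\<^bsub>D\<^esub> farr L (farr R v \<cdot>\<^bsub>A\<^esub> \<psi> a d f) = (e d' \<cdot>\<^bsub>D\<^esub> farr L (farr R v)) \<cdot>\<^bsub>D\<^esub> farr L (\<psi> a d f)"
      using conjunct1[OF p] v d by (simp add: Hom_iff)
    also have "\<dots> = v \<cdot>\<^bsub>D\<^esub> (e d \<cdot>\<^bsub>D\<^esub> farr L (\<psi> a d f))"
      unfolding e_nat[OF v] using conjunct1[OF p] v d(1) by (simp add: Hom_iff)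
    also have "\<dots> = v \<cdot>\<^bsub>D\<^esub> f" using p by simp
    finally show "\<psi> a d' (v \<cdot>\<^bsub>D\<^esub> f) = farr R v \<cdot>\<^bsub>A\<^esub> \<psi> a d f"
      by (intro unique) (use a p v f in \<open>simp_all add: Hom_iff\<close>)
  qed
  then show ?thesis by blast
qed

text \<open>The four equations are the conjugacy conditions, with the composite and identity adjunctions
  written out.\<close>

locale ambidextrous = monad B T \<eta> \<mu> + comonad B S \<epsilon> \<Delta>
  + \<phi>: adjunction B B S T \<phi> + \<psi>: adjunction B B T S \<psi>
  for B :: "('o, 'a) cat" and T S :: "('o, 'a, 'o, 'a) func" and \<eta> \<mu> \<epsilon> \<Delta> :: "'o \<Rightarrow> 'a"
    and \<phi> \<psi> :: "'o \<Rightarrow> 'o \<Rightarrow> 'a \<Rightarrow> 'a" +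
  assumes \<phi>_comult: "\<lbrakk>x \<in> Obj B; h \<in> Hom B (fobj S (fobj S x)) y\<rbrakk>
      \<Longrightarrow> \<phi> x y (h \<cdot>\<^bsub>B\<^esub> \<Delta> x) = \<mu> y \<cdot>\<^bsub>B\<^esub> \<phi> x (fobj T y) (\<phi> (fobj S x) y h)"
    and \<phi>_counit: "h \<in> Hom B x y \<Longrightarrow> \<phi> x y (h \<cdot>\<^bsub>B\<^esub> \<epsilon> x) = \<eta> y \<cdot>\<^bsub>B\<^esub> h"
    and \<psi>_mult: "\<lbrakk>x \<in> Obj B; h \<in> Hom B (fobj T x) y\<rbrakk>
      \<Longrightarrow> \<psi> x (fobj S y) (\<psi> (fobj T x) y (h \<cdot>\<^bsub>B\<^esub> \<mu> x)) = \<Delta> y \<cdot>\<^bsub>B\<^esub> \<psi> x y h"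
    and \<psi>_unit: "\<lbrakk>x \<in> Obj B; h \<in> Hom B (fobj T x) y\<rbrakk>
      \<Longrightarrow> h \<cdot>\<^bsub>B\<^esub> \<eta> x = \<epsilon> y \<cdot>\<^bsub>B\<^esub> \<psi> x y h"
begin

lemma em_comp:
  assumes "(l, f, m) \<in> Arr M" "(m, g, n) \<in> Arr M"
  shows "(l, g \<bullet> f, n) \<in> Arr M"
  using M.comp_arr(1)[of "(l, f, m)" "(m, g, n)"] assms by (simp add: em_comp_tuple)

subsection \<open>Modules as comodules\<close>

text \<open>As \<open>\<Delta>\<close> is conjugate to \<open>\<mu>\<close> and \<open>\<epsilon>\<close> to \<open>\<eta>\<close>, transposition along \<open>\<psi>\<close> turns the
  axioms of a module \<open>T x \<rightarrow> x\<close> into those of a comodule \<open>x \<rightarrow> S x\<close>, and linear arrows into comodule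
  morphisms.\<close>

definition coaction :: "'o \<times> 'a \<Rightarrow> 'a" where
  "coaction m = \<psi> (fst m) (fst m) (snd m)"

lemma coaction_arr [simp]:
  assumes "m \<in> Obj M"
  shows "coaction m \<in> Arr B" "Dom B (coaction m) = fst m" "Cod B (coaction m) = fobj S (fst m)"
  using assms by (simp_all add: coaction_def)

lemma \<psi>_act_act:
  assumes "x \<in> Obj B" "s \<in> Arr B" "Dom B s = fobj T x" "Cod B s = x"
  shows "\<psi> x (fobj S x) (\<psi> (fobj T x) x (s \<bullet> farr T s)) = farr S (\<psi> x x s) \<bullet> \<psi> x x s"
proof -
  have "\<psi> (fobj T x) x (s \<bullet> farr T s) = \<psi> x x s \<bullet> s"
    using \<psi>.tr_precomp[of s s x "fobj T x"] assms by simp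
  also have "\<psi> x (fobj S x) \<dots> = farr S (\<psi> x x s) \<bullet> \<psi> x x s"
    using \<psi>.tr_postcomp[of "\<psi> x x s" s x "fobj S x"] assms by simp
  finally show ?thesis .
qed

lemma coaction_counit: "m \<in> Obj M \<Longrightarrow> \<epsilon> (fst m) \<bullet> coaction m = Ident B (fst m)"
  using \<psi>_unit[of "fst m" "snd m" "fst m"] by (simp add: coaction_def Hom_iff)

lemma coaction_coassoc:
  assumes "m \<in> Obj M"
  shows "\<Delta> (fst m) \<bullet> coaction m = farr S (coaction m) \<bullet> coaction m"
  using \<psi>_mult[of "fst m" "snd m" "fst m"] \<psi>_act_act[of "fst m" "snd m"] em_obj_assoc[OF assms] assms
  by (simp add: coaction_def Hom_iff)

lemma em_obj_if_comodule:
  assumes s: "s \<in> Arr B" "Dom B s = fobj T x" "Cod B s = x" "x \<in> Obj B"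
    and counit: "\<epsilon> x \<bullet> \<psi> x x s = Ident B x"
    and coassoc: "\<Delta> x \<bullet> \<psi> x x s = farr S (\<psi> x x s) \<bullet> \<psi> x x s"
  shows "(x, s) \<in> Obj M"
proof -
  have "s \<bullet> \<eta> x = Ident B x"
    using \<psi>_unit[of x s x] counit s by (simp add: Hom_iff)
  moreover have "s \<bullet> \<mu> x = s \<bullet> farr T s"
  proof (rule \<psi>.tr_inj)
    show "\<psi> (fobj T x) x (s \<bullet> \<mu> x) = \<psi> (fobj T x) x (s \<bullet> farr T s)"
    proof (rule \<psi>.tr_inj)
      show "\<psi> x (fobj S x) (\<psi> (fobj T x) x (s \<bullet> \<mu> x)) = \<psi> x (fobj S x) (\<psi> (fobj T x) x (s \<bullet> farr T s))"
        using \<psi>_mult[of x s x] \<psi>_act_act[of x s] coassoc s by (simp add: Hom_iff)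
    qed (use s in simp_all)
  qed (use s in simp_all)
  ultimately show ?thesis using s by (simp add: em_obj_iff)
qed

lemma em_arr_iff_comodule:
  assumes "m \<in> Obj M" "n \<in> Obj M" "f \<in> Arr B" "Dom B f = fst m" "Cod B f = fst n"
  shows "(m, f, n) \<in> Arr M \<longleftrightarrow> farr S f \<bullet> coaction m = coaction n \<bullet> f"
proof -
  have "\<psi> (fst m) (fst n) (f \<bullet> snd m) = farr S f \<bullet> coaction m"
    using \<psi>.tr_postcomp[of f "snd m" "fst m" "fst n"] assms by (simp add: coaction_def)
  moreover have "\<psi> (fst m) (fst n) (snd n \<bullet> farr T f) = coaction n \<bullet> f"
    using \<psi>.tr_precomp[of f "snd n" "fst n" "fst m"] assms by (simp add: coaction_def)
  moreover have "f \<bullet> snd m = snd n \<bullet> farr T f \<longleftrightarrow>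
      \<psi> (fst m) (fst n) (f \<bullet> snd m) = \<psi> (fst m) (fst n) (snd n \<bullet> farr T f)"
    using \<psi>.tr_inj[of "fst m" "fst n" "f \<bullet> snd m" "snd n \<bullet> farr T f"] assms by auto
  ultimately show ?thesis using assms by (simp add: em_arr_iff)
qed

text \<open>The module whose transpose is the comodule \<open>\<Delta> x\<close>.\<close>

definition cofree :: "'o \<Rightarrow> 'o \<times> 'a" where
  "cofree x = (fobj S x, \<psi>.untr (fobj S x) (fobj S x) (\<Delta> x))"

lemma cofree_fst [simp]: "fst (cofree x) = fobj S x"
  by (simp add: cofree_def)

lemma cofree_coaction [simp]: "x \<in> Obj B \<Longrightarrow> coaction (cofree x) = \<Delta> x"
  using \<psi>.untr(4)[of "\<Delta> x" "fobj S x" "fobj S x"] by (simp add: coaction_def cofree_def)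

lemma cofree_obj [simp]:
  assumes "x \<in> Obj B"
  shows "cofree x \<in> Obj M"
  unfolding cofree_def
  by (rule em_obj_if_comodule)
    (use assms \<psi>.untr[of "\<Delta> x" "fobj S x" "fobj S x"] comult_counit_left comult_coassoc in simp_all)

lemma cofree_arr:
  assumes "u \<in> Arr B" "Dom B u = x" "Cod B u = y"
  shows "(cofree x, farr S u, cofree y) \<in> Arr M"
proof -
  have "x \<in> Obj B" "y \<in> Obj B" using assms by auto
  then show ?thesis
    using em_arr_iff_comodule[of "cofree x" "cofree y" "farr S u"] assms \<Delta>.naturality[OF assms] by simp
qed

lemma cofree_extend:
  assumes m: "m \<in> Obj M" and f: "f \<in> Arr B" "Dom B f = fst m" "Cod B f = x"
  shows "(m, farr S f \<bullet> coaction m, cofree x) \<in> Arr M" "\<epsilon> x \<bullet> (farr S f \<bullet> coaction m) = f"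
proof -
  have x: "x \<in> Obj B" using f by auto
  have "farr S (farr S f \<bullet> coaction m) \<bullet> coaction m = farr S (farr S f) \<bullet> (\<Delta> (fst m) \<bullet> coaction m)"
    unfolding coaction_coassoc[OF m] using m f by simp
  also have "\<dots> = (farr S (farr S f) \<bullet> \<Delta> (fst m)) \<bullet> coaction m" using m f by simp
  also have "\<dots> = (\<Delta> x \<bullet> farr S f) \<bullet> coaction m" using \<Delta>.naturality[OF f] by simp
  also have "\<dots> = \<Delta> x \<bullet> (farr S f \<bullet> coaction m)" using m f x by simp
  finally show "(m, farr S f \<bullet> coaction m, cofree x) \<in> Arr M"
    using em_arr_iff_comodule[of m "cofree x" "farr S f \<bullet> coaction m"] m f x by simp
  have "\<epsilon> x \<bullet> (farr S f \<bullet> coaction m) = (\<epsilon> x \<bullet> farr S f) \<bullet> coaction m" using m f x by simp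
  also have "\<dots> = (f \<bullet> \<epsilon> (fst m)) \<bullet> coaction m" using \<epsilon>.naturality[OF f] by simp
  also have "\<dots> = f" using m f coaction_counit[OF m] by simp
  finally show "\<epsilon> x \<bullet> (farr S f \<bullet> coaction m) = f" .
qed

lemma cofree_extend_unique:
  assumes "(m, h, cofree x) \<in> Arr M" "x \<in> Obj B"
  shows "h = farr S (\<epsilon> x \<bullet> h) \<bullet> coaction m"
proof -
  have m: "m \<in> Obj M" and h: "h \<in> Arr B" "Dom B h = fst m" "Cod B h = fobj S x"
    using assms(1) by (auto simp: em_arr_iff)
  have "farr S (\<epsilon> x \<bullet> h) \<bullet> coaction m = farr S (\<epsilon> x) \<bullet> (farr S h \<bullet> coaction m)"
    using m h assms(2) by simp
  also have "\<dots> = farr S (\<epsilon> x) \<bullet> (\<Delta> x \<bullet> h)"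
    using em_arr_iff_comodule[of m "cofree x" h] assms m h by simp
  also have "\<dots> = (farr S (\<epsilon> x) \<bullet> \<Delta> x) \<bullet> h" using h assms(2) by simp
  also have "\<dots> = h" unfolding comult_counit_right[OF assms(2)] using h by simp
  finally show ?thesis by simp
qed

lemma cofree_eqI:
  assumes "(m, h, cofree x) \<in> Arr M" "(m, h', cofree x) \<in> Arr M" "x \<in> Obj B" "\<epsilon> x \<bullet> h = \<epsilon> x \<bullet> h'"
  shows "h = h'"
  using cofree_extend_unique[OF assms(1,3)] cofree_extend_unique[OF assms(2,3)] assms(4) by simp

subsection \<open>The right action of the monad on the comonad\<close>

text \<open>An action of \<open>T\<close> on \<open>S\<close> from the right, which \<open>\<phi>\<close> derives from \<open>\<mu>\<close>: by \<open>\<phi>_act\<close>,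
  composing \<open>f : S x \<rightarrow> y\<close> with it corresponds to extending the transpose \<open>x \<rightarrow> T y\<close> of \<open>f\<close> to a linear arrow
  \<open>T x \<rightarrow> T y\<close>. The formula is the comodule morphism into the cofree module that the counit
  \<open>S (T x) \<rightarrow> x\<close> determines.\<close>

definition act :: "'o \<Rightarrow> 'a" where
  "act x = farr S (\<phi>.counit x) \<bullet> \<Delta> (fobj T x)"

lemma act_arr [simp]:
  assumes "x \<in> Obj B"
  shows "act x \<in> Arr B" "Dom B (act x) = fobj S (fobj T x)" "Cod B (act x) = fobj S x"
  using assms by (simp_all add: act_def)

lemma act_em_arr: "x \<in> Obj B \<Longrightarrow> (cofree (fobj T x), act x, cofree x) \<in> Arr M"
  using cofree_extend(1)[of "cofree (fobj T x)" "\<phi>.counit x" x] by (simp add: act_def)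

lemma counit_act: "x \<in> Obj B \<Longrightarrow> \<epsilon> x \<bullet> act x = \<phi>.counit x"
  using cofree_extend(2)[of "cofree (fobj T x)" "\<phi>.counit x" x] by (simp add: act_def)

lemma act_unit:
  assumes x: "x \<in> Obj B"
  shows "act x \<bullet> farr S (\<eta> x) = Ident B (fobj S x)"
proof (rule cofree_eqI[of "cofree x" _ x])
  show "(cofree x, act x \<bullet> farr S (\<eta> x), cofree x) \<in> Arr M"
    using x by (intro em_comp[OF cofree_arr act_em_arr]) simp_all
  show "(cofree x, Ident B (fobj S x), cofree x) \<in> Arr M"
    using M.ident_arr(1)[OF cofree_obj[OF x]] by (simp add: em_ident_tuple)
  have "\<epsilon> x \<bullet> (act x \<bullet> farr S (\<eta> x)) = (\<epsilon> x \<bullet> act x) \<bullet> farr S (\<eta> x)" using x by simp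
  also have "\<dots> = \<epsilon> x"
  proof (rule \<phi>.tr_inj)
    show "\<phi> x x ((\<epsilon> x \<bullet> act x) \<bullet> farr S (\<eta> x)) = \<phi> x x (\<epsilon> x)"
      using \<phi>.tr_precomp[of "\<eta> x" "\<phi>.counit x" x x] \<phi>_counit[of "Ident B x" x x] x
      by (simp add: counit_act Hom_iff)
  qed (use x in simp_all)
  finally show "\<epsilon> x \<bullet> (act x \<bullet> farr S (\<eta> x)) = \<epsilon> x \<bullet> Ident B (fobj S x)" using x by simp
qed (rule x)

lemma act_natural:
  assumes u: "u \<in> Arr B" "Dom B u = x" "Cod B u = y"
  shows "act y \<bullet> farr S (farr T u) = farr S u \<bullet> act x"
proof (rule cofree_eqI[of "cofree (fobj T x)" _ y])
  have x: "x \<in> Obj B" and y: "y \<in> Obj B" using u by auto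
  show "(cofree (fobj T x), act y \<bullet> farr S (farr T u), cofree y) \<in> Arr M"
    using u y by (intro em_comp[OF cofree_arr act_em_arr]) simp_all
  show "(cofree (fobj T x), farr S u \<bullet> act x, cofree y) \<in> Arr M"
    using u x by (intro em_comp[OF act_em_arr cofree_arr]) simp_all
  have "\<epsilon> y \<bullet> (act y \<bullet> farr S (farr T u)) = (\<epsilon> y \<bullet> act y) \<bullet> farr S (farr T u)" using u y by simp
  also have "\<dots> = u \<bullet> (\<epsilon> x \<bullet> act x)"
    using \<phi>.counit_natural[OF u] x y by (simp add: counit_act)
  also have "\<dots> = (u \<bullet> \<epsilon> x) \<bullet> act x" using u x by simp
  also have "\<dots> = (\<epsilon> y \<bullet> farr S u) \<bullet> act x" using \<epsilon>.naturality[OF u] by simp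
  also have "\<dots> = \<epsilon> y \<bullet> (farr S u \<bullet> act x)" using u x y by simp
  finally show "\<epsilon> y \<bullet> (act y \<bullet> farr S (farr T u)) = \<epsilon> y \<bullet> (farr S u \<bullet> act x)" .
qed (use u in auto)

lemma \<phi>_act:
  assumes x: "x \<in> Obj B" and f: "f \<in> Arr B" "Dom B f = fobj S x" "Cod B f = y"
  shows "\<phi> (fobj T x) y (f \<bullet> act x) = \<mu> y \<bullet> farr T (\<phi> x y f)"
proof -
  have "\<phi> (fobj T x) y (f \<bullet> act x) = \<phi> (fobj T x) y ((f \<bullet> farr S (\<phi>.counit x)) \<bullet> \<Delta> (fobj T x))"
    using x f by (simp add: act_def)
  also have "\<dots> = \<mu> y \<bullet> \<phi> (fobj T x) (fobj T y) (\<phi> (fobj S (fobj T x)) y (f \<bullet> farr S (\<phi>.counit x)))"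
    by (rule \<phi>_comult) (use x f in \<open>simp_all add: Hom_iff\<close>)
  also have "\<phi> (fobj S (fobj T x)) y (f \<bullet> farr S (\<phi>.counit x)) = \<phi> x y f \<bullet> \<phi>.counit x"
    using \<phi>.tr_precomp[of "\<phi>.counit x" f y] x f by simp
  also have "\<phi> (fobj T x) (fobj T y) (\<phi> x y f \<bullet> \<phi>.counit x) = farr T (\<phi> x y f)"
    using \<phi>.tr_postcomp[of "\<phi> x y f" "\<phi>.counit x" "fobj T x" "fobj T y"] x f by simp
  finally show ?thesis .
qed

text \<open>The counterpart of \<open>\<phi>_act\<close> for the left action: extending \<open>f : S x \<rightarrow> y\<close> to a comodule
  morphism \<open>S x \<rightarrow> S y\<close> corresponds to composing its transpose with a module morphism
  \<open>F y \<rightarrow> F (S y)\<close> that does not depend on \<open>f\<close>.\<close>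

lemma \<phi>_coextend:
  assumes x: "x \<in> Obj B" and f: "f \<in> Arr B" "Dom B f = fobj S x" "Cod B f = y"
  shows "\<phi> x (fobj S y) (farr S f \<bullet> \<Delta> x) = \<mu> (fobj S y) \<bullet> farr T (\<phi>.unit y) \<bullet> \<phi> x y f"
proof -
  have y: "y \<in> Obj B" using f by auto
  have "\<phi> x (fobj S y) (farr S f \<bullet> \<Delta> x) = \<mu> (fobj S y) \<bullet> \<phi> x (fobj T (fobj S y)) (\<phi> (fobj S x) (fobj S y) (farr S f))"
    by (rule \<phi>_comult) (use x f in \<open>simp_all add: Hom_iff\<close>)
  also have "\<phi> (fobj S x) (fobj S y) (farr S f) = \<phi>.unit y \<bullet> f"
    using \<phi>.tr_farr[of f "fobj S x" y] f by simp
  also have "\<phi> x (fobj T (fobj S y)) (\<phi>.unit y \<bullet> f) = farr T (\<phi>.unit y) \<bullet> \<phi> x y f"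
    using \<phi>.tr_postcomp[of "\<phi>.unit y" f x "fobj T (fobj S y)"] x y f by simp
  finally show ?thesis using x y f by simp
qed

subsection \<open>The bimodule represented by the Nakayama functor\<close>

text \<open>These arrows correspond to the module morphisms from \<open>S \<otimes>\<^sub>T m\<close> to \<open>n\<close>. The definition
  states both conditions as linearity, of the arrow \<open>S x \<rightarrow> y\<close> and of its transpose \<open>x \<rightarrow> T y\<close>,
  which makes it symmetric. Each of the two conditions can be rewritten on the other side of the
  adjunction: the second as coequalizing two morphisms into \<open>S x\<close>, the first as equalizing two
  morphisms out of \<open>T y\<close>.\<close>

definition balanced :: "'o \<times> 'a \<Rightarrow> 'o \<times> 'a \<Rightarrow> 'a set" where
  "balanced m n = {f. m \<in> Obj M \<and> (cofree (fst m), f, n) \<in> Arr M \<and>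
     (m, \<phi> (fst m) (fst n) f, fobj F (fst n)) \<in> Arr M}"

lemma balanced_arr:
  assumes "f \<in> balanced m n"
  shows "m \<in> Obj M" "n \<in> Obj M" "f \<in> Arr B" "Dom B f = fobj S (fst m)" "Cod B f = fst n"
  using assms by (auto simp: balanced_def em_arr_iff)

lemma balanced_iff_coequalizes:
  assumes m: "m \<in> Obj M" and f: "(cofree (fst m), f, n) \<in> Arr M"
  shows "f \<in> balanced m n \<longleftrightarrow> f \<bullet> farr S (snd m) = f \<bullet> act (fst m)"
proof -
  have n: "n \<in> Obj M" and f': "f \<in> Arr B" "Dom B f = fobj S (fst m)" "Cod B f = fst n"
    using f by (auto simp: em_arr_iff)
  let ?g = "\<phi> (fst m) (fst n) f"
  have g: "?g \<in> Arr B" "Dom B ?g = fst m" "Cod B ?g = fobj T (fst n)" using m f' by simp_all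
  have 1: "\<phi> (fobj T (fst m)) (fst n) (f \<bullet> farr S (snd m)) = ?g \<bullet> snd m"
    using \<phi>.tr_precomp[of "snd m" f "fst n" "fobj T (fst m)"] m f' by simp
  have 2: "\<phi> (fobj T (fst m)) (fst n) (f \<bullet> act (fst m)) = \<mu> (fst n) \<bullet> farr T ?g"
    using \<phi>_act[of "fst m" f "fst n"] m f' by simp
  have "f \<bullet> farr S (snd m) = f \<bullet> act (fst m) \<longleftrightarrow>
      \<phi> (fobj T (fst m)) (fst n) (f \<bullet> farr S (snd m)) = \<phi> (fobj T (fst m)) (fst n) (f \<bullet> act (fst m))"
    using \<phi>.tr_inj[of "fobj T (fst m)" "fst n" "f \<bullet> farr S (snd m)" "f \<bullet> act (fst m)"] m f' by auto
  also have "\<dots> \<longleftrightarrow> (m, ?g, fobj F (fst n)) \<in> Arr M"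
    unfolding 1 2 using m n g by (simp add: em_arr_iff)
  finally show ?thesis using m f by (simp add: balanced_def)
qed

lemma balanced_iff_equalizes:
  assumes m: "m \<in> Obj M" and n: "n \<in> Obj M" and f: "f \<in> Arr B" "Dom B f = fobj S (fst m)" "Cod B f = fst n"
    and g: "(m, \<phi> (fst m) (fst n) f, fobj F (fst n)) \<in> Arr M"
  shows "f \<in> balanced m n \<longleftrightarrow> farr T (coaction n) \<bullet> \<phi> (fst m) (fst n) f =
    \<mu> (fobj S (fst n)) \<bullet> farr T (\<phi>.unit (fst n)) \<bullet> \<phi> (fst m) (fst n) f"
proof -
  let ?x = "fst m" and ?y = "fst n"
  have 1: "\<phi> ?x (fobj S ?y) (coaction n \<bullet> f) = farr T (coaction n) \<bullet> \<phi> ?x ?y f"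
    using \<phi>.tr_postcomp[of "coaction n" f ?x "fobj S ?y"] m n f by simp
  have 2: "\<phi> ?x (fobj S ?y) (farr S f \<bullet> \<Delta> ?x) = \<mu> (fobj S ?y) \<bullet> farr T (\<phi>.unit ?y) \<bullet> \<phi> ?x ?y f"
    using \<phi>_coextend[of ?x f ?y] m f by simp
  have "f \<in> balanced m n \<longleftrightarrow> farr S f \<bullet> \<Delta> ?x = coaction n \<bullet> f"
    using em_arr_iff_comodule[of "cofree ?x" n f] m n f g by (simp add: balanced_def)
  also have "\<dots> \<longleftrightarrow> \<phi> ?x (fobj S ?y) (coaction n \<bullet> f) = \<phi> ?x (fobj S ?y) (farr S f \<bullet> \<Delta> ?x)"
    using \<phi>.tr_inj[of ?x "fobj S ?y" "coaction n \<bullet> f" "farr S f \<bullet> \<Delta> ?x"] m n f by auto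
  finally show ?thesis unfolding 1 2 .
qed

end

sublocale ambidextrous \<subseteq> P: arrow_bimodule M M B "S \<circ>\<^sub>F U" U balanced
proof -
  interpret U: additive_functor M B U by (rule em_forgetful_functor)
  interpret SU: additive_functor M B "S \<circ>\<^sub>F U"
    by (rule additive_functor_comp[OF em_forgetful_functor S.additive_functor_axioms])
  show "arrow_bimodule M M B (S \<circ>\<^sub>F U) U balanced"
  proof unfold_locales
    fix f m n assume f: "f \<in> balanced m n"
    note f' = balanced_arr[OF f]
    show "m \<in> Obj M \<and> n \<in> Obj M \<and> f \<in> Hom B (fobj (S \<circ>\<^sub>F U) m) (fobj U n)"
      using f' by (simp add: Hom_iff)
    let ?g = "\<phi> (fst m) (fst n) f"
    have fM: "(cofree (fst m), f, n) \<in> Arr M" and gM: "(m, ?g, fobj F (fst n)) \<in> Arr M"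
      using f by (auto simp: balanced_def)
    show "f \<bullet> farr (S \<circ>\<^sub>F U) u \<in> balanced m' n" if u: "u \<in> Hom M m' m" for u m'
    proof -
      have u': "(m', farr U u, m) \<in> Arr M" using u by (cases u) (auto simp: Hom_iff)
      have "\<phi> (fst m') (fst n) (f \<bullet> farr S (farr U u)) = ?g \<bullet> farr U u"
        using \<phi>.tr_precomp[of "farr U u" f "fst n" "fst m'"] u f' by (simp add: Hom_iff)
      then show ?thesis
        using em_comp[OF u' gM] em_comp[OF cofree_arr fM, of "farr U u" "fst m'"] u
        by (auto simp: balanced_def Hom_iff)
    qed
    show "farr U v \<bullet> f \<in> balanced m n'" if v: "v \<in> Hom M n n'" for v n'
    proof -
      have v': "(n, farr U v, n') \<in> Arr M" using v by (cases v) (auto simp: Hom_iff)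
      have "farr F (farr U v) = (fobj F (fst n), farr T (farr U v), fobj F (fst n'))"
        using v by (simp add: em_free_def Hom_iff)
      then have Fv: "(fobj F (fst n), farr T (farr U v), fobj F (fst n')) \<in> Arr M"
        using em_free_arr(1)[of "farr U v"] v by (simp add: Hom_iff)
      have "\<phi> (fst m) (fst n') (farr U v \<bullet> f) = farr T (farr U v) \<bullet> ?g"
        using \<phi>.tr_postcomp[of "farr U v" f "fst m" "fst n'"] v f' by (simp add: Hom_iff)
      then show ?thesis
        using em_comp[OF gM Fv] em_comp[OF fM v'] f' by (simp add: balanced_def)
    qed
  qed
qed


context ambidextrous
begin

subsection \<open>Universal elements of the bimodule\<close>

lemma act_balanced:
  assumes x: "x \<in> Obj B"
  shows "act x \<in> balanced (fobj F x) (cofree x)"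
proof -
  have "\<phi> (fobj T x) (fobj S x) (act x) = \<mu> (fobj S x) \<bullet> farr T (\<phi>.unit x)"
    using \<phi>_coextend[of "fobj T x" "\<phi>.counit x" x] x by (simp add: act_def)
  then show ?thesis
    using em_extend(1)[of "\<phi>.unit x" x "fobj F (fobj S x)"] act_em_arr[OF x] x
    by (simp add: balanced_def)
qed

text \<open>The arrow \<open>act x\<close> is split by \<open>S (\<eta> x)\<close>, so the only candidate for the factorization of \<open>f\<close>
  is \<open>f \<bullet> S (\<eta> x)\<close>. It works because the transpose of \<open>f\<close>, being a linear arrow out of a free
  module, is determined by its restriction along \<open>\<eta> x\<close>.\<close>

lemma act_universal_from:
  assumes x: "x \<in> Obj B"
  shows "P.universal_from (fobj F x) (cofree x) (act x)"
  unfolding P.universal_from_def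
proof (intro conjI allI ballI act_balanced[OF x])
  fix n f assume f: "f \<in> balanced (fobj F x) n"
  note f' = balanced_arr[OF f]
  let ?y = "fst n"
  let ?h = "f \<bullet> farr S (\<eta> x)"
  have fM: "(cofree (fobj T x), f, n) \<in> Arr M" using f by (simp add: balanced_def)
  have hM: "(cofree x, ?h, n) \<in> Arr M"
    using x by (intro em_comp[OF cofree_arr fM]) simp_all
  have h: "?h \<in> Arr B" "Dom B ?h = fobj S x" "Cod B ?h = ?y" using hM by (auto simp: em_arr_iff)
  let ?g = "\<phi> (fobj T x) ?y f"
  have g: "?g \<in> Arr B" "Dom B ?g = fobj T x" "Cod B ?g = fobj T ?y" using f' x by simp_all
  have gM: "(fobj F x, ?g, fobj F ?y) \<in> Arr M" using f by (simp add: balanced_def)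
  have g_lin: "?g \<bullet> \<mu> x = \<mu> ?y \<bullet> farr T ?g" using em_linear[OF gM refl refl] by simp
  have ha: "?h \<bullet> act x = f"
  proof (rule \<phi>.tr_inj)
    have "\<phi> (fobj T x) ?y (?h \<bullet> act x) = \<mu> ?y \<bullet> farr T (\<phi> x ?y ?h)"
      using \<phi>_act[OF x h] .
    also have "\<phi> x ?y ?h = ?g \<bullet> \<eta> x"
      using \<phi>.tr_precomp[of "\<eta> x" f ?y x] f' x by simp
    also have "\<mu> ?y \<bullet> farr T (?g \<bullet> \<eta> x) = (\<mu> ?y \<bullet> farr T ?g) \<bullet> farr T (\<eta> x)"
      using g x f'(2) by simp
    also have "\<dots> = ?g \<bullet> (\<mu> x \<bullet> farr T (\<eta> x))"
      unfolding g_lin[symmetric] using g x by simp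
    also have "\<dots> = ?g" using g x mult_unit_right[OF x] by simp
    finally show "\<phi> (fobj T x) ?y (?h \<bullet> act x) = \<phi> (fobj T x) ?y f" .
  qed (use x h f' in simp_all)
  show "\<exists>!h. h \<in> Hom M (cofree x) n \<and> farr U h \<bullet> act x = f"
  proof (rule ex_ex1I)
    show "\<exists>h. h \<in> Hom M (cofree x) n \<and> farr U h \<bullet> act x = f"
      using hM ha by (intro exI[of _ "(cofree x, ?h, n)"]) (simp add: Hom_iff)
  next
    have retract: "farr U k = ?h" if k: "k \<in> Hom M (cofree x) n" "farr U k \<bullet> act x = f" for k
    proof -
      have "farr U k = farr U k \<bullet> (act x \<bullet> farr S (\<eta> x))"
        using k(1) x by (simp add: act_unit Hom_iff)
      also have "\<dots> = (farr U k \<bullet> act x) \<bullet> farr S (\<eta> x)" using k(1) x by (simp add: Hom_iff)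
      finally show ?thesis by (simp add: k(2))
    qed
    fix k k' assume "k \<in> Hom M (cofree x) n \<and> farr U k \<bullet> act x = f"
      "k' \<in> Hom M (cofree x) n \<and> farr U k' \<bullet> act x = f"
    then show "k = k'" using retract[of k] retract[of k'] by (intro em_eqI) (simp_all add: Hom_iff)
  qed
qed

text \<open>Arrows into a cofree module are determined by their composite with \<open>\<epsilon> x\<close>, and \<open>\<epsilon> x \<bullet> act x\<close> is
  the counit of \<open>\<phi>\<close>. So factoring \<open>f\<close> through \<open>act x\<close> amounts to transposing \<open>\<epsilon> x \<bullet> f\<close>.\<close>

lemma act_universal_to:
  assumes x: "x \<in> Obj B"
  shows "P.universal_to (fobj F x) (cofree x) (act x)"
  unfolding P.universal_to_def
proof (intro conjI allI ballI act_balanced[OF x])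
  fix m f assume f: "f \<in> balanced m (cofree x)"
  note f' = balanced_arr[OF f]
  let ?z = "fst m"
  let ?g = "\<phi> ?z x (\<epsilon> x \<bullet> f)"
  have fM: "(cofree ?z, f, cofree x) \<in> Arr M" and phi_f: "(m, \<phi> ?z (fobj S x) f, fobj F (fobj S x)) \<in> Arr M"
    using f by (simp_all add: balanced_def)
  have g: "?g \<in> Arr B" "Dom B ?g = ?z" "Cod B ?g = fobj T x" using f' x by simp_all
  have T_eps: "(fobj F (fobj S x), farr T (\<epsilon> x), fobj F x) \<in> Arr M"
    using em_free_arr(1)[of "\<epsilon> x"] x by (simp add: em_free_def)
  have "?g = farr T (\<epsilon> x) \<bullet> \<phi> ?z (fobj S x) f"
    using \<phi>.tr_postcomp[of "\<epsilon> x" f ?z x] f' x by simp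
  then have gM: "(m, ?g, fobj F x) \<in> Arr M" using em_comp[OF phi_f T_eps] by simp
  have counit: "\<epsilon> x \<bullet> (act x \<bullet> farr S k) = \<phi>.counit x \<bullet> farr S k"
    if "k \<in> Arr B" "Cod B k = fobj T x" for k
  proof -
    have "\<epsilon> x \<bullet> (act x \<bullet> farr S k) = (\<epsilon> x \<bullet> act x) \<bullet> farr S k" using that x by simp
    then show ?thesis by (simp add: counit_act[OF x])
  qed
  have ga: "act x \<bullet> farr S ?g = f"
  proof (rule cofree_eqI[OF _ fM x])
    show "(cofree ?z, act x \<bullet> farr S ?g, cofree x) \<in> Arr M"
      using g by (intro em_comp[OF cofree_arr act_em_arr[OF x]]) simp_all
    show "\<epsilon> x \<bullet> (act x \<bullet> farr S ?g) = \<epsilon> x \<bullet> f"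
      using counit[OF g(1,3)] \<phi>.counit_tr[of ?z "\<epsilon> x \<bullet> f" x] f' x by simp
  qed
  show "\<exists>!g. g \<in> Hom M m (fobj F x) \<and> act x \<bullet> farr (S \<circ>\<^sub>F U) g = f"
  proof (rule ex_ex1I)
    show "\<exists>g. g \<in> Hom M m (fobj F x) \<and> act x \<bullet> farr (S \<circ>\<^sub>F U) g = f"
      using gM ga by (intro exI[of _ "(m, ?g, fobj F x)"]) (simp add: Hom_iff)
  next
    have determined: "farr U k = ?g" if k: "k \<in> Hom M m (fobj F x)" "act x \<bullet> farr S (farr U k) = f" for k
      using \<phi>.tr_counit[of "farr U k" ?z x] counit[of "farr U k"] k x by (simp add: Hom_iff)
    fix k k' assume "k \<in> Hom M m (fobj F x) \<and> act x \<bullet> farr (S \<circ>\<^sub>F U) k = f"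
      "k' \<in> Hom M m (fobj F x) \<and> act x \<bullet> farr (S \<circ>\<^sub>F U) k' = f"
    then show "k = k'" using determined[of k] determined[of k'] by (intro em_eqI) (simp_all add: Hom_iff)
  qed
qed

text \<open>The representing object is the tensor product \<open>S \<otimes>\<^sub>T m\<close>: the coequalizer, formed among modules,
  of the actions of \<open>T\<close> on its two factors.\<close>

lemma balanced_represented_left:
  assumes "abelian_category M" and m: "m \<in> Obj M"
  shows "\<exists>n p. P.universal_from m n p"
proof -
  interpret AM: abelian_category M by fact
  define G where "G = cofree (fst m)"
  define f where "f = (cofree (fobj T (fst m)), farr S (snd m), G)"
  define g where "g = (cofree (fobj T (fst m)), act (fst m), G)"
  have f: "f \<in> Hom M (cofree (fobj T (fst m))) G" and g: "g \<in> Hom M (cofree (fobj T (fst m))) G"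
    using cofree_arr[of "snd m"] act_em_arr[of "fst m"] m by (simp_all add: f_def g_def G_def Hom_iff)
  obtain n c where c: "c \<in> Hom M G n" "c \<cdot>\<^bsub>M\<^esub> f = c \<cdot>\<^bsub>M\<^esub> g"
    and univ: "\<And>z h. \<lbrakk>h \<in> Hom M G z; h \<cdot>\<^bsub>M\<^esub> f = h \<cdot>\<^bsub>M\<^esub> g\<rbrakk> \<Longrightarrow> \<exists>!u. u \<in> Hom M n z \<and> u \<cdot>\<^bsub>M\<^esub> c = h"
    by (rule AM.ex_coequalizer[OF f g], rule that)
  have coeq: "h \<cdot>\<^bsub>M\<^esub> f = h \<cdot>\<^bsub>M\<^esub> g \<longleftrightarrow> farr U h \<in> balanced m z" if h: "h \<in> Hom M G z" for h z
  proof -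
    have "(G, farr U h, z) \<in> Arr M" using h by (cases h) (auto simp: Hom_iff)
    then have "farr U h \<in> balanced m z \<longleftrightarrow> farr U (h \<cdot>\<^bsub>M\<^esub> f) = farr U (h \<cdot>\<^bsub>M\<^esub> g)"
      using balanced_iff_coequalizes[OF m, of "farr U h" z] by (simp add: G_def f_def g_def)
    moreover have "Dom M (h \<cdot>\<^bsub>M\<^esub> f) = Dom M (h \<cdot>\<^bsub>M\<^esub> g)" "Cod M (h \<cdot>\<^bsub>M\<^esub> f) = Cod M (h \<cdot>\<^bsub>M\<^esub> g)"
      using f g h by (simp_all add: Hom_iff)
    ultimately show ?thesis using em_eqI by metis
  qed
  have "P.universal_from m n (farr U c)"
    unfolding P.universal_from_def
  proof (intro conjI allI ballI)
    show "farr U c \<in> balanced m n" using coeq[OF c(1)] c(2) by blast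
    fix z k assume k: "k \<in> balanced m z"
    then have h: "(G, k, z) \<in> Hom M G z" by (simp add: balanced_def G_def Hom_iff)
    then have "\<exists>!u. u \<in> Hom M n z \<and> u \<cdot>\<^bsub>M\<^esub> c = (G, k, z)"
      using univ[OF h] coeq[OF h] k by simp
    moreover have "u \<cdot>\<^bsub>M\<^esub> c = (G, k, z) \<longleftrightarrow> farr U u \<bullet> farr U c = k" if "u \<in> Hom M n z" for u
    proof
      assume "u \<cdot>\<^bsub>M\<^esub> c = (G, k, z)"
      from arg_cong[OF this, of "farr U"] show "farr U u \<bullet> farr U c = k" by simp
    next
      assume "farr U u \<bullet> farr U c = k"
      then show "u \<cdot>\<^bsub>M\<^esub> c = (G, k, z)" by (intro em_eqI) (use that c(1) in \<open>simp_all add: Hom_iff\<close>)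
    qed
    ultimately show "\<exists>!h. h \<in> Hom M n z \<and> farr U h \<bullet> farr U c = k" by metis
  qed
  then show ?thesis by blast
qed

text \<open>The representing object is the equalizer of the morphisms \<open>F y \<rightarrow> F (S y)\<close> that express
  linearity of an arrow \<open>S x \<rightarrow> y\<close> in terms of its transpose.\<close>

lemma balanced_represented_right:
  assumes "abelian_category M" and n: "n \<in> Obj M"
  shows "\<exists>m q. P.universal_to m n q"
proof -
  interpret AM: abelian_category M by fact
  define y where "y = fst n"
  have y: "y \<in> Obj B" using n by (simp add: y_def)
  define f where "f = farr F (coaction n)"
  define g where "g = (fobj F y, \<mu> (fobj S y) \<bullet> farr T (\<phi>.unit y), fobj F (fobj S y))"
  have f: "f \<in> Hom M (fobj F y) (fobj F (fobj S y))" and g: "g \<in> Hom M (fobj F y) (fobj F (fobj S y))"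
    using em_extend(1)[of "\<phi>.unit y" y "fobj F (fobj S y)"] n y by (simp_all add: f_def g_def y_def Hom_iff)
  obtain m k where k: "k \<in> Hom M m (fobj F y)" "f \<cdot>\<^bsub>M\<^esub> k = g \<cdot>\<^bsub>M\<^esub> k"
    and univ: "\<And>z h. \<lbrakk>h \<in> Hom M z (fobj F y); f \<cdot>\<^bsub>M\<^esub> h = g \<cdot>\<^bsub>M\<^esub> h\<rbrakk> \<Longrightarrow> \<exists>!u. u \<in> Hom M z m \<and> k \<cdot>\<^bsub>M\<^esub> u = h"
    by (rule AM.ex_equalizer[OF f g], rule that)
  have eq: "f \<cdot>\<^bsub>M\<^esub> h = g \<cdot>\<^bsub>M\<^esub> h \<longleftrightarrow> j \<in> balanced z n"
    if h: "h \<in> Hom M z (fobj F y)" and j: "j \<in> Arr B" "Dom B j = fobj S (fst z)" "Cod B j = y"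
      "\<phi> (fst z) y j = farr U h" for h z j
  proof -
    have z: "z \<in> Obj M" using h by (auto simp: Hom_iff)
    have "(z, farr U h, fobj F y) \<in> Arr M" using h by (cases h) (auto simp: Hom_iff)
    then have "j \<in> balanced z n \<longleftrightarrow> farr U (f \<cdot>\<^bsub>M\<^esub> h) = farr U (g \<cdot>\<^bsub>M\<^esub> h)"
      using balanced_iff_equalizes[OF z n, of j] j h y by (simp add: f_def g_def y_def Hom_iff)
    moreover have "Dom M (f \<cdot>\<^bsub>M\<^esub> h) = Dom M (g \<cdot>\<^bsub>M\<^esub> h)" "Cod M (f \<cdot>\<^bsub>M\<^esub> h) = Cod M (g \<cdot>\<^bsub>M\<^esub> h)"
      using f g h by (simp_all add: Hom_iff)
    ultimately show ?thesis using em_eqI by metis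
  qed
  have m: "m \<in> Obj M" using k(1) by (auto simp: Hom_iff)
  define q where "q = \<phi>.untr (fst m) y (farr U k)"
  have q: "q \<in> Arr B" "Dom B q = fobj S (fst m)" "Cod B q = y" "\<phi> (fst m) y q = farr U k"
    using \<phi>.untr[of "farr U k" "fst m" y] k(1) y by (simp_all add: q_def Hom_iff)
  have "P.universal_to m n q"
    unfolding P.universal_to_def
  proof (intro conjI allI ballI)
    show "q \<in> balanced m n" using eq[OF k(1) q] k(2) by blast
    fix z j assume j: "j \<in> balanced z n"
    note j' = balanced_arr[OF j]
    let ?h = "(z, \<phi> (fst z) y j, fobj F y)"
    have h: "?h \<in> Hom M z (fobj F y)" using j by (simp add: balanced_def y_def Hom_iff)
    have "\<exists>!u. u \<in> Hom M z m \<and> k \<cdot>\<^bsub>M\<^esub> u = ?h"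
      using univ[OF h] eq[OF h, of j] j j' by (simp add: y_def)
    moreover have "k \<cdot>\<^bsub>M\<^esub> u = ?h \<longleftrightarrow> q \<bullet> farr (S \<circ>\<^sub>F U) u = j" if u: "u \<in> Hom M z m" for u
    proof -
      have "k \<cdot>\<^bsub>M\<^esub> u = ?h \<longleftrightarrow> farr U k \<bullet> farr U u = \<phi> (fst z) y j"
      proof
        assume "k \<cdot>\<^bsub>M\<^esub> u = ?h"
        from arg_cong[OF this, of "farr U"] show "farr U k \<bullet> farr U u = \<phi> (fst z) y j" by simp
      next
        assume "farr U k \<bullet> farr U u = \<phi> (fst z) y j"
        then show "k \<cdot>\<^bsub>M\<^esub> u = ?h" by (intro em_eqI) (use u k(1) in \<open>simp_all add: Hom_iff\<close>)
      qed
      also have "farr U k \<bullet> farr U u = \<phi> (fst z) y (q \<bullet> farr S (farr U u))"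
        using \<phi>.tr_precomp[of "farr U u" q y "fst z"] q u by (simp add: Hom_iff)
      also have "\<dots> = \<phi> (fst z) y j \<longleftrightarrow> q \<bullet> farr S (farr U u) = j"
        using \<phi>.tr_inj[of "fst z" y "q \<bullet> farr S (farr U u)" j] q(1-3) u j' by (auto simp: y_def Hom_iff)
      finally show ?thesis by simp
    qed
    ultimately show "\<exists>!g. g \<in> Hom M z m \<and> q \<bullet> farr (S \<circ>\<^sub>F U) g = j" by metis
  qed
  then show ?thesis by blast
qed

text \<open>As \<open>p (F x)\<close> and \<open>act x\<close> are both universal, \<open>\<nu> (F x)\<close> is isomorphic to the cofree module on
  \<open>x\<close> by an isomorphism \<open>w x\<close>. Transporting the counit \<open>\<epsilon> x\<close> of the cofree module along \<open>w x\<close> gives a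
  couniversal arrow for \<open>U\<close>.\<close>

lemma forgetful_adjoint_if_universal:
  assumes nu: "additive_functor M M \<nu>"
    and p: "\<And>x. x \<in> Obj B \<Longrightarrow> P.universal_from (fobj F x) (fobj \<nu> (fobj F x)) (p (fobj F x))"
    and p_nat: "\<And>u m m'. u \<in> Hom M m m' \<Longrightarrow> farr U (farr \<nu> u) \<bullet> p m = p m' \<bullet> farr (S \<circ>\<^sub>F U) u"
  shows "\<exists>\<psi>. adjunction M B U (\<nu> \<circ>\<^sub>F F) \<psi>"
proof -
  interpret \<nu>: additive_functor M M \<nu> by (rule nu)
  have nuF_obj: "x \<in> Obj B \<Longrightarrow> fobj \<nu> (fobj F x) \<in> Obj M" for x by (intro \<nu>.fobj_obj) simp
  have "\<exists>w w'. w \<in> Hom M (fobj \<nu> (fobj F x)) (cofree x) \<and> w' \<in> Hom M (cofree x) (fobj \<nu> (fobj F x)) \<and>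
      farr U w \<bullet> p (fobj F x) = act x \<and> w' \<cdot>\<^bsub>M\<^esub> w = Ident M (fobj \<nu> (fobj F x)) \<and>
      w \<cdot>\<^bsub>M\<^esub> w' = Ident M (cofree x)" if x: "x \<in> Obj B" for x
    using P.universal_from_iso[OF p[OF x] act_universal_from[OF x]] by metis
  then obtain w w' where w: "\<And>x. x \<in> Obj B \<Longrightarrow> w x \<in> Hom M (fobj \<nu> (fobj F x)) (cofree x)"
    and w': "\<And>x. x \<in> Obj B \<Longrightarrow> w' x \<in> Hom M (cofree x) (fobj \<nu> (fobj F x))"
    and wp: "\<And>x. x \<in> Obj B \<Longrightarrow> farr U (w x) \<bullet> p (fobj F x) = act x"
    and w'w: "\<And>x. x \<in> Obj B \<Longrightarrow> w' x \<cdot>\<^bsub>M\<^esub> w x = Ident M (fobj \<nu> (fobj F x))"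
    and ww': "\<And>x. x \<in> Obj B \<Longrightarrow> w x \<cdot>\<^bsub>M\<^esub> w' x = Ident M (cofree x)"
    by metis
  have w_arr: "w x \<in> Arr M" "Dom M (w x) = fobj \<nu> (fobj F x)" "Cod M (w x) = cofree x"
    "w' x \<in> Arr M" "Dom M (w' x) = cofree x" "Cod M (w' x) = fobj \<nu> (fobj F x)" if "x \<in> Obj B" for x
    using w[OF that] w'[OF that] by (simp_all add: Hom_iff)
  show ?thesis
  proof (rule adjunction_if_couniversal[of M B U "\<nu> \<circ>\<^sub>F F" "\<lambda>x. \<epsilon> x \<bullet> farr U (w x)"])
    show "additive_functor M B U" by (rule em_forgetful_functor)
    show "additive_functor B M (\<nu> \<circ>\<^sub>F F)" by (rule additive_functor_comp[OF em_free_functor nu])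
    show "\<epsilon> x \<bullet> farr U (w x) \<in> Hom B (fobj U (fobj (\<nu> \<circ>\<^sub>F F) x)) x" if "x \<in> Obj B" for x
      using that w_arr[OF that] by (simp add: Hom_iff)
  next
    fix u x y assume u: "u \<in> Hom B x y"
    have x: "x \<in> Obj B" and y: "y \<in> Obj B" using u by (auto simp: Hom_iff)
    have u': "u \<in> Arr B" "Dom B u = x" "Cod B u = y" using u by (auto simp: Hom_iff)
    let ?nFu = "farr \<nu> (farr F u)"
    have nFu: "?nFu \<in> Hom M (fobj \<nu> (fobj F x)) (fobj \<nu> (fobj F y))"
      using u' by (simp add: Hom_iff)
    let ?Gu = "(cofree x, farr S u, cofree y)"
    have Gu: "?Gu \<in> Arr M" by (rule cofree_arr[OF u'])
    have p_arr: "p (fobj F z) \<in> balanced (fobj F z) (fobj \<nu> (fobj F z))" if "z \<in> Obj B" for z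
      using P.universal_fromD(1)[OF p[OF that]] .
    have "w y \<cdot>\<^bsub>M\<^esub> ?nFu = ?Gu \<cdot>\<^bsub>M\<^esub> w x"
    proof (rule P.universal_fromD(3)[OF p[OF x], of _ "cofree y"])
      show "w y \<cdot>\<^bsub>M\<^esub> ?nFu \<in> Hom M (fobj \<nu> (fobj F x)) (cofree y)"
        using nFu w_arr[OF y] by (simp add: Hom_iff)
      show "?Gu \<cdot>\<^bsub>M\<^esub> w x \<in> Hom M (fobj \<nu> (fobj F x)) (cofree y)"
        using Gu w_arr[OF x] by (simp add: Hom_iff)
      have "farr U (w y \<cdot>\<^bsub>M\<^esub> ?nFu) \<bullet> p (fobj F x) = farr U (w y) \<bullet> (farr U ?nFu \<bullet> p (fobj F x))"
        using nFu w_arr[OF y] balanced_arr[OF p_arr[OF x]] by (simp add: Hom_iff)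
      also have "farr U ?nFu \<bullet> p (fobj F x) = p (fobj F y) \<bullet> farr S (farr T u)"
        using p_nat[of "farr F u" "fobj F x" "fobj F y"] u' by (simp add: Hom_iff)
      also have "farr U (w y) \<bullet> (p (fobj F y) \<bullet> farr S (farr T u)) = (farr U (w y) \<bullet> p (fobj F y)) \<bullet> farr S (farr T u)"
        using u' w_arr[OF y] balanced_arr[OF p_arr[OF y]] by simp
      also have "\<dots> = farr S u \<bullet> (farr U (w x) \<bullet> p (fobj F x))"
        unfolding wp[OF y] wp[OF x] by (rule act_natural[OF u'])
      also have "\<dots> = farr U (?Gu \<cdot>\<^bsub>M\<^esub> w x) \<bullet> p (fobj F x)"
        using u' x w_arr[OF x] balanced_arr[OF p_arr[OF x]] by simp
      finally show "farr U (w y \<cdot>\<^bsub>M\<^esub> ?nFu) \<bullet> p (fobj F x) = farr U (?Gu \<cdot>\<^bsub>M\<^esub> w x) \<bullet> p (fobj F x)" .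
    qed
    then have w_nat: "farr U (w y) \<bullet> farr U ?nFu = farr S u \<bullet> farr U (w x)"
      by (metis em_forget_comp(1) em_forgetful_simps(2))
    have "(\<epsilon> y \<bullet> farr U (w y)) \<bullet> farr U ?nFu = \<epsilon> y \<bullet> (farr U (w y) \<bullet> farr U ?nFu)"
      using y w_arr[OF y] nFu by (simp add: Hom_iff)
    also have "\<dots> = (\<epsilon> y \<bullet> farr S u) \<bullet> farr U (w x)"
      unfolding w_nat using y u' w_arr[OF x] by simp
    also have "\<dots> = (u \<bullet> \<epsilon> x) \<bullet> farr U (w x)" using \<epsilon>.naturality[OF u'] by simp
    also have "\<dots> = u \<bullet> (\<epsilon> x \<bullet> farr U (w x))" using x u' w_arr[OF x] by simp
    finally show "\<epsilon> y \<bullet> farr U (w y) \<bullet> farr U (farr (\<nu> \<circ>\<^sub>F F) u) = u \<bullet> (\<epsilon> x \<bullet> farr U (w x))" by simp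
  next
    fix m x f assume m: "m \<in> Obj M" and f: "f \<in> Hom B (fobj U m) x"
    have x: "x \<in> Obj B" and f': "f \<in> Arr B" "Dom B f = fst m" "Cod B f = x" using f by (auto simp: Hom_iff)
    let ?h = "(m, farr S f \<bullet> coaction m, cofree x)"
    have h: "?h \<in> Arr M" "\<epsilon> x \<bullet> (farr S f \<bullet> coaction m) = f" using cofree_extend[OF m f'] .
    have counit: "(\<epsilon> x \<bullet> farr U (w x)) \<bullet> farr U g = \<epsilon> x \<bullet> farr U (w x \<cdot>\<^bsub>M\<^esub> g)"
      if "g \<in> Hom M m (fobj \<nu> (fobj F x))" for g
      using that x w_arr[OF x] by (simp add: Hom_iff)
    show "\<exists>!g. g \<in> Hom M m (fobj (\<nu> \<circ>\<^sub>F F) x) \<and> (\<epsilon> x \<bullet> farr U (w x)) \<bullet> farr U g = f"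
    proof (rule ex_ex1I)
      have g: "w' x \<cdot>\<^bsub>M\<^esub> ?h \<in> Hom M m (fobj \<nu> (fobj F x))"
        using h(1) w_arr[OF x] by (simp add: Hom_iff)
      have "w x \<cdot>\<^bsub>M\<^esub> (w' x \<cdot>\<^bsub>M\<^esub> ?h) = (w x \<cdot>\<^bsub>M\<^esub> w' x) \<cdot>\<^bsub>M\<^esub> ?h" using h(1) w_arr[OF x] by simp
      also have "\<dots> = ?h" unfolding ww'[OF x] using h(1) by simp
      finally have "(\<epsilon> x \<bullet> farr U (w x)) \<bullet> farr U (w' x \<cdot>\<^bsub>M\<^esub> ?h) = f"
        unfolding counit[OF g] using h(2) by simp
      then show "\<exists>g. g \<in> Hom M m (fobj (\<nu> \<circ>\<^sub>F F) x) \<and> (\<epsilon> x \<bullet> farr U (w x)) \<bullet> farr U g = f"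
        using g by (intro exI[of _ "w' x \<cdot>\<^bsub>M\<^esub> ?h"]) simp
    next
      fix g g'
      assume "g \<in> Hom M m (fobj (\<nu> \<circ>\<^sub>F F) x) \<and> (\<epsilon> x \<bullet> farr U (w x)) \<bullet> farr U g = f"
        "g' \<in> Hom M m (fobj (\<nu> \<circ>\<^sub>F F) x) \<and> (\<epsilon> x \<bullet> farr U (w x)) \<bullet> farr U g' = f"
      then have g: "g \<in> Hom M m (fobj \<nu> (fobj F x))" "g' \<in> Hom M m (fobj \<nu> (fobj F x))"
        and eq: "\<epsilon> x \<bullet> farr U (w x \<cdot>\<^bsub>M\<^esub> g) = \<epsilon> x \<bullet> farr U (w x \<cdot>\<^bsub>M\<^esub> g')"
        using counit[of g] counit[of g'] by simp_all
      have wg: "w x \<cdot>\<^bsub>M\<^esub> g \<in> Hom M m (cofree x)" "w x \<cdot>\<^bsub>M\<^esub> g' \<in> Hom M m (cofree x)"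
        using g w_arr[OF x] by (simp_all add: Hom_iff)
      have tuple: "(m, farr U h, cofree x) \<in> Arr M" if "h \<in> Hom M m (cofree x)" for h
        using that by (cases h) (auto simp: Hom_iff)
      have "w x \<cdot>\<^bsub>M\<^esub> g = w x \<cdot>\<^bsub>M\<^esub> g'"
        using cofree_eqI[OF tuple[OF wg(1)] tuple[OF wg(2)] x eq] wg
        by (intro em_eqI) (simp_all only: Hom_iff)
      then have "(w' x \<cdot>\<^bsub>M\<^esub> w x) \<cdot>\<^bsub>M\<^esub> g = (w' x \<cdot>\<^bsub>M\<^esub> w x) \<cdot>\<^bsub>M\<^esub> g'"
        using g w_arr[OF x] by (simp add: Hom_iff)
      then show "g = g'" unfolding w'w[OF x] using g by (simp add: Hom_iff)
    qed
  qed
qed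

lemma has_nakayama_functor:
  assumes "abelian_category B"
  shows "has_nakayama_functor B M F U (em_adj B \<eta>)"
proof -
  have abelian: "abelian_category M"
    by (rule em_abelian[OF assms \<psi>.left_adjoint_cokernel])
  obtain \<nu> \<nu>' \<theta> p q where adj: "adjunction M M \<nu> \<nu>' \<theta>"
    and p: "\<And>m. m \<in> Obj M \<Longrightarrow> P.universal_from m (fobj \<nu> m) (p m)"
    and p_nat: "\<And>u m m'. u \<in> Hom M m m' \<Longrightarrow> farr U (farr \<nu> u) \<bullet> p m = p m' \<bullet> farr (S \<circ>\<^sub>F U) u"
    and q: "\<And>n. n \<in> Obj M \<Longrightarrow> P.universal_to (fobj \<nu>' n) n (q n)"
    and q_tr: "\<And>m n h. \<lbrakk>m \<in> Obj M; h \<in> Hom M (fobj \<nu> m) n\<rbrakk> \<Longrightarrow>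
      q n \<bullet> farr (S \<circ>\<^sub>F U) (\<theta> m n h) = farr U h \<bullet> p m"
    by (rule P.representable_adjunction, erule balanced_represented_left[OF abelian],
        erule balanced_represented_right[OF abelian], rule that)
  interpret \<theta>: adjunction M M \<nu> \<nu>' \<theta> by (rule adj)
  have iso: "is_iso M (adj_unit M \<nu> \<theta> (fobj F x))" if x: "x \<in> Obj B" for x
  proof -
    let ?m = "fobj F x"
    have m: "?m \<in> Obj M" and nm: "fobj \<nu> ?m \<in> Obj M" using x \<theta>.L.fobj_obj[of ?m] by simp_all
    have to: "P.universal_to ?m (fobj \<nu> ?m) (p ?m)"
      by (rule P.universal_to_transfer[OF p[OF m] act_universal_from[OF x] act_universal_to[OF x]])
    have "q (fobj \<nu> ?m) \<bullet> farr (S \<circ>\<^sub>F U) (\<theta>.unit ?m) = p ?m"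
      using q_tr[of ?m "Ident M (fobj \<nu> ?m)" "fobj \<nu> ?m"] m nm balanced_arr[OF P.universal_fromD(1)[OF p[OF m]]]
      by (simp add: adj_unit_def Hom_iff)
    then show ?thesis
      by (intro P.universal_to_iso[OF to q[OF nm]]) (use m in \<open>simp_all add: Hom_iff\<close>)
  qed
  have right: "\<exists>\<psi>. adjunction M B U (\<nu> \<circ>\<^sub>F F) \<psi>"
    by (rule forgetful_adjoint_if_universal[of \<nu> p, OF \<theta>.L.additive_functor_axioms p p_nat]) simp_all
  interpret B: abelian_category B by (rule assms)
  interpret AM: abelian_category M by (rule abelian)
  interpret FU: adjunction B M F U "em_adj B \<eta>" by (rule em_adjunction)
  have "nakayama_setting B M F U (em_adj B \<eta>)"
    by unfold_locales (rule em_forgetful_faithful)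
  then have "nakayama_functor B M F U (em_adj B \<eta>) \<nu>"
    unfolding nakayama_functor_def
    using right adj iso \<theta>.L.additive_functor_axioms by blast
  then show ?thesis unfolding has_nakayama_functor_def by blast
qed

end

section \<open>Nakayama functors and ambidextrous adjunctions\<close>

theorem theorem1p1p3:
  fixes B :: "('o, 'a) cat" and T :: "('o, 'a, 'o, 'a) func" and \<eta> \<mu> :: "'o \<Rightarrow> 'a"
  assumes "abelian_category B" and "monad B T \<eta> \<mu>"
  shows "has_nakayama_functor B (em_category B T \<eta> \<mu>) (em_free B T \<mu>) em_forgetful (em_adj B \<eta>)
    \<longleftrightarrow> (\<exists>S \<epsilon> \<Delta>. comonad B S \<epsilon> \<Delta> \<and> ambidextrous_adjunction B S \<epsilon> \<Delta> T \<eta> \<mu>)"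
proof
  assume "has_nakayama_functor B (em_category B T \<eta> \<mu>) (em_free B T \<mu>) em_forgetful (em_adj B \<eta>)"
  then show "\<exists>S \<epsilon> \<Delta>. comonad B S \<epsilon> \<Delta> \<and> ambidextrous_adjunction B S \<epsilon> \<Delta> T \<eta> \<mu>"
    using monad.nakayama_imp_ambidextrous[OF assms(2)] unfolding has_nakayama_functor_def by blast
next
  assume "\<exists>S \<epsilon> \<Delta>. comonad B S \<epsilon> \<Delta> \<and> ambidextrous_adjunction B S \<epsilon> \<Delta> T \<eta> \<mu>"
  then obtain S \<epsilon> \<Delta> \<phi> \<psi> where com: "comonad B S \<epsilon> \<Delta>"
    and adj: "adjunction B B S T \<phi>" "adjunction B B T S \<psi>"
    and conj: "conjugate B B S T \<phi> (S \<circ>\<^sub>F S) (T \<circ>\<^sub>F T) (comp_adj S T \<phi> \<phi>) \<Delta> \<mu>"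
      "conjugate B B S T \<phi> id_func id_func id_adj \<epsilon> \<eta>"
      "conjugate B B (T \<circ>\<^sub>F T) (S \<circ>\<^sub>F S) (comp_adj T S \<psi> \<psi>) T S \<psi> \<mu> \<Delta>"
      "conjugate B B id_func id_func id_adj T S \<psi> \<eta> \<epsilon>"
    unfolding ambidextrous_adjunction_def comonad_left_adjoint_monad_def monad_left_adjoint_comonad_def
    by blast
  interpret monad B T \<eta> \<mu> by (rule assms(2))
  have obj: "x \<in> Obj B" "y \<in> Obj B" if "h \<in> Hom B x y" for h x y
    using that by (auto simp: Hom_iff)
  interpret ambidextrous B T S \<eta> \<mu> \<epsilon> \<Delta> \<phi> \<psi>
  proof (intro ambidextrous.intro ambidextrous_axioms.intro assms(2) com adj)
    show "\<phi> x y (h \<cdot>\<^bsub>B\<^esub> \<Delta> x) = \<mu> y \<cdot>\<^bsub>B\<^esub> \<phi> x (fobj T y) (\<phi> (fobj S x) y h)"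
      if "x \<in> Obj B" "h \<in> Hom B (fobj S (fobj S x)) y" for x y h
      using conj(1) that obj[OF that(2)] unfolding conjugate_def comp_adj_def by simp
    show "\<phi> x y (h \<cdot>\<^bsub>B\<^esub> \<epsilon> x) = \<eta> y \<cdot>\<^bsub>B\<^esub> h" if "h \<in> Hom B x y" for x y h
      using conj(2) that obj[OF that] unfolding conjugate_def id_adj_def by simp
    show "\<psi> x (fobj S y) (\<psi> (fobj T x) y (h \<cdot>\<^bsub>B\<^esub> \<mu> x)) = \<Delta> y \<cdot>\<^bsub>B\<^esub> \<psi> x y h"
      if "x \<in> Obj B" "h \<in> Hom B (fobj T x) y" for x y h
      using conj(3) that obj[OF that(2)] unfolding conjugate_def comp_adj_def by simp
    show "h \<cdot>\<^bsub>B\<^esub> \<eta> x = \<epsilon> y \<cdot>\<^bsub>B\<^esub> \<psi> x y h" if "x \<in> Obj B" "h \<in> Hom B (fobj T x) y" for x y h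
      using conj(4) that obj[OF that(2)] unfolding conjugate_def id_adj_def by simp
  qed
  show "has_nakayama_functor B (em_category B T \<eta> \<mu>) (em_free B T \<mu>) em_forgetful (em_adj B \<eta>)"
    by (rule has_nakayama_functor[OF assms(1)])
qed

end
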